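(* Let $n\in\mathbb{N}$, $\mu,\nu\in\mathbb{R}$, $\alpha<0$, $\beta,\gamma,\delta\in\mathbb{R}\setminus\{0\}$ and $u_0,v_0\in H^2(\mathbb{R}^n)$. For all sufficiently small $\varepsilon>0$, $$\Omega^\varepsilon:=\sqrt{(\delta-\nu-\varepsilon^{-1}\alpha+\mu)^2+4\varepsilon^{-1}\beta\gamma}\in\mathbb{R}\setminus\{0\},$$ and there are real coefficients $\rho_1^\varepsilon,\dots,\rho_8^\varepsilon$, depending only on $\alpha,\beta,\gamma,\delta,\mu,\nu$ and $\varepsilon$, such that the solution of $$\varepsilon\partial_t u^\varepsilon=\varepsilon(\Delta-\mu I)u^\varepsilon+\alpha u^\varepsilon+\beta v^\varepsilon,\qquad \partial_t v^\varepsilon=(\Delta-\nu I)v^\varepsilon+\gamma u^\varepsilon+\delta v^\varepsilon,\qquad u^\varepsilon(0)=u_0,\ v^\varepsilon(0)=v_0$$ is given for $t>0$ by $$\begin{pmatrix}u^\varepsilon(t)\\ v^\varepsilon(t)\end{pmatrix}=\begin{pmatrix}[\rho_1^\varepsilon L_+^\varepsilon(t)+\rho_2^\varepsilon L_-^\varepsilon(t)]*u_0+[\rho_3^\varepsilon L_+^\varepsilon(t)+\rho_4^\varepsilon L_-^\varepsilon(t)]*v_0\\ [\rho_5^\varepsilon L_+^\varepsilon(t)+\rho_6^\varepsilon L_-^\varepsilon(t)]*u_0+[\rho_7^\varepsilon L_+^\varepsilon(t)+\rho_8^\varepsilon L_-^\varepsilon(t)]*v_0\end{pmatrix},$$ where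 $L_\pm^\varepsilon(t):=e^{(\varepsilon^{-1}\alpha-\mu+\delta-\nu\pm\Omega^\varepsilon)\frac t2}K_n(t)$.
   Context: $K_n(t)$ is the $n$-dimensional heat kernel $K_n(t)(x)=(4\pi t)^{-n/2}e^{-|x|^2/(4t)}$, $x\in\mathbb{R}^n$, $t>0$, and $*$ is convolution in the space variable. A solution is a pair $(u^\varepsilon,v^\varepsilon)$ continuous on $[0,\infty)$ with values in $H^2(\mathbb{R}^n)\times H^2(\mathbb{R}^n)$, continuously differentiable in time with values in $L^2(\mathbb{R}^n)\times L^2(\mathbb{R}^n)$, satisfying the equations in $L^2(\mathbb{R}^n)$ and the initial conditions. *)

theory Defs
  imports "HOL-Analysis.Analysis"
begin

text \<open>
  The coefficients in the theorem must not depend on the dimension, so \<open>n\<close> has to be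
  quantified inside the statement and cannot be a type. Hence \<open>\<real>\<^sup>n\<close> is the space of the product
  measure below: functions \<^typ>\<open>nat \<Rightarrow> real\<close> restricted to the index set \<open>{..<n}\<close>
  (and \<^const>\<open>undefined\<close> outside it), with \<open>n\<close>-dimensional Lebesgue--Borel measure. On this set
  the product topology of \<^typ>\<open>nat \<Rightarrow> real\<close> is the usual topology of \<open>\<real>\<^sup>n\<close>.
\<close>

definition Rn :: "nat \<Rightarrow> (nat \<Rightarrow> real) measure" where
  "Rn n = (\<Pi>\<^sub>M i\<in>{..<n}. lborel)"

definition heat_kernel :: "nat \<Rightarrow> real \<Rightarrow> (nat \<Rightarrow> real) \<Rightarrow> real" where
  "heat_kernel n t x =
     (4 * pi * t) powr (- real n / 2) * exp (- (L2_set x {..<n})\<^sup>2 / (4 * t))"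

definition conv ::
    "nat \<Rightarrow> ((nat \<Rightarrow> real) \<Rightarrow> real) \<Rightarrow> ((nat \<Rightarrow> real) \<Rightarrow> real) \<Rightarrow> (nat \<Rightarrow> real) \<Rightarrow> real" where
  "conv n f g x = (\<integral>y. f (\<lambda>i\<in>{..<n}. x i - y i) * g y \<partial>(Rn n))"


subsection \<open>Test functions\<close>

definition partial :: "nat \<Rightarrow> ((nat \<Rightarrow> real) \<Rightarrow> real) \<Rightarrow> (nat \<Rightarrow> real) \<Rightarrow> real" where
  "partial i f x = deriv (\<lambda>s. f (x(i := s))) (x i)"

text \<open>
  A derivative of order \<open>k\<close> is given by the list of its \<open>k\<close> directions; the lists of length \<open>k\<close>
  over \<open>{..<n}\<close> cover all multi-indices of order \<open>k\<close>.
\<close>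

primrec partials :: "nat list \<Rightarrow> ((nat \<Rightarrow> real) \<Rightarrow> real) \<Rightarrow> (nat \<Rightarrow> real) \<Rightarrow> real" where
  "partials [] f = f"
| "partials (i # is) f = partial i (partials is f)"

definition smooth :: "nat \<Rightarrow> ((nat \<Rightarrow> real) \<Rightarrow> real) \<Rightarrow> bool" where
  "smooth n f \<longleftrightarrow>
     (\<forall>is\<in>lists {..<n}.
        continuous_on (space (Rn n)) (partials is f) \<and>
        (\<forall>i<n. \<forall>x\<in>space (Rn n).
           (\<lambda>s. partials is f (x(i := s))) field_differentiable at (x i)))"

definition test_functions :: "nat \<Rightarrow> ((nat \<Rightarrow> real) \<Rightarrow> real) set" where
  "test_functions n =
     {\<phi>. smooth n \<phi> \<and> compact (closure {x \<in> space (Rn n). \<phi> x \<noteq> 0})}"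


subsection \<open>Sobolev spaces\<close>

text \<open>
  Elements of these spaces are representatives; they are identified when they agree almost
  everywhere, and every statement below respects this.
\<close>

definition L2 :: "nat \<Rightarrow> ((nat \<Rightarrow> real) \<Rightarrow> real) set" where
  "L2 n = {f \<in> borel_measurable (Rn n). integrable (Rn n) (\<lambda>x. (f x)\<^sup>2)}"

definition norm_L2 :: "nat \<Rightarrow> ((nat \<Rightarrow> real) \<Rightarrow> real) \<Rightarrow> real" where
  "norm_L2 n f = sqrt (\<integral>x. (f x)\<^sup>2 \<partial>(Rn n))"

definition has_weak_deriv ::
    "nat \<Rightarrow> nat list \<Rightarrow> ((nat \<Rightarrow> real) \<Rightarrow> real) \<Rightarrow> ((nat \<Rightarrow> real) \<Rightarrow> real) \<Rightarrow> bool" where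
  "has_weak_deriv n is u g \<longleftrightarrow>
     (\<forall>\<phi>\<in>test_functions n.
        (\<integral>x. u x * partials is \<phi> x \<partial>(Rn n)) = (- 1) ^ length is * (\<integral>x. g x * \<phi> x \<partial>(Rn n)))"

definition sobolev :: "nat \<Rightarrow> nat \<Rightarrow> ((nat \<Rightarrow> real) \<Rightarrow> real) set" where
  "sobolev n k =
     {u \<in> L2 n. \<forall>is\<in>lists {..<n}. length is \<le> k \<longrightarrow> (\<exists>g\<in>L2 n. has_weak_deriv n is u g)}"

abbreviation H2 :: "nat \<Rightarrow> ((nat \<Rightarrow> real) \<Rightarrow> real) set" where
  "H2 n \<equiv> sobolev n 2"

definition weak_deriv ::
    "nat \<Rightarrow> nat list \<Rightarrow> ((nat \<Rightarrow> real) \<Rightarrow> real) \<Rightarrow> (nat \<Rightarrow> real) \<Rightarrow> real" where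
  "weak_deriv n is u = (SOME g. g \<in> L2 n \<and> has_weak_deriv n is u g)"

text \<open>
  Mixed derivatives are counted once for every ordering of the directions, so the second-order
  part of the norm of \<open>H\<^sup>2\<close> is the \<open>L\<^sup>2\<close> norm of the Hessian.
\<close>

definition norm_sobolev :: "nat \<Rightarrow> nat \<Rightarrow> ((nat \<Rightarrow> real) \<Rightarrow> real) \<Rightarrow> real" where
  "norm_sobolev n k u =
     sqrt (\<Sum>is | is \<in> lists {..<n} \<and> length is \<le> k. (norm_L2 n (weak_deriv n is u))\<^sup>2)"

definition laplacian :: "nat \<Rightarrow> ((nat \<Rightarrow> real) \<Rightarrow> real) \<Rightarrow> (nat \<Rightarrow> real) \<Rightarrow> real" where
  "laplacian n u x = (\<Sum>i<n. weak_deriv n [i, i] u x)"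


subsection \<open>Solutions\<close>

definition continuous_into_H2 :: "nat \<Rightarrow> (real \<Rightarrow> (nat \<Rightarrow> real) \<Rightarrow> real) \<Rightarrow> bool" where
  "continuous_into_H2 n u \<longleftrightarrow>
     (\<forall>t\<ge>0. u t \<in> H2 n \<and>
        ((\<lambda>s. norm_sobolev n 2 (\<lambda>x. u s x - u t x)) \<longlongrightarrow> 0) (at t within {0..}))"

definition continuous_into_L2 :: "nat \<Rightarrow> (real \<Rightarrow> (nat \<Rightarrow> real) \<Rightarrow> real) \<Rightarrow> bool" where
  "continuous_into_L2 n u \<longleftrightarrow>
     (\<forall>t\<ge>0. u t \<in> L2 n \<and>
        ((\<lambda>s. norm_L2 n (\<lambda>x. u s x - u t x)) \<longlongrightarrow> 0) (at t within {0..}))"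

definition has_time_deriv_L2 ::
    "nat \<Rightarrow> (real \<Rightarrow> (nat \<Rightarrow> real) \<Rightarrow> real) \<Rightarrow> (real \<Rightarrow> (nat \<Rightarrow> real) \<Rightarrow> real) \<Rightarrow> bool" where
  "has_time_deriv_L2 n u u' \<longleftrightarrow>
     (\<forall>t\<ge>0. ((\<lambda>s. norm_L2 n (\<lambda>x. (u s x - u t x) / (s - t) - u' t x)) \<longlongrightarrow> 0)
        (at t within {0..}))"

definition is_solution ::
    "nat \<Rightarrow> real \<Rightarrow> real \<Rightarrow> real \<Rightarrow> real \<Rightarrow> real \<Rightarrow> real \<Rightarrow> real \<Rightarrow>
     ((nat \<Rightarrow> real) \<Rightarrow> real) \<Rightarrow> ((nat \<Rightarrow> real) \<Rightarrow> real) \<Rightarrow>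
     (real \<Rightarrow> (nat \<Rightarrow> real) \<Rightarrow> real) \<Rightarrow> (real \<Rightarrow> (nat \<Rightarrow> real) \<Rightarrow> real) \<Rightarrow> bool" where
  "is_solution n \<epsilon> \<mu> \<nu> \<alpha> \<beta> \<gamma> \<delta> u\<^sub>0 v\<^sub>0 u v \<longleftrightarrow>
     continuous_into_H2 n u \<and> continuous_into_H2 n v \<and>
     (\<exists>u' v'.
        has_time_deriv_L2 n u u' \<and> continuous_into_L2 n u' \<and>
        has_time_deriv_L2 n v v' \<and> continuous_into_L2 n v' \<and>
        (\<forall>t\<ge>0. AE x in Rn n.
           \<epsilon> * u' t x = \<epsilon> * (laplacian n (u t) x - \<mu> * u t x) + \<alpha> * u t x + \<beta> * v t x \<and>
           v' t x = (laplacian n (v t) x - \<nu> * v t x) + \<gamma> * u t x + \<delta> * v t x)) \<and>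
     (AE x in Rn n. u 0 x = u\<^sub>0 x \<and> v 0 x = v\<^sub>0 x)"


subsection \<open>The solution formula\<close>

text \<open>The square root is the principal complex one, so that being real is a genuine claim.\<close>

definition Omega :: "real \<Rightarrow> real \<Rightarrow> real \<Rightarrow> real \<Rightarrow> real \<Rightarrow> real \<Rightarrow> real \<Rightarrow> complex" where
  "Omega \<mu> \<nu> \<alpha> \<beta> \<gamma> \<delta> \<epsilon> =
     csqrt (complex_of_real ((\<delta> - \<nu> - \<alpha> / \<epsilon> + \<mu>)\<^sup>2 + 4 * (\<beta> * \<gamma>) / \<epsilon>))"

text \<open>
  \<open>L\<^sub>+\<close> is obtained for \<open>\<sigma> = 1\<close> and \<open>L\<^sub>-\<close> for \<open>\<sigma> = - 1\<close>; they are used only when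
  \<^const>\<open>Omega\<close> is real.
\<close>

definition L_kernel ::
    "real \<Rightarrow> nat \<Rightarrow> real \<Rightarrow> real \<Rightarrow> real \<Rightarrow> real \<Rightarrow> real \<Rightarrow> real \<Rightarrow> real \<Rightarrow>
     real \<Rightarrow> (nat \<Rightarrow> real) \<Rightarrow> real" where
  "L_kernel \<sigma> n \<mu> \<nu> \<alpha> \<beta> \<gamma> \<delta> \<epsilon> t x =
     exp ((\<alpha> / \<epsilon> - \<mu> + \<delta> - \<nu> + \<sigma> * Re (Omega \<mu> \<nu> \<alpha> \<beta> \<gamma> \<delta> \<epsilon>)) * (t / 2)) * heat_kernel n t x"

end

theory Submission
  imports Defs "HOL-Probability.Probability"
begin

text \<open>
  Write \<open>T\<^sub>t\<close> for convolution with the heat kernel (and \<open>T\<^sub>0\<close> for the identity) and \<open>M\<close> for the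
  coefficient matrix of the zeroth order terms. The constant matrix \<open>M\<close> commutes with the Laplacian, so the
  solution is \<open>e\<^sup>t\<^sup>M\<close> applied to \<open>(T\<^sub>t u\<^sub>0, T\<^sub>t v\<^sub>0)\<close>. The eigenvalues of \<open>M\<close> are real and distinct as soon as
  the discriminant is positive, and \<open>e\<^sup>t\<^sup>M\<close> is then the combination of its two exponentials with the spectral
  projections as coefficients; the entries of these projections are the \<open>\<rho>\<^sub>i\<close>.

  For \<open>u \<in> H\<^sup>2\<close> the curve \<open>t \<mapsto> T\<^sub>t u\<close> is \<open>C\<^sup>1\<close> into \<open>L\<^sup>2\<close> by duality: for test functions \<open>\<phi>\<close> with
  \<open>d/dt T\<^sub>t \<phi> = T\<^sub>t \<Delta>\<phi>\<close>, self-adjointness gives \<open>d/dt \<langle>T\<^sub>t u, \<phi>\<rangle> = \<langle>T\<^sub>t \<Delta>u, \<phi>\<rangle>\<close>, and the real mean value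
  theorem together with the density of these \<open>\<phi>\<close> bounds the norm of the difference quotient minus
  \<open>T\<^sub>t \<Delta>u\<close>. Products of functions of one variable are such test functions, by a Taylor expansion in one
  variable. Conversely, if \<open>(u, v)\<close> is a solution and \<open>(a, b) = (p, q) e\<^bsup>(T - t)M\<^esup>\<close>, then
  \<open>\<langle>a u(t) + b v(t), T\<^bsub>T - t\<^esub> \<phi>\<rangle>\<close> has derivative zero on \<open>[0, T]\<close>; comparing the end points determines
  \<open>(u(T), v(T))\<close>.
\<close>

section \<open>The space L2 as an inner product space\<close>

text \<open>The obstacle that shapes the proof is that weak derivatives may be tested only with
  compactly supported smooth functions, while the heat flow destroys compact support. The way round
  it is that \<open>T_t f\<close> is an average of translates of \<open>f\<close>, and translates of
  test functions are test functions: weak derivatives therefore commute with \<open>T_t\<close>, and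
  self-adjointness moves the flow to whichever argument of the inner product can carry it. The
  analytic work falls on tensor products, because the Gaussian factorises. In one variable its
  moments of order 2 and 4, \<open>2 * t\<close> and \<open>12 * t^2\<close>, yield the time
  derivative at 0 with an error that is quadratic and uniform in space, and the semigroup property
  carries it to all times. Not every test function has to be shown regular for the flow: a linear
  class dense in L2 suffices, since norms and equality almost everywhere are detected by pairing
  with such a class. Testing a solution with a backward solution of the adjoint system replaces an
  energy estimate and at the same time computes the solution. Smallness of \<epsilon> enters because
  \<epsilon>^2 times the discriminant tends to \<alpha>^2 > 0.\<close>

lemma L2I: "f \<in> borel_measurable (Rn n) \<Longrightarrow> integrable (Rn n) (\<lambda>x. (f x)\<^sup>2) \<Longrightarrow> f \<in> L2 n"
  by (simp add: L2_def)

lemma L2_measurable [measurable_dest]: "f \<in> L2 n \<Longrightarrow> f \<in> borel_measurable (Rn n)"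
  by (simp add: L2_def)

lemma L2_square_integrable: "f \<in> L2 n \<Longrightarrow> integrable (Rn n) (\<lambda>x. (f x)\<^sup>2)"
  by (simp add: L2_def)

lemma L2_mult_integrable:
  assumes f: "f \<in> L2 n" and g: "g \<in> L2 n"
  shows "integrable (Rn n) (\<lambda>x. f x * g x)"
proof (rule Bochner_Integration.integrable_bound)
  show "integrable (Rn n) (\<lambda>x. (f x)\<^sup>2 + (g x)\<^sup>2)"
    using f g by (simp add: L2_square_integrable)
  show "(\<lambda>x. f x * g x) \<in> borel_measurable (Rn n)"
    using f g by measurable
  have "\<bar>a * b\<bar> \<le> a\<^sup>2 + b\<^sup>2" for a b :: real
  proof -
    have "0 \<le> (\<bar>a\<bar> - \<bar>b\<bar>)\<^sup>2" by simp
    then have "2 * (\<bar>a\<bar> * \<bar>b\<bar>) \<le> a\<^sup>2 + b\<^sup>2" by (simp add: power2_diff)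
    moreover have "0 \<le> \<bar>a\<bar> * \<bar>b\<bar>" by simp
    ultimately show ?thesis unfolding abs_mult by linarith
  qed
  then show "AE x in Rn n. norm (f x * g x) \<le> norm ((f x)\<^sup>2 + (g x)\<^sup>2)"
    by (intro AE_I2) (auto intro: order_trans[OF _ abs_ge_self])
qed

lemma L2_cmult: "f \<in> L2 n \<Longrightarrow> (\<lambda>x. c * f x) \<in> L2 n"
  by (auto simp: L2_def power_mult_distrib)

lemma L2_add:
  assumes "f \<in> L2 n" "g \<in> L2 n" shows "(\<lambda>x. f x + g x) \<in> L2 n"
proof -
  have "integrable (Rn n) (\<lambda>x. (f x)\<^sup>2 + (g x)\<^sup>2 + 2 * (f x * g x))"
    using assms by (intro Bochner_Integration.integrable_add integrable_mult_right L2_mult_integrable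
        L2_square_integrable)
  then show ?thesis using assms by (auto simp: L2_def power2_sum algebra_simps)
qed

lemma L2_uminus: "f \<in> L2 n \<Longrightarrow> (\<lambda>x. - f x) \<in> L2 n"
  by (auto simp: L2_def)

lemma L2_diff: "f \<in> L2 n \<Longrightarrow> g \<in> L2 n \<Longrightarrow> (\<lambda>x. f x - g x) \<in> L2 n"
  using L2_add[of f n "\<lambda>x. - g x"] L2_uminus[of g n] by simp

lemma L2_divide: "f \<in> L2 n \<Longrightarrow> (\<lambda>x. f x / c) \<in> L2 n"
  using L2_cmult[of f n "1 / c"] by simp

lemma L2_zero: "(\<lambda>x. 0) \<in> L2 n"
  by (simp add: L2_def)

lemma L2_sum: "(\<And>i. i \<in> I \<Longrightarrow> f i \<in> L2 n) \<Longrightarrow> (\<lambda>x. \<Sum>i\<in>I. f i x) \<in> L2 n"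
  by (induction I rule: infinite_finite_induct) (simp_all add: L2_zero L2_add)

lemmas L2_intros = L2_cmult L2_add L2_diff L2_divide L2_zero L2_sum L2_uminus

section \<open>Inner product and norm\<close>

definition ip :: "nat \<Rightarrow> ((nat \<Rightarrow> real) \<Rightarrow> real) \<Rightarrow> ((nat \<Rightarrow> real) \<Rightarrow> real) \<Rightarrow> real" where
  "ip n f g = (\<integral>x. f x * g x \<partial>Rn n)"

lemma ip_commute: "ip n f g = ip n g f"
  by (simp add: ip_def mult.commute)

lemma ip_add_left: "f \<in> L2 n \<Longrightarrow> g \<in> L2 n \<Longrightarrow> h \<in> L2 n \<Longrightarrow> ip n (\<lambda>x. f x + g x) h = ip n f h + ip n g h"
  by (simp add: ip_def distrib_right L2_mult_integrable)

lemma ip_diff_left: "f \<in> L2 n \<Longrightarrow> g \<in> L2 n \<Longrightarrow> h \<in> L2 n \<Longrightarrow> ip n (\<lambda>x. f x - g x) h = ip n f h - ip n g h"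
  by (simp add: ip_def left_diff_distrib L2_mult_integrable)

lemma ip_cmult_left: "ip n (\<lambda>x. c * f x) h = c * ip n f h"
  by (simp add: ip_def mult.assoc)

lemma ip_divide_left: "ip n (\<lambda>x. f x / c) h = ip n f h / c"
  by (simp add: ip_def)

lemma ip_sum_left: "(\<And>i. i \<in> I \<Longrightarrow> f i \<in> L2 n) \<Longrightarrow> h \<in> L2 n \<Longrightarrow> ip n (\<lambda>x. \<Sum>i\<in>I. f i x) h = (\<Sum>i\<in>I. ip n (f i) h)"
  by (simp add: ip_def sum_distrib_right L2_mult_integrable)

lemma ip_add_right: "f \<in> L2 n \<Longrightarrow> g \<in> L2 n \<Longrightarrow> h \<in> L2 n \<Longrightarrow> ip n h (\<lambda>x. f x + g x) = ip n h f + ip n h g"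
  by (simp add: ip_commute[of n h] ip_add_left)

lemma ip_diff_right: "f \<in> L2 n \<Longrightarrow> g \<in> L2 n \<Longrightarrow> h \<in> L2 n \<Longrightarrow> ip n h (\<lambda>x. f x - g x) = ip n h f - ip n h g"
  by (simp add: ip_commute[of n h] ip_diff_left)

lemma ip_cmult_right: "ip n h (\<lambda>x. c * f x) = c * ip n h f"
  by (simp add: ip_commute[of n h] ip_cmult_left)

lemma ip_divide_right: "ip n h (\<lambda>x. f x / c) = ip n h f / c"
  by (simp add: ip_commute[of n h] ip_divide_left)

lemma ip_sum_right: "(\<And>i. i \<in> I \<Longrightarrow> f i \<in> L2 n) \<Longrightarrow> h \<in> L2 n \<Longrightarrow> ip n h (\<lambda>x. \<Sum>i\<in>I. f i x) = (\<Sum>i\<in>I. ip n h (f i))"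
  by (simp add: ip_commute[of n h] ip_sum_left)

lemma ip_cong_AE:
  assumes "AE x in Rn n. f x = f' x" "f \<in> L2 n" "f' \<in> L2 n" "g \<in> L2 n"
  shows "ip n f g = ip n f' g"
  unfolding ip_def using assms by (intro integral_cong_AE) auto

lemma norm_L2_nonneg [simp]: "0 \<le> norm_L2 n f"
  by (simp add: norm_L2_def integral_nonneg_AE)

lemma norm_L2_square: "(norm_L2 n f)\<^sup>2 = ip n f f"
  unfolding norm_L2_def ip_def by (simp add: power2_eq_square integral_nonneg_AE)

lemma norm_L2_cmult: "norm_L2 n (\<lambda>x. c * f x) = \<bar>c\<bar> * norm_L2 n f"
  by (simp add: norm_L2_def power_mult_distrib real_sqrt_mult)

lemma norm_L2_minus_commute: "norm_L2 n (\<lambda>x. f x - g x) = norm_L2 n (\<lambda>x. g x - f x)"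
  by (simp add: norm_L2_def power2_commute)

lemma norm_L2_zero [simp]: "norm_L2 n (\<lambda>x. 0) = 0"
  by (simp add: norm_L2_def)

lemma norm_L2_cong_AE:
  assumes "AE x in Rn n. f x = g x" "f \<in> borel_measurable (Rn n)" "g \<in> borel_measurable (Rn n)"
  shows "norm_L2 n f = norm_L2 n g"
proof -
  have "(\<integral>x. (f x)\<^sup>2 \<partial>Rn n) = (\<integral>x. (g x)\<^sup>2 \<partial>Rn n)"
    using assms by (intro integral_cong_AE) auto
  then show ?thesis by (simp add: norm_L2_def)
qed

lemma norm_L2_eq_0D:
  assumes "f \<in> L2 n" "norm_L2 n f = 0" shows "AE x in Rn n. f x = 0"
  using assms integral_nonneg_eq_0_iff_AE[of "Rn n" "\<lambda>x. (f x)\<^sup>2"]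
  by (simp add: norm_L2_def L2_square_integrable)

lemma ip_Cauchy_Schwarz:
  assumes f: "f \<in> L2 n" and g: "g \<in> L2 n"
  shows "\<bar>ip n f g\<bar> \<le> norm_L2 n f * norm_L2 n g"
proof (cases "norm_L2 n g = 0")
  case True
  have "ip n f g = ip n f (\<lambda>x. 0)"
    unfolding ip_commute[of n f]
    using True norm_L2_eq_0D[OF g] by (intro ip_cong_AE) (auto simp: f g L2_zero)
  then show ?thesis using True by (simp add: ip_def)
next
  case False
  \<comment> \<open>The coefficient of the orthogonal projection of \<open>f\<close> onto
    \<open>g\<close>; it minimises the norm of \<open>f - c * g\<close>.\<close>
  define c where "c = ip n f g / ip n g g"
  have gg: "ip n g g > 0" using False by (metis norm_L2_square zero_less_power2)
  have "0 \<le> ip n (\<lambda>x. f x - c * g x) (\<lambda>x. f x - c * g x)"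
    by (simp add: ip_def)
  also have "\<dots> = ip n f f - 2 * c * ip n f g + c\<^sup>2 * ip n g g"
    using f g by (simp add: ip_diff_left ip_diff_right ip_cmult_left ip_cmult_right L2_intros
        ip_commute[of n g f] power2_eq_square algebra_simps)
  also have "\<dots> = ip n f f - (ip n f g)\<^sup>2 / ip n g g"
    using gg by (simp add: c_def power2_eq_square field_simps)
  finally have "(ip n f g)\<^sup>2 \<le> ip n f f * ip n g g"
    using gg by (simp add: field_simps)
  also have "\<dots> = (norm_L2 n f * norm_L2 n g)\<^sup>2"
    by (simp add: norm_L2_square power_mult_distrib)
  finally show ?thesis
    by (simp add: abs_le_square_iff[symmetric] abs_mult)
qed

lemma norm_L2_triangle:
  assumes f: "f \<in> L2 n" and g: "g \<in> L2 n"
  shows "norm_L2 n (\<lambda>x. f x + g x) \<le> norm_L2 n f + norm_L2 n g"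
proof (rule power2_le_imp_le)
  have "(norm_L2 n (\<lambda>x. f x + g x))\<^sup>2 = ip n f f + 2 * ip n f g + ip n g g"
    using f g by (simp add: norm_L2_square ip_add_left ip_add_right L2_intros ip_commute[of n g f])
  also have "\<dots> \<le> ip n f f + 2 * (norm_L2 n f * norm_L2 n g) + ip n g g"
    using ip_Cauchy_Schwarz[OF f g] by linarith
  also have "\<dots> = (norm_L2 n f + norm_L2 n g)\<^sup>2"
    by (simp add: power2_sum norm_L2_square)
  finally show "(norm_L2 n (\<lambda>x. f x + g x))\<^sup>2 \<le> (norm_L2 n f + norm_L2 n g)\<^sup>2" .
qed simp

lemma norm_L2_triangle_diff:
  assumes "f \<in> L2 n" "g \<in> L2 n" "h \<in> L2 n"
  shows "norm_L2 n (\<lambda>x. f x - h x) \<le> norm_L2 n (\<lambda>x. f x - g x) + norm_L2 n (\<lambda>x. g x - h x)"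
  using norm_L2_triangle[of "\<lambda>x. f x - g x" n "\<lambda>x. g x - h x"] assms by (simp add: L2_intros)

text \<open>The triangle inequality in the shape in which it is used below: an error is split into
  two errors already known to vanish. The splitting is required only on \<open>space (Rn n)\<close>,
  since the norm sees nothing else and \<open>heat\<close> is known to be additive only
  there.\<close>

lemma norm_L2_add_tendsto_0:
  assumes "((\<lambda>s. norm_L2 n (f s)) \<longlongrightarrow> 0) F" "((\<lambda>s. norm_L2 n (g s)) \<longlongrightarrow> 0) F"
    and "\<forall>\<^sub>F s in F. f s \<in> L2 n \<and> g s \<in> L2 n \<and> (\<forall>x\<in>space (Rn n). h s x = f s x + g s x)"
  shows "((\<lambda>s. norm_L2 n (h s)) \<longlongrightarrow> 0) F"
proof (rule tendsto_sandwich[OF _ _ tendsto_const])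
  show "((\<lambda>s. norm_L2 n (f s) + norm_L2 n (g s)) \<longlongrightarrow> 0) F"
    using tendsto_add[OF assms(1,2)] by simp
  show "\<forall>\<^sub>F s in F. norm_L2 n (h s) \<le> norm_L2 n (f s) + norm_L2 n (g s)"
    using assms(3)
  proof eventually_elim
    case (elim s)
    then have "norm_L2 n (h s) = norm_L2 n (\<lambda>x. f s x + g s x)"
      unfolding norm_L2_def by (auto intro!: arg_cong[of _ _ sqrt] Bochner_Integration.integral_cong)
    then show ?case using norm_L2_triangle[of "f s" n "g s"] elim by simp
  qed
qed simp

lemma ip_tendsto:
  assumes a: "((\<lambda>s. norm_L2 n (\<lambda>x. f s x - f0 x)) \<longlongrightarrow> 0) F"
    and b: "((\<lambda>s. norm_L2 n (\<lambda>x. g s x - g0 x)) \<longlongrightarrow> 0) F"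
    and L: "\<forall>\<^sub>F s in F. f s \<in> L2 n \<and> g s \<in> L2 n" "f0 \<in> L2 n" "g0 \<in> L2 n"
  shows "((\<lambda>s. ip n (f s) (g s)) \<longlongrightarrow> ip n f0 g0) F"
proof -
  have "((\<lambda>s. ip n (f s) (g s) - ip n f0 g0) \<longlongrightarrow> 0) F"
  proof (rule Lim_null_comparison)
    let ?A = "\<lambda>s. norm_L2 n (\<lambda>x. f s x - f0 x)" and ?B = "\<lambda>s. norm_L2 n (\<lambda>x. g s x - g0 x)"
    show "((\<lambda>s. ?A s * ?B s + ?A s * norm_L2 n g0 + norm_L2 n f0 * ?B s) \<longlongrightarrow> 0) F"
      using a b by (auto intro!: tendsto_eq_intros)
    show "\<forall>\<^sub>F s in F. norm (ip n (f s) (g s) - ip n f0 g0)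
        \<le> ?A s * ?B s + ?A s * norm_L2 n g0 + norm_L2 n f0 * ?B s"
      using L(1)
    proof eventually_elim
      case (elim s)
      define p where "p = (\<lambda>x. f s x - f0 x)"
      define q where "q = (\<lambda>x. g s x - g0 x)"
      have p: "p \<in> L2 n" and q: "q \<in> L2 n"
        using elim L unfolding p_def q_def by (auto intro: L2_intros)
      have "ip n (f s) (g s) = ip n (\<lambda>x. p x + f0 x) (\<lambda>x. q x + g0 x)"
        by (simp add: p_def q_def)
      also have "\<dots> = ip n p q + ip n p g0 + ip n f0 q + ip n f0 g0"
        using p q L by (simp add: ip_add_left ip_add_right L2_intros)
      finally have "norm (ip n (f s) (g s) - ip n f0 g0) \<le> \<bar>ip n p q\<bar> + \<bar>ip n p g0\<bar> + \<bar>ip n f0 q\<bar>"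
        by simp
      also have "\<dots> \<le> norm_L2 n p * norm_L2 n q + norm_L2 n p * norm_L2 n g0 + norm_L2 n f0 * norm_L2 n q"
        using p q L by (intro add_mono ip_Cauchy_Schwarz)
      finally show ?case by (simp add: p_def q_def)
    qed
  qed
  then show ?thesis by (rule LIM_zero_cancel)
qed

section \<open>Differentiable curves in L2\<close>

lemma norm_L2_continuous_of_derivative:
  assumes W: "((\<lambda>s. norm_L2 n (\<lambda>x. (W s x - W t x) / (s - t) - W' x)) \<longlongrightarrow> 0) (at t within S)"
    and L: "\<And>s. s \<in> S \<Longrightarrow> W s \<in> L2 n" "t \<in> S" "W' \<in> L2 n"
  shows "((\<lambda>s. norm_L2 n (\<lambda>x. W s x - W t x)) \<longlongrightarrow> 0) (at t within S)"
proof (rule norm_L2_add_tendsto_0)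
  have st: "((\<lambda>s. \<bar>s - t\<bar>) \<longlongrightarrow> 0) (at t within S)"
    by (auto intro!: tendsto_eq_intros)
  show "((\<lambda>s. norm_L2 n (\<lambda>x. (s - t) * ((W s x - W t x) / (s - t) - W' x))) \<longlongrightarrow> 0) (at t within S)"
    unfolding norm_L2_cmult using tendsto_mult[OF st W] by simp
  show "((\<lambda>s. norm_L2 n (\<lambda>x. (s - t) * W' x)) \<longlongrightarrow> 0) (at t within S)"
    unfolding norm_L2_cmult using tendsto_mult_left_zero[OF st] by simp
  have "\<forall>\<^sub>F s in at t within S. s \<in> S \<and> s \<noteq> t"
    by (simp add: eventually_at_filter)
  then show "\<forall>\<^sub>F s in at t within S. (\<lambda>x. (s - t) * ((W s x - W t x) / (s - t) - W' x)) \<in> L2 n \<and>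
          (\<lambda>x. (s - t) * W' x) \<in> L2 n \<and> (\<forall>x\<in>space (Rn n). W s x - W t x =
              (s - t) * ((W s x - W t x) / (s - t) - W' x) + (s - t) * W' x)"
  proof eventually_elim
    case (elim s)
    have "a = (s - t) * (a / (s - t) - c) + (s - t) * c" for a c :: real
      using elim by (simp add: field_simps)
    then show ?case using L elim by (intro conjI ballI L2_intros) auto
  qed
qed

text \<open>The difference of the products is split as
  \<open>(Z s - Z t) W s + Z t (W s - W t)\<close>, whose first term needs continuity of
  \<open>W\<close> at \<open>t\<close>. The set \<open>S\<close> admits one-sided derivatives at the
  ends of a time interval.\<close>

lemma ip_has_derivative:
  assumes Z: "((\<lambda>s. norm_L2 n (\<lambda>x. (Z s x - Z t x) / (s - t) - Z' x)) \<longlongrightarrow> 0) (at t within S)"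
    and W: "((\<lambda>s. norm_L2 n (\<lambda>x. (W s x - W t x) / (s - t) - W' x)) \<longlongrightarrow> 0) (at t within S)"
    and L: "\<And>s. s \<in> S \<Longrightarrow> Z s \<in> L2 n" "\<And>s. s \<in> S \<Longrightarrow> W s \<in> L2 n" "t \<in> S" "Z' \<in> L2 n" "W' \<in> L2 n"
  shows "((\<lambda>s. ip n (Z s) (W s)) has_real_derivative ip n Z' (W t) + ip n (Z t) W') (at t within S)"
proof -
  have evS: "\<forall>\<^sub>F s in at t within S. s \<in> S \<and> s \<noteq> t"
    by (simp add: eventually_at_filter)
  have Wc: "((\<lambda>s. norm_L2 n (\<lambda>x. W s x - W t x)) \<longlongrightarrow> 0) (at t within S)"
    by (rule norm_L2_continuous_of_derivative[OF W L(2,3,5)])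
  have "((\<lambda>s. ip n (\<lambda>x. (Z s x - Z t x) / (s - t)) (W s) + ip n (Z t) (\<lambda>x. (W s x - W t x) / (s - t)))
      \<longlongrightarrow> ip n Z' (W t) + ip n (Z t) W') (at t within S)"
  proof (intro tendsto_add ip_tendsto)
    show "\<forall>\<^sub>F s in at t within S. (\<lambda>x. (Z s x - Z t x) / (s - t)) \<in> L2 n \<and> W s \<in> L2 n"
      using evS by eventually_elim (use L in \<open>auto intro!: L2_intros\<close>)
    show "\<forall>\<^sub>F s in at t within S. Z t \<in> L2 n \<and> (\<lambda>x. (W s x - W t x) / (s - t)) \<in> L2 n"
      using evS by eventually_elim (use L in \<open>auto intro!: L2_intros\<close>)
  qed (use Z W Wc L in auto)
  moreover have "\<forall>\<^sub>F s in at t within S.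
      ip n (\<lambda>x. (Z s x - Z t x) / (s - t)) (W s) + ip n (Z t) (\<lambda>x. (W s x - W t x) / (s - t))
      = (ip n (Z s) (W s) - ip n (Z t) (W t)) / (s - t)"
    using evS
  proof eventually_elim
    case (elim s)
    then show ?case using L
      by (simp add: ip_divide_left ip_divide_right ip_diff_left ip_diff_right L2_intros diff_divide_distrib)
  qed
  ultimately show ?thesis
    unfolding has_field_derivative_iff by (rule Lim_transform_eventually)
qed

lemma L2_dominated_convergence:
  assumes meas: "\<And>k::nat. f k \<in> borel_measurable (Rn n)" "f0 \<in> borel_measurable (Rn n)"
    and lim: "\<And>x. x \<in> space (Rn n) \<Longrightarrow> (\<lambda>k. f k x) \<longlonglongrightarrow> f0 x"
    and g: "g \<in> L2 n" and bound: "\<And>k x. x \<in> space (Rn n) \<Longrightarrow> \<bar>f k x\<bar> \<le> g x"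
  shows "f0 \<in> L2 n" "f k \<in> L2 n" "(\<lambda>k. norm_L2 n (\<lambda>x. f k x - f0 x)) \<longlonglongrightarrow> 0"
proof -
  note meas[measurable]
  have b0: "\<bar>f0 x\<bar> \<le> g x" if "x \<in> space (Rn n)" for x
    using LIMSEQ_le_const2[OF tendsto_rabs[OF lim[OF that]]] bound[OF that] by blast
  have *: "h \<in> L2 n" if [measurable]: "h \<in> borel_measurable (Rn n)"
    and "\<And>x. x \<in> space (Rn n) \<Longrightarrow> \<bar>h x\<bar> \<le> g x" for h
    using that(2) by (intro L2I Bochner_Integration.integrable_bound[OF L2_square_integrable[OF g]])
      (auto simp: abs_le_square_iff[symmetric] intro!: AE_I2, fastforce)
  show f0: "f0 \<in> L2 n" and fk: "f k \<in> L2 n" for k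
    using b0 bound by (auto intro!: * meas)
  have "(\<lambda>k. \<integral>x. (f k x - f0 x)\<^sup>2 \<partial>Rn n) \<longlonglongrightarrow> (\<integral>x. 0 \<partial>Rn n)"
  proof (rule integral_dominated_convergence)
    \<comment> \<open>Both \<open>f k\<close> and \<open>f0\<close> are bounded by \<open>g\<close>,
      hence the factor 2.\<close>
    show "integrable (Rn n) (\<lambda>x. (2 * g x)\<^sup>2)"
      using g by (intro L2_square_integrable L2_intros)
    show "AE x in Rn n. (\<lambda>k. (f k x - f0 x)\<^sup>2) \<longlonglongrightarrow> 0"
      using lim by (intro AE_I2) (auto intro!: tendsto_eq_intros)
    show "AE x in Rn n. norm ((f k x - f0 x)\<^sup>2) \<le> (2 * g x)\<^sup>2" for k
    proof (intro AE_I2)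
      fix x assume x: "x \<in> space (Rn n)"
      have "\<bar>f k x - f0 x\<bar> \<le> \<bar>2 * g x\<bar>"
        using bound[OF x, of k] b0[OF x] by linarith
      then show "norm ((f k x - f0 x)\<^sup>2) \<le> (2 * g x)\<^sup>2" by (simp add: abs_le_square_iff)
    qed
  qed simp_all
  then have "(\<lambda>k. sqrt (\<integral>x. (f k x - f0 x)\<^sup>2 \<partial>Rn n)) \<longlonglongrightarrow> sqrt 0"
    by (intro tendsto_real_sqrt) simp
  then show "(\<lambda>k. norm_L2 n (\<lambda>x. f k x - f0 x)) \<longlonglongrightarrow> 0"
    by (simp add: norm_L2_def)
qed

section \<open>Lebesgue measure and the heat kernel\<close>

lemma space_Rn: "space (Rn n) = (\<Pi>\<^sub>E i\<in>{..<n}. UNIV)"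
  by (simp add: Rn_def space_PiM)

lemma sets_Rn [measurable_cong]: "sets (Rn n) = sets (\<Pi>\<^sub>M i\<in>{..<n}. borel)"
  unfolding Rn_def by (intro sets_PiM_cong) auto

global_interpretation lborel_PiM: product_sigma_finite "\<lambda>i::nat. (lborel :: real measure)"
  by standard

lemma sigma_finite_Rn: "sigma_finite_measure (Rn n)"
  unfolding Rn_def by (rule lborel_PiM.sigma_finite) simp

global_interpretation Rn: sigma_finite_measure "Rn n" for n
  by (rule sigma_finite_Rn)

global_interpretation Rn_pair: pair_sigma_finite "Rn n" "Rn m" for n m
  by standard

lemma emeasure_Rn_PiE:
  "(\<And>i. i < n \<Longrightarrow> A i \<in> sets borel) \<Longrightarrow> emeasure (Rn n) (Pi\<^sub>E {..<n} A) = (\<Prod>i<n. emeasure lborel (A i))"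
  unfolding Rn_def by (subst lborel_PiM.emeasure_PiM) auto

lemma sets_Rn_PiE [measurable]:
  "(\<And>i. i < n \<Longrightarrow> A i \<in> sets borel) \<Longrightarrow> Pi\<^sub>E {..<n} A \<in> sets (Rn n)"
  unfolding sets_Rn by (intro sets_PiM_I_finite) auto

lemma measurable_Rn_component: "i < n \<Longrightarrow> (\<lambda>x. x i) \<in> borel_measurable (Rn n)"
  unfolding Rn_def by measurable

text \<open>A product measure is determined by its values on measurable boxes, and a map acting on
  each coordinate separately pulls boxes back to boxes. It serves for translations and
  reflections.\<close>

lemma distr_Rn_coordinatewise:
  assumes [measurable]: "\<And>i. i < n \<Longrightarrow> m i \<in> borel_measurable borel"
    and inv: "\<And>i. i < n \<Longrightarrow> distr lborel borel (m i) = lborel"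
  shows "distr (Rn n) (Rn n) (\<lambda>x. \<lambda>i\<in>{..<n}. m i (x i)) = Rn n"
proof -
  have meas: "(\<lambda>x. \<lambda>i\<in>{..<n}. m i (x i)) \<in> measurable (Rn n) (Rn n)"
    unfolding Rn_def by (intro measurable_restrict) measurable
  have "distr (Rn n) (Rn n) (\<lambda>x. \<lambda>i\<in>{..<n}. m i (x i)) = (\<Pi>\<^sub>M i\<in>{..<n}. lborel)"
  proof (rule lborel_PiM.PiM_eqI)
    fix A :: "nat \<Rightarrow> real set" assume "\<And>i. i \<in> {..<n} \<Longrightarrow> A i \<in> sets lborel"
    then have A: "i < n \<Longrightarrow> A i \<in> sets borel" for i by simp
    have mA: "i < n \<Longrightarrow> m i -` A i \<in> sets borel" for i
      using measurable_sets[OF assms(1) A, of i] by simp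
    have "emeasure (distr (Rn n) (Rn n) (\<lambda>x. \<lambda>i\<in>{..<n}. m i (x i))) (Pi\<^sub>E {..<n} A)
        = emeasure (Rn n) ((\<lambda>x. \<lambda>i\<in>{..<n}. m i (x i)) -` (Pi\<^sub>E {..<n} A) \<inter> space (Rn n))"
      using A by (intro emeasure_distr meas) auto
    also have "(\<lambda>x. \<lambda>i\<in>{..<n}. m i (x i)) -` (Pi\<^sub>E {..<n} A) \<inter> space (Rn n) = Pi\<^sub>E {..<n} (\<lambda>i. m i -` A i)"
      by (auto simp: space_Rn PiE_iff)
    also have "emeasure (Rn n) \<dots> = (\<Prod>i<n. emeasure lborel (m i -` A i))"
      using mA by (intro emeasure_Rn_PiE)
    also have "\<dots> = (\<Prod>i<n. emeasure lborel (A i))"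
    proof (intro prod.cong refl)
      fix i assume "i \<in> {..<n}" then have i: "i < n" by simp
      have "emeasure (distr lborel borel (m i)) (A i) = emeasure lborel (m i -` A i \<inter> space lborel)"
        using A[OF i] i by (intro emeasure_distr) auto
      then show "emeasure lborel (m i -` A i) = emeasure lborel (A i)"
        by (simp add: inv[OF i])
    qed
    finally show "emeasure (distr (Rn n) (Rn n) (\<lambda>x. \<lambda>i\<in>{..<n}. m i (x i))) (Pi\<^sub>E {..<n} A)
        = (\<Prod>i\<in>{..<n}. emeasure lborel (A i))" .
  qed (auto simp: Rn_def)
  then show ?thesis by (simp add: Rn_def)
qed

text \<open>The argument of the kernel in \<open>conv\<close>. The restriction is essential: the
  plain difference need not be \<open>undefined\<close> outside the index set and could leave
  \<open>space (Rn n)\<close>.\<close>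

definition diff_Rn :: "nat \<Rightarrow> (nat \<Rightarrow> real) \<Rightarrow> (nat \<Rightarrow> real) \<Rightarrow> nat \<Rightarrow> real" where
  "diff_Rn n x y = (\<lambda>i\<in>{..<n}. x i - y i)"

lemma diff_Rn_measurable [measurable]:
  assumes [measurable]: "f \<in> measurable M (Rn n)" "g \<in> measurable M (Rn n)"
  shows "(\<lambda>w. diff_Rn n (f w) (g w)) \<in> measurable M (Rn n)"
proof -
  have "(\<lambda>w. f w i) \<in> borel_measurable M" "(\<lambda>w. g w i) \<in> borel_measurable M" if "i < n" for i
    using measurable_compose[OF assms(1) measurable_Rn_component[OF that]]
      measurable_compose[OF assms(2) measurable_Rn_component[OF that]] by auto
  then show ?thesis
    unfolding Rn_def diff_Rn_def by (intro measurable_restrict) auto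
qed

lemma diff_Rn_in_space [simp]: "diff_Rn n x y \<in> space (Rn n)"
  by (simp add: diff_Rn_def space_Rn)

lemma diff_Rn_diff_Rn [simp]: "y \<in> space (Rn n) \<Longrightarrow> diff_Rn n x (diff_Rn n x y) = y"
  by (auto simp: diff_Rn_def space_Rn PiE_iff extensional_def fun_eq_iff)

lemma distr_diff_Rn_right: "distr (Rn n) (Rn n) (\<lambda>y. diff_Rn n x y) = Rn n"
  unfolding diff_Rn_def
proof (rule distr_Rn_coordinatewise)
  show "distr lborel borel (\<lambda>y. x i - y) = lborel" for i
    using lborel_real_affine[of "- 1" "x i"] by (simp add: density_1 one_ennreal_def[symmetric])
qed simp

lemma distr_diff_Rn_left: "distr (Rn n) (Rn n) (\<lambda>x. diff_Rn n x y) = Rn n"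
  unfolding diff_Rn_def
proof (rule distr_Rn_coordinatewise)
  show "distr lborel borel (\<lambda>x. x - y i) = lborel" for i
    using lborel_real_affine[of 1 "- y i"] by (simp add: density_1 one_ennreal_def[symmetric])
qed simp

lemma integral_diff_Rn_right:
  fixes f :: "_ \<Rightarrow> real"
  assumes [measurable]: "f \<in> borel_measurable (Rn n)" and "x \<in> space (Rn n)"
  shows "(\<integral>y. f (diff_Rn n x y) \<partial>Rn n) = (\<integral>y. f y \<partial>Rn n)"
  using assms(2) by (subst (2) distr_diff_Rn_right[of n x, symmetric], subst integral_distr) auto

lemma integrable_diff_Rn_right:
  fixes f :: "_ \<Rightarrow> real"
  assumes [measurable]: "f \<in> borel_measurable (Rn n)" and "x \<in> space (Rn n)"
  shows "integrable (Rn n) (\<lambda>y. f (diff_Rn n x y)) \<longleftrightarrow> integrable (Rn n) f"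
  using assms(2) by (subst (2) distr_diff_Rn_right[of n x, symmetric], subst integrable_distr_eq) auto

lemma integral_diff_Rn_left:
  fixes f :: "_ \<Rightarrow> real"
  assumes [measurable]: "f \<in> borel_measurable (Rn n)" and "y \<in> space (Rn n)"
  shows "(\<integral>x. f (diff_Rn n x y) \<partial>Rn n) = (\<integral>y. f y \<partial>Rn n)"
  using assms(2) by (subst (2) distr_diff_Rn_left[of n y, symmetric], subst integral_distr) auto

lemma integrable_diff_Rn_left:
  fixes f :: "_ \<Rightarrow> real"
  assumes [measurable]: "f \<in> borel_measurable (Rn n)" and "y \<in> space (Rn n)"
  shows "integrable (Rn n) (\<lambda>x. f (diff_Rn n x y)) \<longleftrightarrow> integrable (Rn n) f"
  using assms(2) by (subst (2) distr_diff_Rn_left[of n y, symmetric], subst integrable_distr_eq) auto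

lemma product_Rn:
  fixes f :: "nat \<Rightarrow> real \<Rightarrow> real"
  assumes "\<And>i. i < n \<Longrightarrow> integrable lborel (f i)"
  shows "integrable (Rn n) (\<lambda>x. \<Prod>i<n. f i (x i))"
    "(\<integral>x. (\<Prod>i<n. f i (x i)) \<partial>Rn n) = (\<Prod>i<n. \<integral>x. f i x \<partial>lborel)"
  unfolding Rn_def using assms
  by (auto intro!: lborel_PiM.product_integrable_prod lborel_PiM.product_integral_prod)

text \<open>The one-dimensional heat kernel is the centred normal density of variance
  \<open>2 * t\<close>; in this form its mass, moments and convolutions are facts of probability
  theory.\<close>

definition kernel1 :: "real \<Rightarrow> real \<Rightarrow> real" where
  "kernel1 t = normal_density 0 (sqrt (2 * t))"

lemma kernel1_nonneg [simp]: "0 \<le> kernel1 t x"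
  by (simp add: kernel1_def)

lemma kernel1_measurable [measurable]: "kernel1 t \<in> borel_measurable borel"
  by (simp add: kernel1_def)

lemma kernel1_integral: "t > 0 \<Longrightarrow> integrable lborel (kernel1 t)" "t > 0 \<Longrightarrow> (\<integral>x. kernel1 t x \<partial>lborel) = 1"
  by (simp_all add: kernel1_def)

lemma heat_kernel_eq_prod:
  assumes "t > 0"
  shows "heat_kernel n t x = (\<Prod>i<n. kernel1 t (x i))"
proof -
  have "(\<Prod>i<n. kernel1 t (x i)) = (\<Prod>i<n. (4 * pi * t) powr (- 1 / 2) * exp (- (x i)\<^sup>2 / (4 * t)))"
    using assms by (simp add: kernel1_def normal_density_def powr_minus_divide powr_half_sqrt ac_simps)
  also have "\<dots> = ((4 * pi * t) powr (- 1 / 2)) ^ n * exp (\<Sum>i<n. - (x i)\<^sup>2 / (4 * t))"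
    by (simp add: prod.distrib exp_sum)
  also have "((4 * pi * t) powr (- 1 / 2)) ^ n = (4 * pi * t) powr (- real n / 2)"
    using assms by (simp add: powr_power)
  also have "(\<Sum>i<n. - (x i)\<^sup>2 / (4 * t)) = - (L2_set x {..<n})\<^sup>2 / (4 * t)"
    by (simp add: L2_set_def sum_nonneg sum_negf flip: sum_divide_distrib)
  finally show ?thesis by (simp add: heat_kernel_def)
qed

lemma heat_kernel_nonneg [simp]: "0 \<le> heat_kernel n t x"
  by (simp add: heat_kernel_def)

lemma heat_kernel_measurable [measurable]: "heat_kernel n t \<in> borel_measurable (Rn n)"
  unfolding heat_kernel_def[abs_def] L2_set_def
  by (intro borel_measurable_times borel_measurable_const borel_measurable_exp borel_measurable_divide
      borel_measurable_uminus borel_measurable_power borel_measurable_sqrt borel_measurable_sum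
      measurable_Rn_component) auto

lemma heat_kernel_le: "t > 0 \<Longrightarrow> heat_kernel n t x \<le> (4 * pi * t) powr (- real n / 2)"
  unfolding heat_kernel_def by (intro mult_left_le) (auto simp: divide_nonneg_nonneg)

lemma heat_kernel_integral:
  assumes "t > 0"
  shows "integrable (Rn n) (heat_kernel n t)" "(\<integral>x. heat_kernel n t x \<partial>Rn n) = 1"
proof -
  have "heat_kernel n t = (\<lambda>x. \<Prod>i<n. kernel1 t (x i))"
    using heat_kernel_eq_prod[OF assms] by (intro ext)
  then show "integrable (Rn n) (heat_kernel n t)" "(\<integral>x. heat_kernel n t x \<partial>Rn n) = 1"
    using product_Rn[of n "\<lambda>_. kernel1 t"] assms by (simp_all add: kernel1_integral)
qed

lemma heat_kernel_diff_commute: "heat_kernel n t (diff_Rn n x y) = heat_kernel n t (diff_Rn n y x)"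
  unfolding heat_kernel_def L2_set_def diff_Rn_def by (simp add: power2_commute)

section \<open>The heat semigroup on L2\<close>

definition heat :: "nat \<Rightarrow> real \<Rightarrow> ((nat \<Rightarrow> real) \<Rightarrow> real) \<Rightarrow> (nat \<Rightarrow> real) \<Rightarrow> real" where
  "heat n t f = (if t = 0 then f else conv n (heat_kernel n t) f)"

lemma heat_0 [simp]: "heat n 0 f = f"
  by (simp add: heat_def)

lemma heat_pos: "t > 0 \<Longrightarrow> heat n t f x = (\<integral>y. heat_kernel n t (diff_Rn n x y) * f y \<partial>Rn n)"
  by (simp add: heat_def conv_def diff_Rn_def)

text \<open>The square of the kernel is at most its maximum times the kernel itself. As a
  consequence \<open>heat n t f x\<close> is an absolutely convergent integral at every point
  \<open>x\<close>, not only almost everywhere.\<close>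

lemma heat_kernel_diff_L2:
  assumes "t > 0" and x: "x \<in> space (Rn n)"
  shows "(\<lambda>y. heat_kernel n t (diff_Rn n x y)) \<in> L2 n"
proof (rule L2I)
  show "integrable (Rn n) (\<lambda>y. (heat_kernel n t (diff_Rn n x y))\<^sup>2)"
  proof (rule Bochner_Integration.integrable_bound)
    show "integrable (Rn n) (\<lambda>y. (4 * pi * t) powr (- real n / 2) * heat_kernel n t (diff_Rn n x y))"
      using assms by (intro integrable_mult_right) (simp add: integrable_diff_Rn_right heat_kernel_integral)
    show "AE y in Rn n. norm ((heat_kernel n t (diff_Rn n x y))\<^sup>2)
        \<le> norm ((4 * pi * t) powr (- real n / 2) * heat_kernel n t (diff_Rn n x y))"
      using heat_kernel_le[OF assms(1)]
      by (intro AE_I2) (auto simp: power2_eq_square abs_mult intro!: mult_right_mono)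
  qed (use x in measurable)
qed (use x in measurable)

lemma heat_integrable:
  "t > 0 \<Longrightarrow> x \<in> space (Rn n) \<Longrightarrow> f \<in> L2 n \<Longrightarrow> integrable (Rn n) (\<lambda>y. heat_kernel n t (diff_Rn n x y) * f y)"
  by (intro L2_mult_integrable heat_kernel_diff_L2)

lemma heat_pos':
  assumes "t > 0" "x \<in> space (Rn n)" "f \<in> L2 n"
  shows "heat n t f x = (\<integral>y. heat_kernel n t y * f (diff_Rn n x y) \<partial>Rn n)"
    "integrable (Rn n) (\<lambda>y. heat_kernel n t y * f (diff_Rn n x y))"
proof -
  have [measurable]: "f \<in> borel_measurable (Rn n)" using assms by measurable
  have eq: "(\<integral>y. heat_kernel n t (diff_Rn n x (diff_Rn n x y)) * f (diff_Rn n x y) \<partial>Rn n)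
      = (\<integral>y. heat_kernel n t y * f (diff_Rn n x y) \<partial>Rn n)"
    by (intro Bochner_Integration.integral_cong) auto
  have meas: "(\<lambda>y. heat_kernel n t (diff_Rn n x y) * f y) \<in> borel_measurable (Rn n)"
    using assms by measurable
  show "heat n t f x = (\<integral>y. heat_kernel n t y * f (diff_Rn n x y) \<partial>Rn n)"
    unfolding heat_pos[OF assms(1)] eq[symmetric] using assms
    by (subst integral_diff_Rn_right[symmetric, OF meas, of x]) auto
  have "integrable (Rn n) (\<lambda>y. heat_kernel n t (diff_Rn n x (diff_Rn n x y)) * f (diff_Rn n x y))"
    using integrable_diff_Rn_right[OF meas assms(2)] heat_integrable[OF assms] by simp
  then show "integrable (Rn n) (\<lambda>y. heat_kernel n t y * f (diff_Rn n x y))"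
    using assms by (simp cong: Bochner_Integration.integrable_cong)
qed

lemma heat_measurable:
  assumes [measurable]: "f \<in> borel_measurable (Rn n)" and "t \<ge> 0"
  shows "heat n t f \<in> borel_measurable (Rn n)"
proof (cases "t = 0")
  case False
  then have "heat n t f = (\<lambda>x. \<integral>y. heat_kernel n t (diff_Rn n x y) * f y \<partial>Rn n)"
    using assms by (intro ext heat_pos) auto
  then show ?thesis by simp
qed (use assms in simp)

text \<open>Jensen's inequality for the probability density
  \<open>heat_kernel n t (diff_Rn n x y)\<close> in \<open>y\<close>: the variance of
  \<open>f\<close> under it is nonnegative, and its mean is \<open>heat n t f x\<close>.\<close>

lemma heat_square_le:
  assumes t: "t > 0" and x: "x \<in> space (Rn n)" and f: "f \<in> L2 n"
  shows "(heat n t f x)\<^sup>2 \<le> (\<integral>y. heat_kernel n t (diff_Rn n x y) * (f y)\<^sup>2 \<partial>Rn n)"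
    "integrable (Rn n) (\<lambda>y. heat_kernel n t (diff_Rn n x y) * (f y)\<^sup>2)"
proof -
  let ?K = "\<lambda>y. heat_kernel n t (diff_Rn n x y)"
  note x[measurable] L2_measurable[OF f, measurable]
  show 2: "integrable (Rn n) (\<lambda>y. ?K y * (f y)\<^sup>2)"
  proof (rule Bochner_Integration.integrable_bound)
    show "integrable (Rn n) (\<lambda>y. (4 * pi * t) powr (- real n / 2) * (f y)\<^sup>2)"
      using f by (intro integrable_mult_right L2_square_integrable)
    show "AE y in Rn n. norm (?K y * (f y)\<^sup>2) \<le> norm ((4 * pi * t) powr (- real n / 2) * (f y)\<^sup>2)"
      using heat_kernel_le[OF t] by (intro AE_I2) (auto simp: abs_mult intro!: mult_right_mono)
  qed measurable
  have K: "integrable (Rn n) ?K" "(\<integral>y. ?K y \<partial>Rn n) = 1"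
    using heat_kernel_integral[OF t] x by (simp_all add: integrable_diff_Rn_right integral_diff_Rn_right)
  note 1 = heat_integrable[OF t x f]
  define m where "m = heat n t f x"
  have m: "(\<integral>y. ?K y * f y \<partial>Rn n) = m"
    using heat_pos[OF t] by (simp add: m_def)
  have "0 \<le> (\<integral>y. ?K y * (f y - m)\<^sup>2 \<partial>Rn n)"
    by (intro integral_nonneg_AE AE_I2) simp
  also have "(\<integral>y. ?K y * (f y - m)\<^sup>2 \<partial>Rn n) = (\<integral>y. ?K y * (f y)\<^sup>2 + (m\<^sup>2 * ?K y - 2 * m * (?K y * f y)) \<partial>Rn n)"
    by (intro Bochner_Integration.integral_cong) (auto simp: power2_eq_square algebra_simps)
  also have "\<dots> = (\<integral>y. ?K y * (f y)\<^sup>2 \<partial>Rn n) + (m\<^sup>2 * 1 - 2 * m * m)"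
    using 1 2 K m by simp
  finally show "(heat n t f x)\<^sup>2 \<le> (\<integral>y. ?K y * (f y)\<^sup>2 \<partial>Rn n)"
    by (simp add: m_def[symmetric] power2_eq_square)
qed

text \<open>Jensen's inequality followed by Tonelli's theorem, as the kernel has mass 1 in either
  variable. Nonnegative integrals are used because integrability of the left-hand side is only
  deduced from this bound.\<close>

lemma heat_contraction_nn:
  assumes t: "t > 0" and f: "f \<in> L2 n"
  shows "(\<integral>\<^sup>+x. ennreal ((heat n t f x)\<^sup>2) \<partial>Rn n) \<le> ennreal (\<integral>y. (f y)\<^sup>2 \<partial>Rn n)"
proof -
  note L2_measurable[OF f, measurable]
  let ?K = "\<lambda>x y. heat_kernel n t (diff_Rn n x y)"
  have "(\<integral>\<^sup>+x. ennreal ((heat n t f x)\<^sup>2) \<partial>Rn n) \<le> (\<integral>\<^sup>+x. \<integral>\<^sup>+y. ennreal (?K x y * (f y)\<^sup>2) \<partial>Rn n \<partial>Rn n)"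
    using heat_square_le[OF t _ f]
    by (intro nn_integral_mono) (subst nn_integral_eq_integral, auto intro!: ennreal_leI)
  also have "\<dots> = (\<integral>\<^sup>+y. \<integral>\<^sup>+x. ennreal (?K x y * (f y)\<^sup>2) \<partial>Rn n \<partial>Rn n)"
    by (intro Rn_pair.Fubini'[symmetric]) measurable
  also have "\<dots> = (\<integral>\<^sup>+y. ennreal ((f y)\<^sup>2) \<partial>Rn n)"
  proof (intro nn_integral_cong)
    fix y assume y: "y \<in> space (Rn n)"
    have "(\<integral>\<^sup>+x. ennreal (?K x y * (f y)\<^sup>2) \<partial>Rn n) = ennreal (\<integral>x. ?K x y * (f y)\<^sup>2 \<partial>Rn n)"
      using y heat_kernel_integral[OF t]
      by (intro nn_integral_eq_integral integrable_mult_left) (auto simp: integrable_diff_Rn_left)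
    then show "(\<integral>\<^sup>+x. ennreal (?K x y * (f y)\<^sup>2) \<partial>Rn n) = ennreal ((f y)\<^sup>2)"
      using y heat_kernel_integral[OF t] by (simp add: integral_diff_Rn_left)
  qed
  also have "\<dots> = ennreal (\<integral>y. (f y)\<^sup>2 \<partial>Rn n)"
    using f by (intro nn_integral_eq_integral) (auto simp: L2_square_integrable)
  finally show ?thesis .
qed

lemma heat_L2: 
  assumes t: "t \<ge> 0" and f: "f \<in> L2 n"
  shows "heat n t f \<in> L2 n" "norm_L2 n (heat n t f) \<le> norm_L2 n f"
proof -
  have "heat n t f \<in> L2 n \<and> norm_L2 n (heat n t f) \<le> norm_L2 n f" if t: "t > 0"
  proof
    have m: "heat n t f \<in> borel_measurable (Rn n)" 
      using f t by (intro heat_measurable) auto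
    then show *: "heat n t f \<in> L2 n"
      using heat_contraction_nn[OF t f] by (intro L2I) (auto simp: integrable_iff_bounded intro: le_less_trans)
    have "ennreal (\<integral>x. (heat n t f x)\<^sup>2 \<partial>Rn n) = (\<integral>\<^sup>+x. ennreal ((heat n t f x)\<^sup>2) \<partial>Rn n)"
      using * by (intro nn_integral_eq_integral[symmetric]) (auto simp: L2_square_integrable)
    also have "\<dots> \<le> ennreal (\<integral>x. (f x)\<^sup>2 \<partial>Rn n)"
      by (rule heat_contraction_nn[OF t f])
    finally have "(\<integral>x. (heat n t f x)\<^sup>2 \<partial>Rn n) \<le> (\<integral>x. (f x)\<^sup>2 \<partial>Rn n)"
      by (subst (asm) ennreal_le_iff) simp_all
    then show "norm_L2 n (heat n t f) \<le> norm_L2 n f"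
      by (simp add: norm_L2_def)
  qed
  then show "heat n t f \<in> L2 n" "norm_L2 n (heat n t f) \<le> norm_L2 n f"
    using t f by (cases "t = 0"; auto)+
qed

section \<open>Linearity and self-adjointness of the heat semigroup\<close>

lemma heat_add:
  assumes "t \<ge> 0" "f \<in> L2 n" "g \<in> L2 n" "x \<in> space (Rn n)"
  shows "heat n t (\<lambda>x. f x + g x) x = heat n t f x + heat n t g x"
  using assms heat_integrable[of t x n]
  by (cases "t = 0") (auto simp: heat_pos distrib_left)

lemma heat_cmult: "t \<ge> 0 \<Longrightarrow> heat n t (\<lambda>x. c * f x) x = c * heat n t f x"
  by (cases "t = 0") (auto simp: heat_pos mult.left_commute[of _ c])

lemma heat_diff:
  assumes "t \<ge> 0" "f \<in> L2 n" "g \<in> L2 n" "x \<in> space (Rn n)"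
  shows "heat n t (\<lambda>x. f x - g x) x = heat n t f x - heat n t g x"
  using heat_add[OF assms(1,2) L2_cmult[OF assms(3), of "-1"] assms(4)] heat_cmult[of t n "-1" g] assms(1)
      by simp

lemma heat_sum:
  assumes "t \<ge> 0" "\<And>i. i \<in> I \<Longrightarrow> f i \<in> L2 n" "x \<in> space (Rn n)"
  shows "heat n t (\<lambda>x. \<Sum>i\<in>I. f i x) x = (\<Sum>i\<in>I. heat n t (f i) x)"
proof (cases "t = 0")
  case False
  then show ?thesis
    using assms heat_integrable[of t x n] by (simp add: heat_pos sum_distrib_left)
qed simp

text \<open>With absolute values the inner integral becomes \<open>heat n t\<close> of
  \<open>\<bar>f\<bar>\<close> times \<open>\<bar>g\<bar>\<close>, a product of two L2 functions.
  The first form serves self-adjointness, the second the averaging over translates.\<close>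

lemma heat_Fubini:
  assumes t: "t > 0" and f: "f \<in> L2 n" and g: "g \<in> L2 n"
  shows "integrable (Rn n \<Otimes>\<^sub>M Rn n) (\<lambda>(x, y). heat_kernel n t (diff_Rn n x y) * f y * g x)" (is ?A)
    "integrable (Rn n \<Otimes>\<^sub>M Rn n) (\<lambda>(x, y). heat_kernel n t y * f (diff_Rn n x y) * g x)" (is ?B)
proof -
  note L2_measurable[OF f, measurable] L2_measurable[OF g, measurable]
  have af: "(\<lambda>x. \<bar>f x\<bar>) \<in> L2 n" and ag: "(\<lambda>x. \<bar>g x\<bar>) \<in> L2 n"
    using f g by (auto simp: L2_def)
  have int: "integrable (Rn n) (\<lambda>x. heat n t (\<lambda>x. \<bar>f x\<bar>) x * \<bar>g x\<bar>)"
    using t af ag by (intro L2_mult_integrable heat_L2) auto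
  show ?A
  proof (rule Rn_pair.Fubini_integrable)
    show "integrable (Rn n) (\<lambda>x. \<integral>y. norm (case (x, y) of (x, y) \<Rightarrow> heat_kernel n t (diff_Rn n x y) * f y * g
        x) \<partial>Rn n)"
      using int t by (simp add: abs_mult heat_pos)
    show "AE x in Rn n. integrable (Rn n) (\<lambda>y. case (x, y) of (x, y) \<Rightarrow> heat_kernel n t (diff_Rn n x y) * f y
        * g x)"
      using heat_integrable[OF t _ f] by (intro AE_I2) simp
  qed measurable
  show ?B
  proof (rule Rn_pair.Fubini_integrable)
    have "(\<integral>y. norm (case (x, y) of (x, y) \<Rightarrow> heat_kernel n t y * f (diff_Rn n x y) * g x) \<partial>Rn n)
        = heat n t (\<lambda>x. \<bar>f x\<bar>) x * \<bar>g x\<bar>" if "x \<in> space (Rn n)" for x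
      using t that af by (simp add: abs_mult heat_pos'(1))
    then show "integrable (Rn n) (\<lambda>x. \<integral>y. norm (case (x, y) of (x, y) \<Rightarrow> heat_kernel n t y * f (diff_Rn n x
        y) * g x) \<partial>Rn n)"
      using int by (simp cong: Bochner_Integration.integrable_cong)
    show "AE x in Rn n. integrable (Rn n) (\<lambda>y. case (x, y) of (x, y) \<Rightarrow> heat_kernel n t y * f (diff_Rn n x y)
        * g x)"
      using heat_pos'(2)[OF t _ f] by (intro AE_I2) simp
  qed measurable
qed

lemma heat_selfadjoint:
  assumes t: "t \<ge> 0" and f: "f \<in> L2 n" and g: "g \<in> L2 n"
  shows "ip n (heat n t f) g = ip n f (heat n t g)"
proof (cases "t = 0")
  case False
  with t have t: "t > 0" by simp
  have "ip n (heat n t f) g = (\<integral>x. \<integral>y. heat_kernel n t (diff_Rn n x y) * f y * g x \<partial>Rn n \<partial>Rn n)"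
    by (simp add: ip_def heat_pos[OF t])
  also have "\<dots> = (\<integral>y. \<integral>x. heat_kernel n t (diff_Rn n x y) * f y * g x \<partial>Rn n \<partial>Rn n)"
    using heat_Fubini(1)[OF t f g] by (intro Rn_pair.Fubini_integral[symmetric])
  also have "\<dots> = (\<integral>y. \<integral>x. f y * (heat_kernel n t (diff_Rn n y x) * g x) \<partial>Rn n \<partial>Rn n)"
    by (simp add: heat_kernel_diff_commute mult_ac)
  also have "\<dots> = ip n f (heat n t g)"
    by (simp add: ip_def heat_pos[OF t])
  finally show ?thesis .
qed simp

text \<open>The pairing becomes an average over pairings with translates of \<open>f\<close>; in
  each of these the shift can be moved to a test function.\<close>

lemma ip_heat_translates:
  assumes t: "t > 0" and f: "f \<in> L2 n" and g: "g \<in> L2 n"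
  shows "ip n (heat n t f) g = (\<integral>y. heat_kernel n t y * ip n (\<lambda>x. f (diff_Rn n x y)) g \<partial>Rn n)"
proof -
  have "ip n (heat n t f) g = (\<integral>x. \<integral>y. heat_kernel n t y * f (diff_Rn n x y) * g x \<partial>Rn n \<partial>Rn n)"
    unfolding ip_def by (intro Bochner_Integration.integral_cong) (simp_all add: heat_pos'(1)[OF t _ f])
  also have "\<dots> = (\<integral>y. \<integral>x. heat_kernel n t y * f (diff_Rn n x y) * g x \<partial>Rn n \<partial>Rn n)"
    using heat_Fubini(2)[OF t f g] by (intro Rn_pair.Fubini_integral[symmetric])
  also have "\<dots> = (\<integral>y. heat_kernel n t y * ip n (\<lambda>x. f (diff_Rn n x y)) g \<partial>Rn n)"
    by (simp add: ip_def mult.assoc)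
  finally show ?thesis .
qed

section \<open>Test functions\<close>

lemma fun_upd_in_space_Rn: "x \<in> space (Rn n) \<Longrightarrow> i < n \<Longrightarrow> x(i := s) \<in> space (Rn n)"
  by (auto simp: space_Rn PiE_iff extensional_def)

lemma continuous_on_fun_upd: "continuous_on UNIV (\<lambda>s::real. x(i := s))"
proof (rule continuous_on_coordinatewise_then_product)
  fix j show "continuous_on UNIV (\<lambda>s::real. (x(i := s)) j)"
    by (cases "j = i") (auto intro: continuous_intros)
qed

text \<open>The closure in the definition of \<open>test_functions\<close> is taken in the whole
  type of functions; closedness keeps supports inside R^n. The space is an intersection of closed
  sets, one for each coordinate outside the index set.\<close>

lemma closed_space_Rn: "closed (space (Rn n))"
proof -
  have "space (Rn n) = (\<Inter>i\<in>{n..}. {x. x i = (undefined :: real)})"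
    unfolding space_Rn PiE_def extensional_def by force
  also have "closed \<dots>"
  proof (rule closed_INT, rule ballI)
    show "closed {x. x i = (undefined :: real)}" for i :: nat
      by (rule closed_Collect_eq[OF continuous_on_product_coordinates continuous_on_const])
  qed
  finally show ?thesis .
qed

text \<open>Composition with the continuous retraction \<open>r\<close> onto R^n extends
  \<open>f\<close> to a continuous, hence Borel, function on all sequences; on R^n nothing
  changes.\<close>

lemma continuous_on_Rn_measurable:
  fixes f :: "(nat \<Rightarrow> real) \<Rightarrow> real"
  assumes f: "continuous_on (space (Rn n)) f"
  shows "f \<in> borel_measurable (Rn n)"
proof -
  define r where "r = (\<lambda>x::nat \<Rightarrow> real. \<lambda>i\<in>{..<n}. x i)"
  have "continuous_on UNIV r"
  proof (rule continuous_on_coordinatewise_then_product)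
    fix i show "continuous_on UNIV (\<lambda>x. r x i)"
      by (cases "i < n") (simp_all add: r_def continuous_on_product_coordinates)
  qed
  moreover have "continuous_on (r ` UNIV) f"
    by (rule continuous_on_subset[OF f]) (auto simp: r_def space_Rn split: if_splits)
  ultimately have "continuous_on UNIV (\<lambda>x. f (r x))"
    using continuous_on_compose2 by blast
  then have 1: "(\<lambda>x. f (r x)) \<in> borel_measurable borel"
    by (rule borel_measurable_continuous_onI)
  have 2: "(\<lambda>x. x) \<in> borel_measurable (Rn n)"
  proof (rule measurable_coordinatewise_then_product)
    fix i show "(\<lambda>x. x i) \<in> borel_measurable (Rn n)"
    proof (cases "i < n")
      \<comment> \<open>On R^n a coordinate outside the index set is the constant
        \<open>undefined\<close>.\<close>
      case False
      then have "(\<lambda>x. x i) \<in> borel_measurable (Rn n) \<longleftrightarrow> (\<lambda>x. undefined :: real) \<in> borel_measurable (Rn n)"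
        by (intro measurable_cong) (auto simp: space_Rn PiE_iff extensional_def)
      then show ?thesis by simp
    qed (rule measurable_Rn_component)
  qed
  have "(\<lambda>x. f (r x)) \<in> borel_measurable (Rn n)"
    by (rule measurable_compose[OF 2 1])
  moreover have "f (r x) = f x" if "x \<in> space (Rn n)" for x
    using that by (intro arg_cong[of _ _ f]) (auto simp: r_def space_Rn PiE_iff extensional_def)
  ultimately show ?thesis by (simp cong: measurable_cong)
qed

text \<open>Each coordinate is continuous and hence bounded on \<open>K\<close>; the sum of the
  finitely many nonnegative bounds serves all \<open>i < n\<close> at once.\<close>

lemma compact_Rn_bounded:
  fixes K :: "(nat \<Rightarrow> real) set"
  assumes "compact K"
  obtains R where "\<And>x i. x \<in> K \<Longrightarrow> i < n \<Longrightarrow> \<bar>x i\<bar> \<le> R"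
proof -
  have "\<exists>M\<ge>0. \<forall>x\<in>K. \<bar>x i\<bar> \<le> M" for i :: nat
  proof -
    have "compact ((\<lambda>x. x i) ` K)"
      using assms by (intro compact_continuous_image continuous_on_product_coordinates
        continuous_on_subset[OF continuous_on_product_coordinates]) auto
    then have "bounded ((\<lambda>x. x i) ` K)" by (rule compact_imp_bounded)
    then show ?thesis unfolding bounded_pos by (metis imageI less_imp_le real_norm_def)
  qed
  then obtain M where M: "\<And>i. M i \<ge> 0" "\<And>i x. x \<in> K \<Longrightarrow> \<bar>x i\<bar> \<le> M i" by metis
  show ?thesis
  proof
    fix x and i :: nat assume "x \<in> K" "i < n"
    have "\<bar>x i\<bar> \<le> M i" using M \<open>x \<in> K\<close> by blast
    also have "\<dots> \<le> (\<Sum>i<n. M i)" using M \<open>i < n\<close> by (intro member_le_sum) auto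
    finally show "\<bar>x i\<bar> \<le> (\<Sum>i<n. M i)" .
  qed
qed

lemma compact_support_L2:
  fixes g :: "(nat \<Rightarrow> real) \<Rightarrow> real"
  assumes g: "continuous_on (space (Rn n)) g" and K: "compact K" "K \<subseteq> space (Rn n)"
    and 0: "\<And>x. x \<in> space (Rn n) \<Longrightarrow> x \<notin> K \<Longrightarrow> g x = 0"
  shows "g \<in> L2 n"
proof -
  have m: "g \<in> borel_measurable (Rn n)" using g by (rule continuous_on_Rn_measurable)
  have "compact (g ` K)" using g K by (intro compact_continuous_image) (auto intro: continuous_on_subset)
  then obtain M where M: "\<And>x. x \<in> K \<Longrightarrow> \<bar>g x\<bar> \<le> M"
    using compact_imp_bounded bounded_iff by (metis imageI real_norm_def)
  obtain R where R: "\<And>x i. x \<in> K \<Longrightarrow> i < n \<Longrightarrow> \<bar>x i\<bar> \<le> R"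
    using compact_Rn_bounded[OF K(1)] by blast
  define B where "B = Pi\<^sub>E {..<n} (\<lambda>_. {- R..R})"
  have B: "B \<in> sets (Rn n)" unfolding B_def by measurable
  have "emeasure (Rn n) B = (\<Prod>i<n. emeasure lborel {- R..R})"
    unfolding B_def by (rule emeasure_Rn_PiE) simp
  also have "\<dots> < \<infinity>" by (cases "0 \<le> R") (auto simp: less_top[symmetric] power_eq_top_ennreal)
  finally have fin: "emeasure (Rn n) B < \<infinity>" .
  show ?thesis
  proof (rule L2I[OF m Bochner_Integration.integrable_bound])
    show "integrable (Rn n) (\<lambda>x. M\<^sup>2 * indicator B x)"
      using B fin by (intro integrable_mult_right integrable_real_indicator)
    show "AE x in Rn n. norm ((g x)\<^sup>2) \<le> norm (M\<^sup>2 * indicator B x)"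
    proof (intro AE_I2)
      fix x assume x: "x \<in> space (Rn n)"
      show "norm ((g x)\<^sup>2) \<le> norm (M\<^sup>2 * indicator B x)"
      proof (cases "x \<in> K")
        case True
        then have "x i \<in> {- R..R}" if "i < n" for i using R[of x i] that by (simp add: abs_le_iff)
        then have "x \<in> B" using x by (auto simp: B_def space_Rn PiE_iff)
        then show ?thesis using M[OF True] power_mono[OF M[OF True], of 2] by simp
      qed (use 0[OF x] in simp)
    qed
    show "(\<lambda>x. (g x)\<^sup>2) \<in> borel_measurable (Rn n)" using m by measurable
  qed
qed

section \<open>Supports and derivatives of test functions\<close>

lemma test_functionsI:
  assumes "smooth n \<phi>" "compact K" "\<And>x. x \<in> space (Rn n) \<Longrightarrow> x \<notin> K \<Longrightarrow> \<phi> x = 0"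
  shows "\<phi> \<in> test_functions n"
proof -
  have "closure {x \<in> space (Rn n). \<phi> x \<noteq> 0} \<subseteq> K"
    using assms by (intro closure_minimal compact_imp_closed) auto
  then have "compact (K \<inter> closure {x \<in> space (Rn n). \<phi> x \<noteq> 0})"
    using assms by (intro compact_Int_closed) auto
  moreover have "K \<inter> closure {x \<in> space (Rn n). \<phi> x \<noteq> 0} = closure {x \<in> space (Rn n). \<phi> x \<noteq> 0}"
    using \<open>closure _ \<subseteq> K\<close> by blast
  ultimately show ?thesis using assms by (simp add: test_functions_def)
qed

lemma test_functions_support:
  assumes "\<phi> \<in> test_functions n"
  obtains K where "compact K" "K \<subseteq> space (Rn n)" "\<And>x. x \<in> space (Rn n) \<Longrightarrow> x \<notin> K \<Longrightarrow> \<phi> x = 0"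
proof
  show "compact (closure {x \<in> space (Rn n). \<phi> x \<noteq> 0})"
    using assms by (simp add: test_functions_def)
  show "closure {x \<in> space (Rn n). \<phi> x \<noteq> 0} \<subseteq> space (Rn n)"
    by (rule closure_minimal[OF _ closed_space_Rn]) auto
  show "\<phi> x = 0" if "x \<in> space (Rn n)" "x \<notin> closure {x \<in> space (Rn n). \<phi> x \<noteq> 0}" for x
    using that closure_subset[of "{x \<in> space (Rn n). \<phi> x \<noteq> 0}"] by auto
qed

lemma partials_eq_0:
  assumes K: "closed K" and 0: "\<And>x. x \<in> space (Rn n) \<Longrightarrow> x \<notin> K \<Longrightarrow> \<phi> x = 0"
    and "is \<in> lists {..<n}" "x \<in> space (Rn n)" "x \<notin> K"
  shows "partials is \<phi> x = 0"
  using assms(3-5)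
proof (induction "is" arbitrary: x)
  case (Cons i js)
  then have i: "i < n" and js: "js \<in> lists {..<n}" by auto
  \<comment> \<open>The complement of \<open>K\<close> contains a piece of the coordinate line
    around \<open>x\<close>, so the function to be differentiated vanishes near \<open>x i\<close>
    and not just at it.\<close>
  have "open ((\<lambda>s. x(i := s)) -` (- K))"
    using K by (intro open_vimage continuous_on_fun_upd) auto
  then have "\<forall>\<^sub>F s in nhds (x i). s \<in> (\<lambda>s. x(i := s)) -` (- K)"
    using Cons.prems by (intro eventually_nhds_in_open) auto
  then have "\<forall>\<^sub>F s in nhds (x i). partials js \<phi> (x(i := s)) = 0"
    by eventually_elim (use Cons js i in \<open>auto intro!: Cons.IH fun_upd_in_space_Rn\<close>)
  then have "partial i (partials js \<phi>) x = deriv (\<lambda>s. 0) (x i)"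
    unfolding partial_def by (intro deriv_cong_ev) auto
  then show ?case by simp
qed (use 0 in simp)

lemma test_functions_partials_L2:
  assumes \<phi>: "\<phi> \<in> test_functions n" and "is": "is \<in> lists {..<n}"
  shows "partials is \<phi> \<in> L2 n"
proof -
  obtain K where K: "compact K" "K \<subseteq> space (Rn n)" "\<And>x. x \<in> space (Rn n) \<Longrightarrow> x \<notin> K \<Longrightarrow> \<phi> x = 0"
    using test_functions_support[OF \<phi>] by blast
  show ?thesis
  proof (rule compact_support_L2[OF _ K(1,2)])
    show "continuous_on (space (Rn n)) (partials is \<phi>)"
      using \<phi> "is" by (auto simp: test_functions_def smooth_def)
    show "partials is \<phi> x = 0" if "x \<in> space (Rn n)" "x \<notin> K" for x
      by (rule partials_eq_0[OF compact_imp_closed[OF K(1)] _ "is" that]) (rule K(3))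
  qed
qed

lemma test_functions_L2: "\<phi> \<in> test_functions n \<Longrightarrow> \<phi> \<in> L2 n"
  using test_functions_partials_L2[of \<phi> n "[]"] by simp

text \<open>Coordinates outside the index set stay as they are. Unlike a restricted sum this is a
  bijection of all sequences that commutes with \<open>fun_upd\<close>, so
  \<open>partials_translate\<close> needs no assumption on the point.\<close>

definition translate :: "nat \<Rightarrow> (nat \<Rightarrow> real) \<Rightarrow> (nat \<Rightarrow> real) \<Rightarrow> nat \<Rightarrow> real" where
  "translate n c x = (\<lambda>i. x i + (if i < n then c i else 0))"

lemma translate_in_space [simp]: "translate n c x \<in> space (Rn n) \<longleftrightarrow> x \<in> space (Rn n)"
  by (auto simp: translate_def space_Rn PiE_iff extensional_def)

lemma continuous_on_translate: "continuous_on A (translate n c)"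
proof (rule continuous_on_coordinatewise_then_product)
  fix i show "continuous_on A (\<lambda>x. translate n c x i)"
    unfolding translate_def
    by (intro continuous_intros continuous_on_subset[OF continuous_on_product_coordinates]) auto
qed

lemma translate_translate: "translate n (\<lambda>i. - c i) (translate n c x) = x"
  by (auto simp: translate_def)

lemma translate_fun_upd: "i < n \<Longrightarrow> translate n c (x(i := s)) = (translate n c x)(i := s + c i)"
  by (auto simp: translate_def)

text \<open>Differentiability is not assumed: the numbers that are derivatives coincide on both
  sides, and so do the values that \<open>deriv\<close> selects.\<close>

lemma deriv_shift: "deriv (\<lambda>s. f (s + c)) x = deriv f (x + c :: real)"
proof -
  have "DERIV (\<lambda>s. f (s + c)) x :> D \<longleftrightarrow> DERIV f (x + c) :> D" for D
    by (rule DERIV_shift[symmetric])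
  then show ?thesis by (simp add: deriv_def)
qed

lemma partials_translate:
  assumes "is \<in> lists {..<n}"
  shows "partials is (\<lambda>x. \<phi> (translate n c x)) x = partials is \<phi> (translate n c x)"
  using assms
proof (induction "is" arbitrary: x)
  case (Cons i js)
  then have i: "i < n" by auto
  have "partials (i # js) (\<lambda>x. \<phi> (translate n c x)) x
      = deriv (\<lambda>s. partials js \<phi> ((translate n c x)(i := s + c i))) (x i)"
    unfolding partials.simps partial_def Cons.IH translate_fun_upd[OF i] ..
  also have "\<dots> = partials (i # js) \<phi> (translate n c x)"
    using i deriv_shift[of "\<lambda>s. partials js \<phi> ((translate n c x)(i := s))" "c i" "x i"]
    by (simp add: partial_def) (simp add: translate_def)
  finally show ?case .
qed simp

lemma test_functions_translate:
  assumes \<phi>: "\<phi> \<in> test_functions n"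
  shows "(\<lambda>x. \<phi> (translate n c x)) \<in> test_functions n"
proof -
  obtain K where K: "compact K" "K \<subseteq> space (Rn n)" "\<And>x. x \<in> space (Rn n) \<Longrightarrow> x \<notin> K \<Longrightarrow> \<phi> x = 0"
    using test_functions_support[OF \<phi>] by blast
  have sm: "smooth n \<phi>" using \<phi> by (simp add: test_functions_def)
  show ?thesis
  proof (rule test_functionsI)
    show "compact (translate n (\<lambda>i. - c i) ` K)"
      using K(1) by (intro compact_continuous_image continuous_on_translate)
    show "\<phi> (translate n c x) = 0" if "x \<in> space (Rn n)" "x \<notin> translate n (\<lambda>i. - c i) ` K" for x
    proof -
      have "translate n c x \<notin> K"
        using that(2) translate_translate[of n c x] by (metis imageI)
      then show ?thesis using K(3) that(1) by simp
    qed
    show "smooth n (\<lambda>x. \<phi> (translate n c x))"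
      unfolding smooth_def
    proof (intro ballI conjI allI impI)
      fix "is" assume "is": "is \<in> lists {..<n}"
      have "continuous_on (translate n c ` space (Rn n)) (partials is \<phi>)"
        using sm "is" unfolding smooth_def by (auto intro: continuous_on_subset)
      then show "continuous_on (space (Rn n)) (partials is (\<lambda>x. \<phi> (translate n c x)))"
        unfolding partials_translate[OF "is"] 
        by (intro continuous_on_compose2[OF _ continuous_on_translate]) auto
      fix i x assume i: "i < n" and x: "x \<in> space (Rn n)"
      have "(\<lambda>s. partials is \<phi> ((translate n c x)(i := s))) field_differentiable at (translate n c x i)"
        using sm "is" i x unfolding smooth_def by auto
      then have "(\<lambda>s. partials is \<phi> ((translate n c x)(i := s + c i))) field_differentiable at (x i)"
        using i unfolding field_differentiable_def translate_def by (auto simp: DERIV_shift)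
      then show "(\<lambda>s. partials is (\<lambda>x. \<phi> (translate n c x)) (x(i := s))) field_differentiable at (x i)"
        unfolding partials_translate[OF "is"] translate_fun_upd[OF i] .
    qed
  qed
qed

lemma partials_linear:
  assumes f: "smooth n f" and g: "smooth n g" and "is": "is \<in> lists {..<n}" and x: "x \<in> space (Rn n)"
  shows "partials is (\<lambda>x. a * f x + b * g x) x = a * partials is f x + b * partials is g x"
  using "is" x
proof (induction "is" arbitrary: x)
  case (Cons i js)
  then have i: "i < n" and js: "js \<in> lists {..<n}" by auto
  have D: "(\<lambda>s. partials js f (x(i := s))) field_differentiable at (x i)"
    "(\<lambda>s. partials js g (x(i := s))) field_differentiable at (x i)"
    using f g i js Cons.prems unfolding smooth_def by auto
  have "partials (i # js) (\<lambda>x. a * f x + b * g x) x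
      = deriv (\<lambda>s. a * partials js f (x(i := s)) + b * partials js g (x(i := s))) (x i)"
    using Cons i js by (simp add: partial_def fun_upd_in_space_Rn)
  also have "\<dots> = a * partials (i # js) f x + b * partials (i # js) g x"
    using D by (simp add: partial_def deriv_add deriv_cmult field_differentiable_mult)
  finally show ?case .
qed simp

lemma test_functions_linear:
  assumes f: "f \<in> test_functions n" and g: "g \<in> test_functions n"
  shows "(\<lambda>x. a * f x + b * g x) \<in> test_functions n"
proof -
  obtain K where K: "compact K" "K \<subseteq> space (Rn n)" "\<And>x. x \<in> space (Rn n) \<Longrightarrow> x \<notin> K \<Longrightarrow> f x = 0"
    using test_functions_support[OF f] by blast
  obtain L where L: "compact L" "L \<subseteq> space (Rn n)" "\<And>x. x \<in> space (Rn n) \<Longrightarrow> x \<notin> L \<Longrightarrow> g x = 0"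
    using test_functions_support[OF g] by blast
  have sm: "smooth n f" "smooth n g" using f g by (auto simp: test_functions_def)
  show ?thesis
  proof (rule test_functionsI)
    show "compact (K \<union> L)" using K L by blast
    show "a * f x + b * g x = 0" if "x \<in> space (Rn n)" "x \<notin> K \<union> L" for x
      using that K(3) L(3) by simp
    show "smooth n (\<lambda>x. a * f x + b * g x)"
      unfolding smooth_def
    proof (intro ballI conjI allI impI)
      fix "is" assume "is": "is \<in> lists {..<n}"
      have "continuous_on (space (Rn n)) (\<lambda>x. a * partials is f x + b * partials is g x)"
        using sm "is" unfolding smooth_def by (intro continuous_intros) auto
      then show "continuous_on (space (Rn n)) (partials is (\<lambda>x. a * f x + b * g x))"
        using partials_linear[OF sm "is"] by (simp cong: continuous_on_cong)
      fix i x assume i: "i < n" and x: "x \<in> space (Rn n)"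
      have "(\<lambda>s. a * partials is f (x(i := s)) + b * partials is g (x(i := s))) field_differentiable at (x i)"
        using sm "is" i x unfolding smooth_def by (intro derivative_intros field_differentiable_add
            field_differentiable_mult) auto
      then show "(\<lambda>s. partials is (\<lambda>x. a * f x + b * g x) (x(i := s))) field_differentiable at (x i)"
        using partials_linear[OF sm "is"] fun_upd_in_space_Rn[OF x i] by simp
    qed
  qed
qed

section \<open>Smooth tensor products as test functions\<close>

definition tensor :: "nat \<Rightarrow> (nat \<Rightarrow> real \<Rightarrow> real) \<Rightarrow> (nat \<Rightarrow> real) \<Rightarrow> real" where
  "tensor n F x = (\<Prod>i<n. F i (x i))"

definition smooth1 :: "(real \<Rightarrow> real) \<Rightarrow> bool" where
  "smooth1 f \<longleftrightarrow> (\<forall>k x. (deriv ^^ k) f field_differentiable at x)"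

lemma smooth1_DERIV: "smooth1 f \<Longrightarrow> ((deriv ^^ k) f has_real_derivative (deriv ^^ Suc k) f x) (at x)"
  by (simp add: smooth1_def DERIV_deriv_iff_field_differentiable)

lemma smooth1_continuous: "smooth1 f \<Longrightarrow> continuous_on A ((deriv ^^ k) f)"
  by (meson DERIV_continuous_on has_field_derivative_at_within smooth1_DERIV)

lemma smooth1_derivs: "smooth1 f \<Longrightarrow> smooth1 ((deriv ^^ k) f)"
  unfolding smooth1_def by (metis comp_apply funpow_add)

lemma tensor_fun_upd:
  assumes "i < n"
  shows "tensor n F (x(i := s)) = F i s * (\<Prod>j\<in>{..<n} - {i}. F j (x j))"
  unfolding tensor_def using assms by (subst prod.remove[of _ i]) (auto intro!: prod.cong)

lemma tensor_field_derivative: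
  assumes "i < n" "(F i has_real_derivative D) (at (x i))"
  shows "((\<lambda>s. tensor n F (x(i := s))) has_real_derivative D * (\<Prod>j\<in>{..<n} - {i}. F j (x j))) (at (x i))"
  unfolding tensor_fun_upd[OF assms(1)] by (intro DERIV_cmult_right assms)

lemma tensor_upd_function:
  assumes "i < n"
  shows "tensor n (F(i := g)) x = g (x i) * (\<Prod>j\<in>{..<n} - {i}. F j (x j))"
  unfolding tensor_def using assms by (subst prod.remove[of _ i]) (auto intro!: prod.cong)

text \<open>A derivative in direction \<open>i\<close> touches only the factor \<open>i\<close>, so
  the order of the directions is immaterial and each factor is differentiated as often as its index
  occurs in the list.\<close>

lemma partials_tensor:
  assumes "\<And>i. i < n \<Longrightarrow> smooth1 (F i)" "is \<in> lists {..<n}"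
  shows "partials is (tensor n F) = tensor n (\<lambda>i. (deriv ^^ count_list is i) (F i))"
  using assms(2)
proof (induction "is")
  case (Cons i js)
  then have i: "i < n" and IH: "partials js (tensor n F) = tensor n (\<lambda>i. (deriv ^^ count_list js i) (F i))"
    by auto
  define G where "G = (\<lambda>i. (deriv ^^ count_list js i) (F i))"
  show ?case
  proof
    fix x
    have "(G i has_real_derivative deriv (G i) (x i)) (at (x i))"
      using smooth1_DERIV[OF assms(1)[OF i]] by (simp add: G_def)
    from tensor_field_derivative[of i n G _ x, OF i this]
    have "partials (i # js) (tensor n F) x = deriv (G i) (x i) * (\<Prod>j\<in>{..<n} - {i}. G j (x j))"
      by (simp add: partial_def IH G_def DERIV_imp_deriv)
    also have "\<dots> = tensor n (G(i := deriv (G i))) x"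
      using tensor_upd_function[OF i] by simp
    also have "G(i := deriv (G i)) = (\<lambda>k. (deriv ^^ count_list (i # js) k) (F k))"
      by (auto simp: G_def)
    finally show "partials (i # js) (tensor n F) x = tensor n (\<lambda>k. (deriv ^^ count_list (i # js) k) (F k)) x" .
  qed
qed (simp add: fun_eq_iff)

lemma tensor_test_function:
  assumes F: "\<And>i. i < n \<Longrightarrow> smooth1 (F i)"
    and supp: "\<And>i x. i < n \<Longrightarrow> x \<notin> {a i..b i} \<Longrightarrow> F i x = 0"
  shows "tensor n F \<in> test_functions n"
proof (rule test_functionsI)
  \<comment> \<open>A box in the space of all sequences: the singletons place it inside R^n, and
    Tychonoff's theorem makes it compact.\<close>
  let ?K = "Pi\<^sub>E UNIV (\<lambda>i. if i < n then {a i..b i} else {undefined})"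
  have "compactin (product_topology (\<lambda>i. euclidean) UNIV) ?K"
    by (subst compactin_PiE) auto
  then show "compact ?K" by (simp add: euclidean_product_topology)
  show "tensor n F x = 0" if "x \<in> space (Rn n)" "x \<notin> ?K" for x
  proof -
    have "\<exists>i<n. x i \<notin> {a i..b i}"
      by (rule ccontr) (use that in \<open>auto simp: space_Rn PiE_iff extensional_def split: if_splits\<close>)
    then obtain i where "i < n" "x i \<notin> {a i..b i}" by blast
    then show ?thesis using supp[of i "x i"] by (auto simp: tensor_def)
  qed
  show "smooth n (tensor n F)"
    unfolding smooth_def
  proof (intro ballI conjI allI impI)
    fix "is" assume "is": "is \<in> lists {..<n}"
    define G where "G = (\<lambda>i. (deriv ^^ count_list is i) (F i))"
    have eq: "partials is (tensor n F) = tensor n G"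
      using partials_tensor[OF F "is"] by (simp add: G_def)
    have "continuous_on UNIV (\<lambda>x. G i (x i))" if "i < n" for i
      using smooth1_continuous[OF F[OF that], of UNIV] unfolding G_def
      by (intro continuous_on_compose2[OF _ continuous_on_product_coordinates]) auto
    then show "continuous_on (space (Rn n)) (partials is (tensor n F))"
      unfolding eq tensor_def
      by (intro continuous_on_prod) (auto intro: continuous_on_subset)
    fix i x assume i: "i < n" and x: "x \<in> space (Rn n)"
    have "(G i has_real_derivative deriv (G i) (x i)) (at (x i))"
      using smooth1_DERIV[OF F[OF i]] by (simp add: G_def)
    from tensor_field_derivative[of i n G _ x, OF i this]
    show "(\<lambda>s. partials is (tensor n F) (x(i := s))) field_differentiable at (x i)"
      unfolding eq field_differentiable_def by blast
  qed
qed

section \<open>Weak derivatives and the heat semigroup\<close>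

lemma translate_diff_Rn: "x \<in> space (Rn n) \<Longrightarrow> translate n y (diff_Rn n x y) = x"
  by (auto simp: translate_def diff_Rn_def space_Rn PiE_iff extensional_def fun_eq_iff)

lemma has_weak_deriv_iff:
  "has_weak_deriv n is u g \<longleftrightarrow>
    (\<forall>\<phi>\<in>test_functions n. ip n u (partials is \<phi>) = (- 1) ^ length is * ip n g \<phi>)"
  by (simp add: has_weak_deriv_def ip_def)

text \<open>Translation invariance of the measure moves the shift from \<open>f\<close> to the test
  function. The empty list gives the case without derivatives.\<close>

lemma ip_diff_Rn_left:
  assumes f: "f \<in> L2 n" and y: "y \<in> space (Rn n)" and "is": "is \<in> lists {..<n}" and \<phi>: "\<phi> \<in> test_functions n"
  shows "ip n (\<lambda>x. f (diff_Rn n x y)) (partials is \<phi>) = ip n f (partials is (\<lambda>x. \<phi> (translate n y x)))"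
proof -
  let ?\<phi> = "\<lambda>x. \<phi> (translate n y x)"
  have "partials is ?\<phi> \<in> L2 n"
    by (intro test_functions_partials_L2 test_functions_translate \<phi> "is")
  then have [measurable]: "(\<lambda>x. f x * partials is ?\<phi> x) \<in> borel_measurable (Rn n)"
    using f by measurable
  have "ip n f (partials is ?\<phi>) = (\<integral>x. f (diff_Rn n x y) * partials is ?\<phi> (diff_Rn n x y) \<partial>Rn n)"
    unfolding ip_def using y by (subst integral_diff_Rn_left[symmetric, of _ n y]) auto
  also have "\<dots> = ip n (\<lambda>x. f (diff_Rn n x y)) (partials is \<phi>)"
    unfolding ip_def
    by (intro Bochner_Integration.integral_cong) (simp_all add: partials_translate[OF "is"] translate_diff_Rn)
  finally show ?thesis ..
qed

text \<open>
  \<open>T\<^sub>t \<phi>\<close> is not compactly supported, so the derivative is moved across under the integral over all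
  translates of \<open>\<phi>\<close>, which are test functions.
\<close>

lemma has_weak_deriv_heat:
  assumes f: "f \<in> L2 n" and g: "g \<in> L2 n" and "is": "is \<in> lists {..<n}" and w: "has_weak_deriv n is f g"
    and t: "t \<ge> 0"
  shows "has_weak_deriv n is (heat n t f) (heat n t g)"
proof (cases "t = 0")
  case False
  with t have t: "t > 0" by simp
  show ?thesis
    unfolding has_weak_deriv_iff
  proof
    fix \<phi> assume \<phi>: "\<phi> \<in> test_functions n"
    have "ip n (heat n t f) (partials is \<phi>)
        = (\<integral>y. heat_kernel n t y * ip n (\<lambda>x. f (diff_Rn n x y)) (partials is \<phi>) \<partial>Rn n)"
      by (intro ip_heat_translates t f test_functions_partials_L2 \<phi> "is")
    also have "\<dots> = (\<integral>y. (- 1) ^ length is * (heat_kernel n t y * ip n (\<lambda>x. g (diff_Rn n x y)) \<phi>) \<partial>Rn n)"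
    proof (intro Bochner_Integration.integral_cong refl)
      fix y assume y: "y \<in> space (Rn n)"
      have "ip n (\<lambda>x. f (diff_Rn n x y)) (partials is \<phi>) = ip n f (partials is (\<lambda>x. \<phi> (translate n y x)))"
        by (rule ip_diff_Rn_left[OF f y "is" \<phi>])
      also have "\<dots> = (- 1) ^ length is * ip n g (\<lambda>x. \<phi> (translate n y x))"
        using w test_functions_translate[OF \<phi>] unfolding has_weak_deriv_iff by blast
      also have "ip n g (\<lambda>x. \<phi> (translate n y x)) = ip n (\<lambda>x. g (diff_Rn n x y)) \<phi>"
        using ip_diff_Rn_left[OF g y _ \<phi>, of "[]"] by simp
      finally show "heat_kernel n t y * ip n (\<lambda>x. f (diff_Rn n x y)) (partials is \<phi>)
          = (- 1) ^ length is * (heat_kernel n t y * ip n (\<lambda>x. g (diff_Rn n x y)) \<phi>)" by simp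
    qed
    also have "\<dots> = (- 1) ^ length is * ip n (heat n t g) \<phi>"
      by (simp add: ip_heat_translates[OF t g test_functions_L2[OF \<phi>]])
    finally show "ip n (heat n t f) (partials is \<phi>) = (- 1) ^ length is * ip n (heat n t g) \<phi>" .
  qed
qed (use w in simp)

lemma has_weak_deriv_linear:
  assumes "f \<in> L2 n" "g \<in> L2 n" "f' \<in> L2 n" "g' \<in> L2 n" "is \<in> lists {..<n}"
    and "has_weak_deriv n is f f'" "has_weak_deriv n is g g'"
  shows "has_weak_deriv n is (\<lambda>x. a * f x + b * g x) (\<lambda>x. a * f' x + b * g' x)"
  using assms unfolding has_weak_deriv_iff
  by (simp add: ip_add_left ip_cmult_left L2_intros test_functions_partials_L2 test_functions_L2 algebra_simps)

section \<open>Sobolev functions and the Laplacian\<close>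

lemma weak_deriv_spec:
  assumes "u \<in> sobolev n k" "is \<in> lists {..<n}" "length is \<le> k"
  shows "weak_deriv n is u \<in> L2 n" "has_weak_deriv n is u (weak_deriv n is u)"
proof -
  have "\<exists>g. g \<in> L2 n \<and> has_weak_deriv n is u g"
    using assms by (auto simp: sobolev_def)
  from someI_ex[OF this]
  show "weak_deriv n is u \<in> L2 n" "has_weak_deriv n is u (weak_deriv n is u)"
    by (auto simp: weak_deriv_def)
qed

lemma sobolev_L2: "u \<in> sobolev n k \<Longrightarrow> u \<in> L2 n"
  by (simp add: sobolev_def)

lemma laplacian_L2: "u \<in> H2 n \<Longrightarrow> laplacian n u \<in> L2 n"
  unfolding laplacian_def[abs_def] by (intro L2_sum weak_deriv_spec[of _ _ 2]) auto

text \<open>The classical Laplacian of a test function; \<open>laplacian\<close> is built from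
  chosen weak derivatives, which are determined only almost everywhere.\<close>

definition test_laplacian :: "nat \<Rightarrow> ((nat \<Rightarrow> real) \<Rightarrow> real) \<Rightarrow> (nat \<Rightarrow> real) \<Rightarrow> real" where
  "test_laplacian n \<phi> x = (\<Sum>i<n. partials [i, i] \<phi> x)"

lemma test_laplacian_L2: "\<phi> \<in> test_functions n \<Longrightarrow> test_laplacian n \<phi> \<in> L2 n"
  unfolding test_laplacian_def[abs_def] by (intro L2_sum test_functions_partials_L2) auto

text \<open>Integration by parts against a function without compact support. The flow is first moved
  onto the weak derivatives of \<open>u\<close>, with which it commutes, so that the test function
  itself is differentiated; afterwards it is moved back.\<close>

lemma ip_heat_laplacian:
  assumes u: "u \<in> H2 n" and \<phi>: "\<phi> \<in> test_functions n" and t: "t \<ge> 0"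
  shows "ip n (laplacian n u) (heat n t \<phi>) = ip n u (heat n t (test_laplacian n \<phi>))"
proof -
  note uL = sobolev_L2[OF u]
  have w: "weak_deriv n [i, i] u \<in> L2 n" "has_weak_deriv n [i, i] u (weak_deriv n [i, i] u)" if "i < n" for i
    using weak_deriv_spec[OF u, of "[i, i]"] that by auto
  have "ip n (laplacian n u) (heat n t \<phi>) = (\<Sum>i<n. ip n (weak_deriv n [i, i] u) (heat n t \<phi>))"
    unfolding laplacian_def[abs_def]
    by (intro ip_sum_left w heat_L2(1) t test_functions_L2 \<phi>) auto
  also have "\<dots> = (\<Sum>i<n. ip n (heat n t u) (partials [i, i] \<phi>))"
  proof (intro sum.cong refl)
    fix i assume "i \<in> {..<n}" then have i: "i < n" by simp
    have "ip n (weak_deriv n [i, i] u) (heat n t \<phi>) = ip n (heat n t (weak_deriv n [i, i] u)) \<phi>"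
      by (intro heat_selfadjoint[symmetric] t w i test_functions_L2 \<phi>)
    also have "\<dots> = ip n (heat n t u) (partials [i, i] \<phi>)"
      using has_weak_deriv_heat[OF uL w(1) _ w(2) t, OF i _ i] \<phi> i unfolding has_weak_deriv_iff by simp
    finally show "ip n (weak_deriv n [i, i] u) (heat n t \<phi>) = ip n (heat n t u) (partials [i, i] \<phi>)" .
  qed
  also have "\<dots> = ip n (heat n t u) (test_laplacian n \<phi>)"
    unfolding test_laplacian_def[abs_def]
    by (intro ip_sum_right[symmetric] test_functions_partials_L2 \<phi> heat_L2(1) t uL) auto
  also have "\<dots> = ip n u (heat n t (test_laplacian n \<phi>))"
    by (intro heat_selfadjoint t uL test_laplacian_L2 \<phi>)
  finally show ?thesis .
qed

section \<open>Bump functions of one variable\<close>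

text \<open>Differentiability of order \<open>k\<close> with unnamed derivatives. Sums, products and
  affine substitutions follow by induction on \<open>k\<close> without computing iterates of
  \<open>deriv\<close>.\<close>

primrec kdiff :: "nat \<Rightarrow> (real \<Rightarrow> real) \<Rightarrow> bool" where
  "kdiff 0 f \<longleftrightarrow> True"
| "kdiff (Suc k) f \<longleftrightarrow> (\<exists>f'. (\<forall>x. (f has_real_derivative f' x) (at x)) \<and> kdiff k f')"

lemma kdiff_SucD: "kdiff (Suc k) f \<Longrightarrow> kdiff k f"
proof (induction k arbitrary: f)
  case (Suc k)
  then obtain f' where "\<forall>x. (f has_real_derivative f' x) (at x)" "kdiff (Suc k) f'" by auto
  then show ?case using Suc.IH[of f'] by auto
qed simp

lemma kdiff_add: "kdiff k f \<Longrightarrow> kdiff k g \<Longrightarrow> kdiff k (\<lambda>x. f x + g x)"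
proof (induction k arbitrary: f g)
  case (Suc k)
  then obtain f' g' where "\<forall>x. (f has_real_derivative f' x) (at x)" "kdiff k f'"
    "\<forall>x. (g has_real_derivative g' x) (at x)" "kdiff k g'" by auto
  then show ?case using Suc.IH[of f' g'] by (auto intro!: exI[of _ "\<lambda>x. f' x + g' x"] DERIV_add)
qed simp

lemma kdiff_mult: "kdiff k f \<Longrightarrow> kdiff k g \<Longrightarrow> kdiff k (\<lambda>x. f x * g x)"
proof (induction k arbitrary: f g)
  case (Suc k)
  then obtain f' g' where f': "\<And>x. (f has_real_derivative f' x) (at x)" "kdiff k f'"
    and g': "\<And>x. (g has_real_derivative g' x) (at x)" "kdiff k g'" by auto
  have "((\<lambda>x. f x * g x) has_real_derivative f' x * g x + g' x * f x) (at x)" for x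
    by (rule DERIV_mult[OF f'(1) g'(1)])
  moreover have "kdiff k (\<lambda>x. f' x * g x + g' x * f x)"
    by (intro kdiff_add Suc.IH f' g' kdiff_SucD[OF Suc.prems(1)] kdiff_SucD[OF Suc.prems(2)])
  ultimately show ?case
    unfolding kdiff.simps by (intro exI[of _ "\<lambda>x. f' x * g x + g' x * f x"]) auto
qed simp

lemma kdiff_const: "kdiff k (\<lambda>x. c)"
  by (induction k arbitrary: c) (auto intro!: exI[of _ "\<lambda>_. 0"])

lemma kdiff_affine: "kdiff k f \<Longrightarrow> kdiff k (\<lambda>x. f (c * x + d))"
proof (induction k arbitrary: f)
  case (Suc k)
  then obtain f' where f': "\<And>x. (f has_real_derivative f' x) (at x)" "kdiff k f'" by auto
  have "((\<lambda>x. f (c * x + d)) has_real_derivative f' (c * x + d) * c) (at x)" for x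
    by (rule DERIV_chain2[OF f'(1)]) (auto intro!: derivative_eq_intros)
  moreover have "kdiff k (\<lambda>x. f' (c * x + d) * c)"
    using Suc f' by (intro kdiff_mult kdiff_const)
  ultimately show ?case unfolding kdiff.simps by (intro exI[of _ "\<lambda>x. f' (c * x + d) * c"]) auto
qed simp

text \<open>Each application of \<open>deriv\<close> uses up one order of differentiability, so the
  induction on \<open>j\<close> carries all \<open>k\<close> along; uniqueness of derivatives
  identifies the unnamed derivative with \<open>deriv\<close>.\<close>

lemma smooth1I:
  assumes "\<And>k. kdiff k f" shows "smooth1 f"
proof -
  have "kdiff k ((deriv ^^ j) f)" for j k
  proof (induction j arbitrary: k)
    case (Suc j)
    then obtain f' where "\<And>x. ((deriv ^^ j) f has_real_derivative f' x) (at x)" "kdiff k f'"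
      using Suc.IH[of "Suc k"] unfolding kdiff.simps by blast
    moreover from this have "deriv ((deriv ^^ j) f) = f'"
      by (auto intro: DERIV_imp_deriv)
    ultimately show ?case by simp
  qed (use assms in simp)
  from this[of "Suc 0"] show ?thesis
    by (auto simp: smooth1_def field_differentiable_def)
qed

text \<open>The classical flat function \<open>exp (- 1 / x)\<close>, with a polynomial in
  \<open>1 / x\<close> as a factor so that the family is closed under differentiation.\<close>

definition exp_inv :: "real poly \<Rightarrow> real \<Rightarrow> real" where
  "exp_inv p x = (if x > 0 then poly p (1 / x) * exp (- (1 / x)) else 0)"

lemma poly_exp_decay: "((\<lambda>y. poly p y * exp (- y)) \<longlongrightarrow> 0) (at_top :: real filter)"
proof -
  have "((\<lambda>y. \<Sum>i\<le>degree p. coeff p i * (y ^ i / exp y)) \<longlongrightarrow> (\<Sum>i\<le>degree p. coeff p i * 0)) (at_top :: real filter)"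
    by (intro tendsto_sum tendsto_mult tendsto_const tendsto_power_div_exp_0)
  then show ?thesis
    by (simp add: poly_altdef sum_distrib_right sum_divide_distrib exp_minus field_simps)
qed

text \<open>For \<open>x > 0\<close> the chain rule produces the factor \<open>1 / x^2\<close>, that
  is the monomial \<open>[:0, 0, 1:]\<close> at \<open>1 / x\<close>, and the exponential
  contributes \<open>p\<close> while the polynomial contributes \<open>- pderiv p\<close>. Only the
  point 0 requires a limit.\<close>

lemma exp_inv_DERIV:
  "(exp_inv p has_real_derivative exp_inv ([:0, 0, 1:] * (p - pderiv p)) x) (at x)"
proof -
  consider "x > 0" | "x < 0" | "x = 0" by linarith
  then show ?thesis
  proof cases
    case 1
    have "((\<lambda>x. poly p (1 / x) * exp (- (1 / x))) has_real_derivative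
        exp_inv ([:0, 0, 1:] * (p - pderiv p)) x) (at x)"
      using 1 by (auto intro!: derivative_eq_intros simp: exp_inv_def field_simps power2_eq_square)
    then show ?thesis
      by (rule DERIV_cong_ev[THEN iffD1, rotated -1])
        (use 1 in \<open>auto simp: exp_inv_def intro: eventually_mono[OF eventually_nhds_in_open[of "{0<..}"]]\<close>)
  next
    case 2
    have "((\<lambda>x. 0) has_real_derivative exp_inv ([:0, 0, 1:] * (p - pderiv p)) x) (at x)"
      using 2 by (auto simp: exp_inv_def)
    then show ?thesis
      by (rule DERIV_cong_ev[THEN iffD1, rotated -1])
        (use 2 in \<open>auto simp: exp_inv_def intro: eventually_mono[OF eventually_nhds_in_open[of "{..<0}"]]\<close>)
  next
    case 3
    have "((\<lambda>h. exp_inv p h / h) \<longlongrightarrow> 0) (at_right 0)"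
    proof -
      \<comment> \<open>In the variable \<open>1 / h\<close> the difference quotient is again a
        polynomial times a decaying exponential; \<open>pCons 0\<close> absorbs the division by
        \<open>h\<close>.\<close>
      have "((\<lambda>h. poly (pCons 0 p) (inverse h) * exp (- inverse h)) \<longlongrightarrow> 0) (at_right 0)"
        by (rule filterlim_compose[OF poly_exp_decay filterlim_inverse_at_top_right])
      moreover have "\<forall>\<^sub>F h in at_right 0. poly (pCons 0 p) (inverse h) * exp (- inverse h) = exp_inv p h / h"
        by (auto simp: eventually_at_filter exp_inv_def field_simps)
      ultimately show ?thesis by (rule Lim_transform_eventually)
    qed
    moreover have "((\<lambda>h. exp_inv p h / h) \<longlongrightarrow> 0) (at_left 0)"
      by (rule tendsto_eventually) (auto simp: eventually_at_filter exp_inv_def)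
    ultimately have "((\<lambda>h. exp_inv p h / h) \<longlongrightarrow> 0) (at 0)"
      by (simp add: filterlim_split_at)
    then show ?thesis using 3 by (simp add: has_field_derivative_iff exp_inv_def)
  qed
qed

lemma kdiff_exp_inv: "kdiff k (exp_inv p)"
  using exp_inv_DERIV by (induction k arbitrary: p) auto

text \<open>
  Dilating \<open>exp (- 1 / x)\<close> by \<open>m + 1\<close> makes these functions increase to the indicator of the open interval,
  with support in its closure for every \<open>m\<close>; no plateau functions are needed.
\<close>

definition bump :: "nat \<Rightarrow> real \<Rightarrow> real \<Rightarrow> real \<Rightarrow> real" where
  "bump m a b x = exp_inv 1 (real (Suc m) * (x - a)) * exp_inv 1 (real (Suc m) * (b - x))"

lemma smooth1_bump: "smooth1 (bump m a b)"
proof (rule smooth1I)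
  fix k
  have "kdiff k (\<lambda>x. exp_inv 1 (real (Suc m) * x + - (real (Suc m) * a)) * exp_inv 1 (- real (Suc m) * x +
      real (Suc m) * b))"
    by (intro kdiff_mult kdiff_affine kdiff_exp_inv)
  then show "kdiff k (bump m a b)"
    by (simp add: bump_def[abs_def] algebra_simps)
qed

lemma exp_inv_1_bounds: "0 \<le> exp_inv 1 x" "exp_inv 1 x \<le> 1" "x \<le> 0 \<Longrightarrow> exp_inv 1 x = 0"
  by (auto simp: exp_inv_def)

lemma bump_bounds: "0 \<le> bump m a b x" "bump m a b x \<le> indicator {a<..<b} x" "x \<notin> {a..b} \<Longrightarrow> bump m a b x = 0"
proof -
  have z: "bump m a b x = 0" if "x \<notin> {a<..<b}"
    using that by (auto simp: bump_def exp_inv_1_bounds mult_le_0_iff)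
  show "0 \<le> bump m a b x" by (simp add: bump_def exp_inv_1_bounds)
  show "bump m a b x \<le> indicator {a<..<b} x"
  proof (cases "x \<in> {a<..<b}")
    case True
    then show ?thesis by (simp add: bump_def mult_le_one exp_inv_1_bounds)
  qed (use z in simp)
  show "x \<notin> {a..b} \<Longrightarrow> bump m a b x = 0" using z by auto
qed

lemma exp_inv_1_tendsto:
  assumes "x > 0" shows "(\<lambda>m. exp_inv 1 (real (Suc m) * x)) \<longlonglongrightarrow> 1"
proof -
  have "(\<lambda>m. exp (- ((1 / x) * (1 / real (Suc m))))) \<longlonglongrightarrow> exp (- ((1 / x) * 0))"
    by (intro tendsto_intros LIMSEQ_Suc lim_1_over_n)
  moreover have "exp_inv 1 (real (Suc m) * x) = exp (- ((1 / x) * (1 / real (Suc m))))" for m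
  proof -
    have "0 < real (Suc m) * x" using assms by (intro mult_pos_pos) auto
    then show ?thesis by (simp add: exp_inv_def mult.commute)
  qed
  ultimately show ?thesis by simp
qed

lemma bump_tendsto: "(\<lambda>m. bump m a b x) \<longlonglongrightarrow> indicator {a<..<b} x"
proof (cases "x \<in> {a<..<b}")
  case True
  then have "(\<lambda>m. bump m a b x) \<longlonglongrightarrow> 1 * 1"
    unfolding bump_def by (intro tendsto_mult exp_inv_1_tendsto) auto
  then show ?thesis using True by simp
next
  case False
  then have "bump m a b x = 0" for m
    using bump_bounds(1,2)[of m a b x] by simp
  then show ?thesis using False by simp
qed

section \<open>Compactly supported smooth functions of one variable\<close>

definition test1 :: "(real \<Rightarrow> real) \<Rightarrow> bool" where
  "test1 f \<longleftrightarrow> smooth1 f \<and> (\<exists>a b. \<forall>x. x \<notin> {a..b} \<longrightarrow> f x = 0)"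

lemma test1_bump: "test1 (bump m a b)"
  using smooth1_bump bump_bounds(3) unfolding test1_def by blast

lemma test1_deriv:
  assumes "test1 f" shows "test1 (deriv f)"
proof -
  obtain a b where ab: "\<And>x. x \<notin> {a..b} \<Longrightarrow> f x = 0" using assms by (auto simp: test1_def)
  have "deriv f x = 0" if "x \<notin> {a..b}" for x
  proof -
    have "\<forall>\<^sub>F y in nhds x. y \<in> - {a..b}"
      using that by (intro eventually_nhds_in_open) auto
    then have "\<forall>\<^sub>F y in nhds x. f y = 0" by eventually_elim (use ab in auto)
    then have "deriv f x = deriv (\<lambda>_. 0) x" by (intro deriv_cong_ev) auto
    then show ?thesis by simp
  qed
  moreover have "smooth1 (deriv f)"
    using assms smooth1_derivs[of f 1] by (simp add: test1_def)
  ultimately show ?thesis unfolding test1_def by blast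
qed

lemma test1_derivs: "test1 f \<Longrightarrow> test1 ((deriv ^^ k) f)"
  by (induction k) (auto intro: test1_deriv)

lemma test1_DERIV: "test1 f \<Longrightarrow> ((deriv ^^ k) f has_real_derivative (deriv ^^ Suc k) f x) (at x)"
  unfolding test1_def using smooth1_DERIV by blast

lemma test1_continuous: "test1 f \<Longrightarrow> continuous_on A f"
  using smooth1_continuous[of f A 0] by (simp add: test1_def)

lemma test1_measurable [measurable_dest]: "test1 f \<Longrightarrow> f \<in> borel_measurable borel"
  by (intro borel_measurable_continuous_onI test1_continuous)

text \<open>
  Boundedness by a multiple of \<open>1 / (1 + x\<^sup>2)\<close> replaces compact support, which the heat flow destroys: it is
  preserved by the flow and square integrable.
\<close>

lemma test1_weighted_bound:
  assumes "test1 f"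
  obtains M where "M \<ge> 0" "\<And>x. \<bar>f x\<bar> \<le> M / (1 + x\<^sup>2)"
proof -
  obtain a b where ab: "\<And>x. x \<notin> {a..b} \<Longrightarrow> f x = 0" using assms by (auto simp: test1_def)
  have "compact ((\<lambda>x. f x * (1 + x\<^sup>2)) ` {a..b})"
    using test1_continuous[OF assms, of "{a..b}"]
    by (intro compact_continuous_image continuous_intros) auto
  then obtain M where M: "M > 0" "\<And>x. x \<in> {a..b} \<Longrightarrow> \<bar>f x * (1 + x\<^sup>2)\<bar> \<le> M"
    unfolding compact_eq_bounded_closed bounded_pos by auto
  show ?thesis
  proof
    fix x :: real
    have p: "1 + x\<^sup>2 > 0" by (simp add: add_pos_nonneg)
    have "\<bar>f x\<bar> * (1 + x\<^sup>2) \<le> M"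
      using M ab[of x] p by (cases "x \<in> {a..b}") (auto simp: abs_mult)
    then show "\<bar>f x\<bar> \<le> M / (1 + x\<^sup>2)" using p by (simp add: pos_le_divide_eq)
  qed (use M in simp)
qed

lemma test1_bound:
  assumes "test1 f" obtains M where "M \<ge> 0" "\<And>x. \<bar>f x\<bar> \<le> M"
proof -
  obtain M where M: "M \<ge> 0" "\<And>x. \<bar>f x\<bar> \<le> M / (1 + x\<^sup>2)"
    using test1_weighted_bound[OF assms] by blast
  have "M / (1 + x\<^sup>2) \<le> M" for x
    using M(1) by (simp add: add_pos_nonneg pos_divide_le_eq distrib_left)
  then show ?thesis using that[OF M(1)] M(2) order_trans by blast
qed

section \<open>The heat equation in one variable\<close>

text \<open>The one-variable semigroup, with the shift put on \<open>f\<close> rather than on the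
  kernel: in this form \<open>f\<close> can be expanded about \<open>x\<close> and integrated
  against moments.\<close>

definition heat1 :: "real \<Rightarrow> (real \<Rightarrow> real) \<Rightarrow> real \<Rightarrow> real" where
  "heat1 t f x = (if t = 0 then f x else \<integral>z. kernel1 t z * f (x - z) \<partial>lborel)"

lemma heat1_0 [simp]: "heat1 0 f = f"
  by (simp add: heat1_def fun_eq_iff)

lemma heat1_pos: "t > 0 \<Longrightarrow> heat1 t f x = (\<integral>z. kernel1 t z * f (x - z) \<partial>lborel)"
  by (simp add: heat1_def)

text \<open>A centred normal law of variance \<open>2 * t\<close> has second moment
  \<open>2 * t\<close> and fourth moment \<open>3 * (2 * t)^2\<close>; odd moments vanish by
  symmetry.\<close>

lemma kernel1_moments:
  assumes "t > 0"
  shows "has_bochner_integral lborel (\<lambda>z. kernel1 t z) 1"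
    "has_bochner_integral lborel (\<lambda>z. kernel1 t z * z) 0"
    "has_bochner_integral lborel (\<lambda>z. kernel1 t z * z ^ 2) (2 * t)"
    "has_bochner_integral lborel (\<lambda>z. kernel1 t z * z ^ 3) 0"
    "has_bochner_integral lborel (\<lambda>z. kernel1 t z * z ^ 4) (12 * t\<^sup>2)"
proof -
  have s: "0 < sqrt (2 * t)" using assms by simp
  note e = normal_moment_even[OF s, of 0] and o = normal_moment_odd[OF s, of 0]
  show "has_bochner_integral lborel (\<lambda>z. kernel1 t z) 1"
    using e[of 0] by (simp add: kernel1_def)
  show "has_bochner_integral lborel (\<lambda>z. kernel1 t z * z) 0"
    using o[of 0] by (simp add: kernel1_def)
  show "has_bochner_integral lborel (\<lambda>z. kernel1 t z * z ^ 2) (2 * t)"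
    using e[of 1] assms by (simp add: kernel1_def)
  show "has_bochner_integral lborel (\<lambda>z. kernel1 t z * z ^ 3) 0"
    using o[of 1] by (simp add: kernel1_def eval_nat_numeral)
  show "has_bochner_integral lborel (\<lambda>z. kernel1 t z * z ^ 4) (12 * t\<^sup>2)"
    using e[of 2] assms by (simp add: kernel1_def fact_numeral power2_eq_square field_simps)
qed

lemma heat1_integrable:
  assumes t: "t > 0" and [measurable]: "f \<in> borel_measurable borel" and b: "\<And>x. \<bar>f x\<bar> \<le> B"
  shows "integrable lborel (\<lambda>z. kernel1 t z * f (x - z))"
proof (rule Bochner_Integration.integrable_bound)
  show "integrable lborel (\<lambda>z. B * kernel1 t z)"
    using kernel1_integral(1)[OF t] by simp
  have "B \<ge> 0" using b[of 0] by linarith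
  then show "AE z in lborel. norm (kernel1 t z * f (x - z)) \<le> norm (B * kernel1 t z)"
    using b by (intro AE_I2) (auto simp: abs_mult mult.commute[of B] intro!: mult_left_mono)
qed measurable

lemma heat1_measurable [measurable]:
  assumes [measurable]: "f \<in> borel_measurable borel"
  shows "heat1 t f \<in> borel_measurable borel"
  unfolding heat1_def[abs_def] by measurable

lemma heat1_bound:
  assumes t: "t \<ge> 0" and f: "f \<in> borel_measurable borel" and b: "\<And>x. \<bar>f x\<bar> \<le> B"
  shows "\<bar>heat1 t f x\<bar> \<le> B"
proof (cases "t = 0")
  case False
  with t have t: "t > 0" by simp
  have "\<bar>heat1 t f x\<bar> \<le> (\<integral>z. \<bar>kernel1 t z * f (x - z)\<bar> \<partial>lborel)"
    unfolding heat1_pos[OF t] by (rule integral_abs_bound)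
  also have "\<dots> \<le> (\<integral>z. B * kernel1 t z \<partial>lborel)"
    using b kernel1_integral(1)[OF t] integrable_abs[OF heat1_integrable[OF t f b]]
    by (intro integral_mono) (auto simp: abs_mult mult.commute[of B] intro!: mult_left_mono)
  also have "\<dots> = B" using kernel1_integral[OF t] by simp
  finally show ?thesis .
qed (use b in simp)

lemma heat1_diff:
  assumes "t \<ge> 0" "f \<in> borel_measurable borel" "g \<in> borel_measurable borel" 
    and "\<And>x. \<bar>f x\<bar> \<le> B" "\<And>x. \<bar>g x\<bar> \<le> C"
  shows "heat1 t (\<lambda>x. f x - c * g x) x = heat1 t f x - c * heat1 t g x"
proof (cases "t = 0")
  case False
  with assms have t: "t > 0" by simp
  have "(\<integral>z. kernel1 t z * (f (x - z) - c * g (x - z)) \<partial>lborel)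
      = (\<integral>z. kernel1 t z * f (x - z) - c * (kernel1 t z * g (x - z)) \<partial>lborel)"
    by (intro Bochner_Integration.integral_cong) (auto simp: algebra_simps)
  also have "\<dots> = (\<integral>z. kernel1 t z * f (x - z) \<partial>lborel) - c * (\<integral>z. kernel1 t z * g (x - z) \<partial>lborel)"
    using heat1_integrable[OF t assms(2,4)] heat1_integrable[OF t assms(3,5)] by simp
  finally show ?thesis by (simp add: heat1_pos[OF t])
qed simp

text \<open>Variances of independent normal variables add:
  \<open>2 * s + 2 * t = 2 * (s + t)\<close>.\<close>

lemma kernel1_convolution:
  assumes s: "s > 0" and t: "t > 0"
  shows "(\<integral>y. kernel1 s (x - y) * kernel1 t y \<partial>lborel) = kernel1 (s + t) x"
    "integrable lborel (\<lambda>y. kernel1 s (x - y) * kernel1 t y)"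
proof -
  have *: "(\<integral>\<^sup>+y. ennreal (kernel1 s (x - y) * kernel1 t y) \<partial>lborel) = ennreal (kernel1 (s + t) x)"
    using fun_cong[OF conv_normal_density_zero_mean[of "sqrt (2 * s)" "sqrt (2 * t)"], of x] s t
    by (simp add: kernel1_def distrib_left)
  then show int: "integrable lborel (\<lambda>y. kernel1 s (x - y) * kernel1 t y)"
    by (intro integrableI_nonneg) auto
  show "(\<integral>y. kernel1 s (x - y) * kernel1 t y \<partial>lborel) = kernel1 (s + t) x"
    using nn_integral_eq_integral[OF int] * by simp
qed

text \<open>This reduces the time derivative at an arbitrary time to an expansion at time 0.\<close>

lemma heat1_semigroup:
  assumes s: "s \<ge> 0" and t: "t \<ge> 0" and [measurable]: "f \<in> borel_measurable borel" and b: "\<And>x. \<bar>f x\<bar> \<le> B"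
  shows "heat1 t (heat1 s f) x = heat1 (s + t) f x"
proof (cases "s = 0 \<or> t = 0")
  case False
  with s t have s: "s > 0" and t: "t > 0" and st: "s + t > 0" by auto
  have B: "B \<ge> 0" using b[of 0] by linarith
  let ?h = "\<lambda>z y. kernel1 s (z - y) * kernel1 t y * f (x - z)"
  have int: "integrable (lborel \<Otimes>\<^sub>M lborel) (\<lambda>(z, y). ?h z y)"
  proof (rule lborel_pair.Fubini_integrable)
    have "(\<integral>y. norm (case (z, y) of (z, y) \<Rightarrow> ?h z y) \<partial>lborel) = \<bar>kernel1 (s + t) z * f (x - z)\<bar>" for z
      using kernel1_convolution[OF s t, of z] by (simp add: abs_mult)
    then show "integrable lborel (\<lambda>z. \<integral>y. norm (case (z, y) of (z, y) \<Rightarrow> ?h z y) \<partial>lborel)"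
      using heat1_integrable[OF st assms(3) b] by simp
    show "AE z in lborel. integrable lborel (\<lambda>y. case (z, y) of (z, y) \<Rightarrow> ?h z y)"
      using kernel1_convolution(2)[OF s t] by (intro AE_I2) simp
  qed measurable
  have shift: "(\<integral>z. kernel1 s (z - y) * f (x - z) \<partial>lborel) = heat1 s f (x - y)" for y
    using lborel_integral_real_affine[of 1 "\<lambda>z. kernel1 s (z - y) * f (x - z)" y] s
    by (simp add: heat1_pos algebra_simps)
  have "heat1 (s + t) f x = (\<integral>z. \<integral>y. ?h z y \<partial>lborel \<partial>lborel)"
    using kernel1_convolution(1)[OF s t] by (simp add: heat1_pos[OF st])
  also have "\<dots> = (\<integral>y. \<integral>z. ?h z y \<partial>lborel \<partial>lborel)"
    by (rule lborel_pair.Fubini_integral[OF int, symmetric])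
  also have "\<dots> = (\<integral>y. kernel1 t y * (\<integral>z. kernel1 s (z - y) * f (x - z) \<partial>lborel) \<partial>lborel)"
    by (subst integral_mult_right_zero[symmetric]) (simp add: mult_ac)
  also have "\<dots> = heat1 t (heat1 s f) x"
    by (simp add: shift heat1_pos[OF t])
  finally show ?thesis ..
qed auto

text \<open>The weight at \<open>x - z\<close> is at most \<open>2 * (1 + z^2)\<close> times the
  weight at \<open>x\<close>, and the Gaussian average of \<open>1 + z^2\<close> is
  \<open>1 + 2 * t\<close>.\<close>

lemma heat1_weighted_bound:
  assumes t: "t \<ge> 0" and f: "f \<in> borel_measurable borel" and M: "M \<ge> 0" and b: "\<And>x. \<bar>f x\<bar> \<le> M / (1 + x\<^sup>2)"
  shows "\<bar>heat1 t f x\<bar> \<le> 2 * M * (1 + 2 * t) / (1 + x\<^sup>2)"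
proof (cases "t = 0")
  case True
  then show ?thesis using b[of x] M divide_right_mono[of M "2 * M" "1 + x\<^sup>2"] by auto
next
  case False
  with t have t: "t > 0" by simp
  have pos: "1 + y\<^sup>2 > 0" for y :: real by (simp add: add_pos_nonneg)
  have bM: "\<bar>f y\<bar> \<le> M" for y
  proof -
    have "M / (1 + y\<^sup>2) \<le> M" using M pos[of y] by (simp add: pos_divide_le_eq distrib_left)
    then show ?thesis using b[of y] by linarith
  qed
  have pw: "\<bar>f (x - z)\<bar> \<le> 2 * M / (1 + x\<^sup>2) * (1 + z\<^sup>2)" for z
  proof -
    \<comment> \<open>Peetre's inequality\<close>
    have "1 + x\<^sup>2 \<le> 2 * (1 + z\<^sup>2) * (1 + (x - z)\<^sup>2)"
    proof -
      \<comment> \<open>This square equals \<open>2 * z^2 + 2 * (x - z)^2 - x^2\<close>.\<close>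
      have "0 \<le> (x - 2 * z)\<^sup>2" by simp
      then have "x\<^sup>2 \<le> 2 * z\<^sup>2 + 2 * (x - z)\<^sup>2"
        by (simp add: power2_eq_square algebra_simps)
      moreover have "0 \<le> z\<^sup>2 * (x - z)\<^sup>2" by simp
      moreover have "2 * (1 + z\<^sup>2) * (1 + (x - z)\<^sup>2) = 2 + 2 * z\<^sup>2 + 2 * (x - z)\<^sup>2 + 2 * (z\<^sup>2 * (x - z)\<^sup>2)"
        by (simp add: distrib_left distrib_right)
      ultimately show ?thesis by linarith
    qed
    moreover have "M / c \<le> 2 * M / a * q" if "a \<le> 2 * q * c" "a > 0" "c > 0" for a c q
      using mult_left_mono[OF that(1) M] that by (simp add: field_simps)
    ultimately have "M / (1 + (x - z)\<^sup>2) \<le> 2 * M / (1 + x\<^sup>2) * (1 + z\<^sup>2)"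
      using pos by blast
    then show ?thesis using b[of "x - z"] by linarith
  qed
  have h: "has_bochner_integral lborel (\<lambda>z. 2 * M / (1 + x\<^sup>2) * (kernel1 t z + kernel1 t z * z\<^sup>2)) (2 * M /
      (1 + x\<^sup>2) * (1 + 2 * t))"
    by (intro has_bochner_integral_mult_right has_bochner_integral_add kernel1_moments t)
  have "\<bar>heat1 t f x\<bar> \<le> (\<integral>z. \<bar>kernel1 t z * f (x - z)\<bar> \<partial>lborel)"
    unfolding heat1_pos[OF t] by (rule integral_abs_bound)
  also have "\<dots> \<le> (\<integral>z. 2 * M / (1 + x\<^sup>2) * (kernel1 t z + kernel1 t z * z\<^sup>2) \<partial>lborel)"
  proof (rule integral_mono)
    show "integrable lborel (\<lambda>z. \<bar>kernel1 t z * f (x - z)\<bar>)"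
      by (intro integrable_abs heat1_integrable[OF t f bM])
    show "integrable lborel (\<lambda>z. 2 * M / (1 + x\<^sup>2) * (kernel1 t z + kernel1 t z * z\<^sup>2))"
      using h by (rule integrable.intros)
    show "\<bar>kernel1 t z * f (x - z)\<bar> \<le> 2 * M / (1 + x\<^sup>2) * (kernel1 t z + kernel1 t z * z\<^sup>2)" for z
      using mult_left_mono[OF pw[of z] kernel1_nonneg[of t z]] by (simp add: abs_mult algebra_simps)
  qed
  also have "\<dots> = 2 * M / (1 + x\<^sup>2) * (1 + 2 * t)"
    using h by (rule has_bochner_integral_integral_eq)
  finally show ?thesis by simp
qed

section \<open>Taylor expansion of the heat flow in one variable\<close>

lemma taylor_test1:
  assumes f: "test1 f" and b: "\<And>x. \<bar>(deriv ^^ k) f x\<bar> \<le> M"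
  shows "\<bar>f (x - z) - (\<Sum>m<k. (deriv ^^ m) f x / fact m * (- z) ^ m)\<bar> \<le> M / fact k * \<bar>z\<bar> ^ k"
proof -
  have "\<exists>t. \<bar>t\<bar> \<le> \<bar>- z\<bar> \<and> f (x + - z) = (\<Sum>m<k. (deriv ^^ m) f (x + 0) / fact m * (- z) ^ m)
      + (deriv ^^ k) f (x + t) / fact k * (- z) ^ k"
  \<comment> \<open>Maclaurin's formula for \<open>s \<mapsto> f (x + s)\<close>, evaluated at
    \<open>- z\<close>.\<close>
  proof (rule Maclaurin_all_le[where diff = "\<lambda>m s. (deriv ^^ m) f (x + s)"])
    show "\<forall>m s. ((\<lambda>s. (deriv ^^ m) f (x + s)) has_real_derivative (deriv ^^ Suc m) f (x + s)) (at s)"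
      unfolding add.commute[of x] by (intro allI DERIV_shift[THEN iffD1] test1_DERIV f)
  qed simp
  then obtain t where "f (x + - z) = (\<Sum>m<k. (deriv ^^ m) f (x + 0) / fact m * (- z) ^ m)
      + (deriv ^^ k) f (x + t) / fact k * (- z) ^ k" by blast
  then have "f (x - z) - (\<Sum>m<k. (deriv ^^ m) f x / fact m * (- z) ^ m)
      = (deriv ^^ k) f (x + t) / fact k * (- z) ^ k" by simp
  then have "\<bar>f (x - z) - (\<Sum>m<k. (deriv ^^ m) f x / fact m * (- z) ^ m)\<bar>
      = \<bar>(deriv ^^ k) f (x + t)\<bar> / fact k * \<bar>z\<bar> ^ k"
    by (simp add: abs_mult power_abs)
  also have "\<dots> \<le> M / fact k * \<bar>z\<bar> ^ k"
    using b by (intro mult_right_mono divide_right_mono) auto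
  finally show ?thesis .
qed

text \<open>The Taylor polynomial is integrated exactly, giving \<open>p\<close>, and the remainder
  costs \<open>M / fact k\<close> times the absolute moment of order \<open>k\<close>. The cases
  \<open>k = 2\<close> and \<open>k = 4\<close> follow.\<close>

lemma heat1_expansion:
  assumes f: "test1 f" and h: "h > 0" and k: "has_bochner_integral lborel (\<lambda>z. kernel1 h z * \<bar>z\<bar> ^ k) c"
    and b: "\<And>x. \<bar>(deriv ^^ k) f x\<bar> \<le> M"
    and P: "has_bochner_integral lborel (\<lambda>z. kernel1 h z * (\<Sum>m<k. (deriv ^^ m) f x / fact m * (- z) ^ m)) p"
  shows "\<bar>heat1 h f x - p\<bar> \<le> M / fact k * c"
proof -
  define Q where "Q = (\<lambda>z. \<Sum>m<k. (deriv ^^ m) f x / fact m * (- z) ^ m)"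
  have Q: "integrable lborel (\<lambda>z. kernel1 h z * Q z)" "(\<integral>z. kernel1 h z * Q z \<partial>lborel) = p"
    using P by (simp_all add: Q_def has_bochner_integral_iff)
  obtain B where "\<And>x. \<bar>f x\<bar> \<le> B" using test1_bound[OF f] by blast
  then have i: "integrable lborel (\<lambda>z. kernel1 h z * f (x - z))"
    by (intro heat1_integrable[OF h test1_measurable[OF f]])
  have "heat1 h f x - p = (\<integral>z. kernel1 h z * f (x - z) - kernel1 h z * Q z \<partial>lborel)"
    using i Q by (simp add: heat1_pos[OF h])
  also have "\<bar>\<dots>\<bar> \<le> (\<integral>z. \<bar>kernel1 h z * f (x - z) - kernel1 h z * Q z\<bar> \<partial>lborel)"
    by (rule integral_abs_bound)
  also have "\<dots> \<le> (\<integral>z. M / fact k * (kernel1 h z * \<bar>z\<bar> ^ k) \<partial>lborel)"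
  proof (rule integral_mono)
    show "integrable lborel (\<lambda>z. \<bar>kernel1 h z * f (x - z) - kernel1 h z * Q z\<bar>)"
      by (intro integrable_abs Bochner_Integration.integrable_diff i Q)
    show "integrable lborel (\<lambda>z. M / fact k * (kernel1 h z * \<bar>z\<bar> ^ k))"
      using k by (intro integrable_mult_right) (auto simp: has_bochner_integral_iff)
    show "\<bar>kernel1 h z * f (x - z) - kernel1 h z * Q z\<bar> \<le> M / fact k * (kernel1 h z * \<bar>z\<bar> ^ k)" for z
    proof -
      have "\<bar>kernel1 h z * f (x - z) - kernel1 h z * Q z\<bar> = kernel1 h z * \<bar>f (x - z) - Q z\<bar>"
        by (simp only: right_diff_distrib[symmetric] abs_mult abs_of_nonneg[OF kernel1_nonneg])
      also have "\<dots> \<le> kernel1 h z * (M / fact k * \<bar>z\<bar> ^ k)"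
        unfolding Q_def by (intro mult_left_mono taylor_test1 f b kernel1_nonneg)
      finally show ?thesis by (simp only: mult.left_commute)
    qed
  qed
  also have "\<dots> = M / fact k * c"
    using k by (simp add: has_bochner_integral_iff)
  finally show ?thesis .
qed

lemma heat1_lipschitz_0:
  assumes f: "test1 f" and h: "h > 0" and b: "\<And>x. \<bar>(deriv ^^ 2) f x\<bar> \<le> M"
  shows "\<bar>heat1 h f x - f x\<bar> \<le> M * h"
proof -
  have k: "has_bochner_integral lborel (\<lambda>z. kernel1 h z * \<bar>z\<bar> ^ 2) (2 * h)"
    using kernel1_moments(3)[OF h] by simp
  have "has_bochner_integral lborel (\<lambda>z. f x * kernel1 h z + (- deriv f x) * (kernel1 h z * z))
      (f x * 1 + (- deriv f x) * 0)"
    by (intro has_bochner_integral_add has_bochner_integral_mult_right kernel1_moments h)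
  then have "has_bochner_integral lborel (\<lambda>z. kernel1 h z * (\<Sum>m<2. (deriv ^^ m) f x / fact m * (- z) ^ m))
      (f x)"
    by (simp add: eval_nat_numeral algebra_simps)
  \<comment> \<open>The constant is \<open>M / 2\<close> times the second moment
    \<open>2 * h\<close>.\<close>
  from heat1_expansion[OF f h k b this] show ?thesis by (simp add: fact_numeral)
qed

lemma heat1_expansion_0:
  assumes f: "test1 f" and h: "h > 0" and b: "\<And>x. \<bar>(deriv ^^ 4) f x\<bar> \<le> M"
  shows "\<bar>heat1 h f x - f x - h * (deriv ^^ 2) f x\<bar> \<le> M * h\<^sup>2"
proof -
  have M: "M \<ge> 0" using b[of 0] by linarith
  have k: "has_bochner_integral lborel (\<lambda>z. kernel1 h z * \<bar>z\<bar> ^ 4) (12 * h\<^sup>2)"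
    using kernel1_moments(5)[OF h] by (simp add: power_even_abs)
  have "has_bochner_integral lborel (\<lambda>z. f x * kernel1 h z + (- deriv f x) * (kernel1 h z * z)
      + ((deriv ^^ 2) f x / 2) * (kernel1 h z * z ^ 2) + (- (deriv ^^ 3) f x / 6) * (kernel1 h z * z ^ 3))
      (f x * 1 + (- deriv f x) * 0 + ((deriv ^^ 2) f x / 2) * (2 * h) + (- (deriv ^^ 3) f x / 6) * 0)"
    by (intro has_bochner_integral_add has_bochner_integral_mult_right kernel1_moments h)
  then have "has_bochner_integral lborel (\<lambda>z. kernel1 h z * (\<Sum>m<4. (deriv ^^ m) f x / fact m * (- z) ^ m))
      (f x + h * (deriv ^^ 2) f x)"
    by (simp add: eval_nat_numeral algebra_simps)
  \<comment> \<open>The constant is \<open>M / 24\<close> times the fourth moment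
    \<open>12 * h^2\<close>.\<close>
  from heat1_expansion[OF f h k b this] have "\<bar>heat1 h f x - f x - h * (deriv ^^ 2) f x\<bar> \<le> M / 2 * h\<^sup>2"
    by (simp add: fact_numeral algebra_simps)
  also have "\<dots> \<le> M * h\<^sup>2" using M by (intro mult_right_mono) auto
  finally show ?thesis .
qed

text \<open>The expansions at time 0 hold uniformly in space, so applying \<open>heat1 s\<close>, a
  contraction of the supremum norm, transports them to any starting time \<open>s\<close>. Four
  bounded derivatives of \<open>f\<close> give a quadratic error for \<open>f\<close> and a
  Lipschitz bound for its second derivative.\<close>

lemma heat1_has_derivative:
  assumes f: "test1 f" and t: "t \<ge> 0"
  shows "((\<lambda>s. heat1 s f x) has_real_derivative heat1 t ((deriv ^^ 2) f) x) (at t within {0..})"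
proof -
  let ?g = "(deriv ^^ 2) f"
  have g: "test1 ?g" by (rule test1_derivs[OF f])
  obtain B where B: "\<And>x. \<bar>f x\<bar> \<le> B" using test1_bound[OF f] by blast
  obtain C where C: "\<And>x. \<bar>?g x\<bar> \<le> C" using test1_bound[OF g] by blast
  obtain M where M: "\<And>x. \<bar>(deriv ^^ 4) f x\<bar> \<le> M" using test1_bound[OF test1_derivs[OF f]] by blast
  have gM: "\<And>x. \<bar>(deriv ^^ 2) ?g x\<bar> \<le> M" using M by (simp add: eval_nat_numeral)
  have M0: "M \<ge> 0" using M[of 0] by linarith
  note [measurable] = test1_measurable[OF f] test1_measurable[OF g]
  have fw: "\<bar>heat1 (s + h) f x - heat1 s f x - h * heat1 s ?g x\<bar> \<le> M * h\<^sup>2" 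
    and gw: "\<bar>heat1 (s + h) ?g x - heat1 s ?g x\<bar> \<le> M * h" if s: "s \<ge> 0" and h: "h > 0" for s h
  proof -
    have Bh: "\<bar>heat1 h f x\<bar> \<le> B" "\<bar>heat1 h ?g x\<bar> \<le> C" for x
      using h B C by (auto intro!: heat1_bound)
    have Bh': "\<bar>heat1 h f x - f x\<bar> \<le> 2 * B" for x
      using Bh(1)[of x] B[of x] by linarith
    have "heat1 (s + h) f x = heat1 s (heat1 h f) x"
      using heat1_semigroup[of h s f B x] s h B by (simp add: add.commute)
    then have "heat1 (s + h) f x - heat1 s f x - h * heat1 s ?g x
        = heat1 s (\<lambda>x. (heat1 h f x - f x) - h * ?g x) x"
      using heat1_diff[of s "\<lambda>x. heat1 h f x - f x" ?g "2 * B" C h x] heat1_diff[of s "heat1 h f" f B B 1 x]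
          s Bh Bh' B C
      by simp
    also have "\<bar>\<dots>\<bar> \<le> M * h\<^sup>2"
      using heat1_expansion_0[OF f h M] s by (intro heat1_bound) auto
    finally show "\<bar>heat1 (s + h) f x - heat1 s f x - h * heat1 s ?g x\<bar> \<le> M * h\<^sup>2" .
    have "heat1 (s + h) ?g x = heat1 s (heat1 h ?g) x"
      using heat1_semigroup[of h s ?g C x] s h C by (simp add: add.commute)
    then have "heat1 (s + h) ?g x - heat1 s ?g x = heat1 s (\<lambda>x. heat1 h ?g x - ?g x) x"
      using heat1_diff[of s "heat1 h ?g" ?g C C 1 x] s Bh C by simp
    also have "\<bar>\<dots>\<bar> \<le> M * h"
      using heat1_lipschitz_0[OF g h gM] s by (intro heat1_bound) auto
    finally show "\<bar>heat1 (s + h) ?g x - heat1 s ?g x\<bar> \<le> M * h" .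
  qed
  have bd: "\<bar>heat1 s f x - heat1 t f x - (s - t) * heat1 t ?g x\<bar> \<le> 2 * M * \<bar>s - t\<bar>\<^sup>2" if s: "s \<ge> 0"
      "s \<noteq> t" for s
  proof (cases "s > t")
    case True
    have "\<bar>heat1 s f x - heat1 t f x - (s - t) * heat1 t ?g x\<bar> \<le> M * (s - t)\<^sup>2"
      using fw[OF t, of "s - t"] True by simp
    also have "\<dots> \<le> 2 * M * \<bar>s - t\<bar>\<^sup>2" using M0 by simp
    finally show ?thesis .
  next
    case False
    then have h: "t - s > 0" using s by simp
    have 1: "\<bar>heat1 t f x - heat1 s f x - (t - s) * heat1 s ?g x\<bar> \<le> M * (t - s)\<^sup>2"
      using fw[OF s(1) h] by simp
    have "\<bar>(t - s) * (heat1 t ?g x - heat1 s ?g x)\<bar> \<le> (t - s) * (M * (t - s))"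
      unfolding abs_mult using gw[OF s(1) h] h by (intro mult_mono) auto
    also have "\<dots> = M * (t - s)\<^sup>2" by (simp add: power2_eq_square)
    finally have 2: "\<bar>(t - s) * (heat1 t ?g x - heat1 s ?g x)\<bar> \<le> M * (t - s)\<^sup>2" .
    \<comment> \<open>The expansion starts at the earlier time \<open>s\<close>, so its linear term
      belongs to \<open>s\<close>; replacing it by the one at \<open>t\<close> costs a second error
      of the same size, hence the factor 2.\<close>
    have "heat1 s f x - heat1 t f x - (s - t) * heat1 t ?g x
        = (t - s) * (heat1 t ?g x - heat1 s ?g x) - (heat1 t f x - heat1 s f x - (t - s) * heat1 s ?g x)"
      by (simp add: algebra_simps)
    then have "\<bar>heat1 s f x - heat1 t f x - (s - t) * heat1 t ?g x\<bar> \<le> M * (t - s)\<^sup>2 + M * (t - s)\<^sup>2"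
      using 1 2 by linarith
    then show ?thesis by (simp add: power2_commute)
  qed
  have "((\<lambda>s. (heat1 s f x - heat1 t f x) / (s - t) - heat1 t ?g x) \<longlongrightarrow> 0) (at t within {0..})"
  proof (rule Lim_null_comparison)
    show "((\<lambda>s. 2 * M * \<bar>s - t\<bar>) \<longlongrightarrow> 0) (at t within {0..})"
      by (auto intro!: tendsto_eq_intros)
    have "norm ((heat1 s f x - heat1 t f x) / (s - t) - heat1 t ?g x) \<le> 2 * M * \<bar>s - t\<bar>"
      if s: "s \<ge> 0" "s \<noteq> t" for s
    proof -
      have "(heat1 s f x - heat1 t f x) / (s - t) - heat1 t ?g x
          = (heat1 s f x - heat1 t f x - (s - t) * heat1 t ?g x) / (s - t)"
        using s by (simp add: field_simps)
      then show ?thesis using bd[OF s] s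
        by (simp add: abs_divide pos_divide_le_eq power2_eq_square)
    qed
    then show "\<forall>\<^sub>F s in at t within {0..}. norm ((heat1 s f x - heat1 t f x) / (s - t) - heat1 t ?g x)
        \<le> 2 * M * \<bar>s - t\<bar>"
      by (simp add: eventually_at_filter)
  qed
  then show ?thesis
    unfolding has_field_derivative_iff by (rule LIM_zero_cancel)
qed

section \<open>Tensor products of functions of one variable\<close>

lemma heat_cong:
  assumes "\<And>x. x \<in> space (Rn n) \<Longrightarrow> f x = g x" "t \<ge> 0" "x \<in> space (Rn n)"
  shows "heat n t f x = heat n t g x"
  using assms by (cases "t = 0") (auto simp: heat_pos intro!: Bochner_Integration.integral_cong)

lemma norm_L2_cong: "(\<And>x. x \<in> space (Rn n) \<Longrightarrow> f x = g x) \<Longrightarrow> norm_L2 n f = norm_L2 n g"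
  unfolding norm_L2_def by (auto intro!: arg_cong[of _ _ sqrt] Bochner_Integration.integral_cong)

lemma tensor_test1:
  assumes "\<forall>i<n. test1 (F i)"
  shows "tensor n F \<in> test_functions n"
proof -
  have "\<exists>a b. \<forall>x. x \<notin> {a..b} \<longrightarrow> F i x = 0" if "i < n" for i
    using assms[rule_format, OF that] by (auto simp: test1_def)
  then obtain a b where "\<And>i x. i < n \<Longrightarrow> x \<notin> {a i..b i} \<Longrightarrow> F i x = 0" by metis
  then show ?thesis using assms by (intro tensor_test_function) (auto simp: test1_def)
qed

text \<open>Kernel and function both factorise over the coordinates; this is the reduction to one
  variable.\<close>

lemma heat_tensor:
  assumes F: "\<forall>i<n. test1 (F i)" and t: "t \<ge> 0" and x: "x \<in> space (Rn n)"
  shows "heat n t (tensor n F) x = (\<Prod>i<n. heat1 t (F i) (x i))"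
proof (cases "t = 0")
  case False
  with t have t: "t > 0" by simp
  have int: "integrable lborel (\<lambda>z. kernel1 t z * F i (x i - z))" if i: "i < n" for i
  proof -
    obtain B where "\<And>x. \<bar>F i x\<bar> \<le> B" using test1_bound[OF F[rule_format, OF i]] by blast
    then show ?thesis by (rule heat1_integrable[OF t test1_measurable[OF F[rule_format, OF i]]])
  qed
  have "heat n t (tensor n F) x = (\<integral>y. heat_kernel n t y * tensor n F (diff_Rn n x y) \<partial>Rn n)"
    by (intro heat_pos' t x test_functions_L2 tensor_test1 F)
  also have "\<dots> = (\<integral>y. (\<Prod>i<n. kernel1 t (y i) * F i (x i - y i)) \<partial>Rn n)"
    by (simp add: heat_kernel_eq_prod[OF t] tensor_def diff_Rn_def prod.distrib)
  also have "\<dots> = (\<Prod>i<n. heat1 t (F i) (x i))"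
    using int by (subst product_Rn(2)) (auto simp: heat1_pos[OF t])
  finally show ?thesis .
qed (simp add: tensor_def)

lemma test_laplacian_tensor:
  assumes F: "\<forall>i<n. test1 (F i)"
  shows "test_laplacian n (tensor n F) = (\<lambda>x. \<Sum>i<n. tensor n (F(i := (deriv ^^ 2) (F i))) x)"
proof -
  have "partials [i, i] (tensor n F) = tensor n (F(i := (deriv ^^ 2) (F i)))" if i: "i < n" for i
  proof -
    have "partials [i, i] (tensor n F) = tensor n (\<lambda>j. (deriv ^^ count_list [i, i] j) (F j))"
      using F i by (intro partials_tensor) (auto simp: test1_def)
    also have "(\<lambda>j. (deriv ^^ count_list [i, i] j) (F j)) = F(i := (deriv ^^ 2) (F i))"
      by (auto simp: numeral_2_eq_2)
    finally show ?thesis .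
  qed
  then show ?thesis by (simp add: test_laplacian_def[abs_def] del: partials.simps)
qed

lemma test1_upd:
  assumes "\<forall>i<n. test1 (F i)" "i < n"
  shows "\<forall>j<n. test1 ((F(i := (deriv ^^ 2) (F i))) j)"
  using assms test1_derivs[of "F i" 2] by auto

lemma heat_tensor_has_derivative:
  assumes F: "\<forall>i<n. test1 (F i)" and t: "t \<ge> 0" and x: "x \<in> space (Rn n)"
  shows "((\<lambda>s. heat n s (tensor n F) x) has_real_derivative heat n t (test_laplacian n (tensor n F)) x)
    (at t within {0..})"
proof -
  let ?D = "\<lambda>i. heat1 t ((deriv ^^ 2) (F i)) (x i)"
  have "((\<lambda>s. \<Prod>i<n. heat1 s (F i) (x i)) has_derivative
      (\<lambda>y. \<Sum>i<n. (?D i * y) * (\<Prod>j\<in>{..<n} - {i}. heat1 t (F j) (x j)))) (at t within {0..})"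
    using heat1_has_derivative[OF F[rule_format] t] 
    by (intro has_derivative_prod) (simp add: has_field_derivative_def mult_commute_abs)
  then have "((\<lambda>s. \<Prod>i<n. heat1 s (F i) (x i)) has_real_derivative
      (\<Sum>i<n. ?D i * (\<Prod>j\<in>{..<n} - {i}. heat1 t (F j) (x j)))) (at t within {0..})"
    unfolding has_field_derivative_def
    by (rule has_derivative_eq_rhs) (simp add: fun_eq_iff sum_distrib_left mult_ac)
  also have "(\<Sum>i<n. ?D i * (\<Prod>j\<in>{..<n} - {i}. heat1 t (F j) (x j))) = heat n t (test_laplacian n (tensor n F)) x"
  proof -
    have "heat n t (test_laplacian n (tensor n F)) x = (\<Sum>i<n. heat n t (tensor n (F(i := (deriv ^^ 2) (F
        i)))) x)"
      unfolding test_laplacian_tensor[OF F]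
      using F by (intro heat_sum t x test_functions_L2 tensor_test1 test1_upd) auto
    also have "\<dots> = (\<Sum>i<n. ?D i * (\<Prod>j\<in>{..<n} - {i}. heat1 t (F j) (x j)))"
    proof (intro sum.cong refl)
      fix i assume "i \<in> {..<n}" then have i: "i < n" by simp
      have "heat n t (tensor n (F(i := (deriv ^^ 2) (F i)))) x
          = (\<Prod>j<n. heat1 t ((F(i := (deriv ^^ 2) (F i))) j) (x j))"
        by (rule heat_tensor[OF test1_upd[OF F i] t x])
      also have "\<dots> = ?D i * (\<Prod>j\<in>{..<n} - {i}. heat1 t (F j) (x j))"
        using i by (subst prod.remove[of _ i]) (auto intro!: prod.cong)
      finally show "heat n t (tensor n (F(i := (deriv ^^ 2) (F i)))) x
          = ?D i * (\<Prod>j\<in>{..<n} - {i}. heat1 t (F j) (x j))" .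
    qed
    finally show ?thesis by simp
  qed
  finally show ?thesis
    by (rule has_field_derivative_transform_within[where d = 1]) (use t heat_tensor[OF F _ x] in auto)
qed

text \<open>A square integrable majorant for the orbits of tensor products over bounded time
  intervals, on which no common compact support is left.\<close>

definition weight :: "nat \<Rightarrow> (nat \<Rightarrow> real) \<Rightarrow> real" where
  "weight n x = (\<Prod>i<n. 1 / (1 + (x i)\<^sup>2))"

lemma weight_L2: "weight n \<in> L2 n"
proof (rule L2I)
  have w: "integrable lborel (\<lambda>x::real. (1 / (1 + x\<^sup>2))\<^sup>2)"
  proof (rule Bochner_Integration.integrable_bound)
    show "integrable lborel (\<lambda>x::real. inverse (1 + x\<^sup>2))"
      using integrable_inverse_1_plus_square by (simp add: set_integrable_def)
    have "(1 / (1 + x\<^sup>2))\<^sup>2 \<le> inverse (1 + x\<^sup>2)" for x :: real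
    proof -
      have "1 / (1 + x\<^sup>2) \<le> 1" by (simp add: pos_divide_le_eq add_pos_nonneg)
      then have "1 / (1 + x\<^sup>2) * (1 / (1 + x\<^sup>2)) \<le> 1 * (1 / (1 + x\<^sup>2))"
        by (intro mult_right_mono) auto
      then show ?thesis by (simp add: power2_eq_square inverse_eq_divide)
    qed
    then show "AE x in lborel. norm ((1 / (1 + x\<^sup>2))\<^sup>2) \<le> norm (inverse (1 + (x::real)\<^sup>2))"
      by (intro AE_I2) simp
  qed measurable
  have "integrable (Rn n) (\<lambda>x. \<Prod>i<n. (1 / (1 + (x i)\<^sup>2))\<^sup>2)"
    by (rule product_Rn(1)[of n "\<lambda>_ x. (1 / (1 + x\<^sup>2))\<^sup>2", OF w])
  then show "integrable (Rn n) (\<lambda>x. (weight n x)\<^sup>2)"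
    by (simp add: weight_def prod_power_distrib)
  show "weight n \<in> borel_measurable (Rn n)"
    unfolding weight_def[abs_def]
    by (intro borel_measurable_prod borel_measurable_divide borel_measurable_add borel_measurable_power
      borel_measurable_const measurable_Rn_component) auto
qed

lemma heat_tensor_bound:
  assumes F: "\<forall>i<n. test1 (F i)"
  obtains C where "C \<ge> 0" "\<And>t x. 0 \<le> t \<Longrightarrow> t \<le> T \<Longrightarrow> x \<in> space (Rn n) \<Longrightarrow> \<bar>heat n t (tensor n F) x\<bar> \<le> C * weight n x"
proof -
  have "\<exists>M\<ge>0. \<forall>x. \<bar>F i x\<bar> \<le> M / (1 + x\<^sup>2)" if "i < n" for i
    using test1_weighted_bound[OF F[rule_format, OF that]] by blast
  then obtain M where M: "\<And>i. i < n \<Longrightarrow> M i \<ge> 0" "\<And>i x. i < n \<Longrightarrow> \<bar>F i x\<bar> \<le> M i / (1 + x\<^sup>2)" by metis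
  show ?thesis
  proof
    \<comment> \<open>The absolute value keeps the constant nonnegative also when
      \<open>T < 0\<close> and there is no time to consider.\<close>
    show "0 \<le> (\<Prod>i<n. 2 * M i * (1 + 2 * \<bar>T\<bar>))" using M(1) by (intro prod_nonneg) auto
    fix t x assume t: "0 \<le> t" "t \<le> T" and x: "x \<in> space (Rn n)"
    have "\<bar>heat n t (tensor n F) x\<bar> = (\<Prod>i<n. \<bar>heat1 t (F i) (x i)\<bar>)"
      by (simp add: heat_tensor[OF F t(1) x] abs_prod)
    also have "\<dots> \<le> (\<Prod>i<n. 2 * M i * (1 + 2 * \<bar>T\<bar>) * (1 / (1 + (x i)\<^sup>2)))"
    proof (intro prod_mono conjI)
      fix i assume "i \<in> {..<n}" then have i: "i < n" by simp
      have "\<bar>heat1 t (F i) (x i)\<bar> \<le> 2 * M i * (1 + 2 * t) / (1 + (x i)\<^sup>2)"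
        by (intro heat1_weighted_bound t test1_measurable F[rule_format] M i)
      also have "\<dots> \<le> 2 * M i * (1 + 2 * \<bar>T\<bar>) / (1 + (x i)\<^sup>2)"
        using M(1)[OF i] t by (intro divide_right_mono mult_left_mono) auto
      finally show "\<bar>heat1 t (F i) (x i)\<bar> \<le> 2 * M i * (1 + 2 * \<bar>T\<bar>) * (1 / (1 + (x i)\<^sup>2))" by simp
    qed auto
    also have "\<dots> = (\<Prod>i<n. 2 * M i * (1 + 2 * \<bar>T\<bar>)) * weight n x"
      by (simp add: weight_def prod.distrib prod_dividef)
    finally show "\<bar>heat n t (tensor n F) x\<bar> \<le> (\<Prod>i<n. 2 * M i * (1 + 2 * \<bar>T\<bar>)) * weight n x" .
  qed
qed

lemma heat_test_laplacian_tensor_bound: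
  assumes F: "\<forall>i<n. test1 (F i)"
  obtains C where "C \<ge> 0" "\<And>t x. 0 \<le> t \<Longrightarrow> t \<le> T \<Longrightarrow> x \<in> space (Rn n) \<Longrightarrow>
    \<bar>heat n t (test_laplacian n (tensor n F)) x\<bar> \<le> C * weight n x"
proof -
  let ?G = "\<lambda>i. F(i := (deriv ^^ 2) (F i))"
  have "\<exists>C\<ge>0. \<forall>t x. 0 \<le> t \<longrightarrow> t \<le> T \<longrightarrow> x \<in> space (Rn n) \<longrightarrow> \<bar>heat n t (tensor n (?G i)) x\<bar> \<le> C * weight n x"
    if i: "i < n" for i
  proof -
    obtain C where "C \<ge> 0" "\<And>t x. 0 \<le> t \<Longrightarrow> t \<le> T \<Longrightarrow> x \<in> space (Rn n) \<Longrightarrow> \<bar>heat n t (tensor n (?G i)) x\<bar>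
        \<le> C * weight n x"
      using heat_tensor_bound[OF test1_upd[OF F i], of T] by blast
    then show ?thesis by blast
  qed
  then obtain C where C: "\<And>i. i < n \<Longrightarrow> C i \<ge> 0"
    "\<And>i t x. i < n \<Longrightarrow> 0 \<le> t \<Longrightarrow> t \<le> T \<Longrightarrow> x \<in> space (Rn n) \<Longrightarrow> \<bar>heat n t (tensor n (?G i)) x\<bar> \<le> C i * weight n x"
    by metis
  show ?thesis
  proof
    show "0 \<le> (\<Sum>i<n. C i)" using C(1) by (intro sum_nonneg) auto
    fix t x assume t: "0 \<le> t" "t \<le> T" and x: "x \<in> space (Rn n)"
    have "heat n t (test_laplacian n (tensor n F)) x = (\<Sum>i<n. heat n t (tensor n (?G i)) x)"
      unfolding test_laplacian_tensor[OF F]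
      using F by (intro heat_sum t x test_functions_L2 tensor_test1 test1_upd) auto
    also have "\<bar>\<dots>\<bar> \<le> (\<Sum>i<n. C i * weight n x)"
      using C(2) t x by (intro order_trans[OF sum_abs] sum_mono) auto
    finally show "\<bar>heat n t (test_laplacian n (tensor n F)) x\<bar> \<le> (\<Sum>i<n. C i) * weight n x"
      by (simp add: sum_distrib_right)
  qed
qed

text \<open>The mean value theorem in a form that does not distinguish \<open>s < t\<close> from
  \<open>s > t\<close>: only the distance of \<open>r\<close> from \<open>t\<close> is recorded,
  which is what bounds and continuity at \<open>t\<close> require.\<close>

lemma mean_value_nonneg:
  fixes h h' :: "real \<Rightarrow> real"
  assumes d: "\<And>t. t \<ge> 0 \<Longrightarrow> (h has_real_derivative h' t) (at t within {0..})"
    and st: "s \<ge> 0" "t \<ge> 0" "s \<noteq> t"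
  obtains r where "0 \<le> r" "\<bar>r - t\<bar> \<le> \<bar>s - t\<bar>" "(h s - h t) / (s - t) = h' r"
proof -
  have "\<exists>r\<in>{a<..<b}. h b - h a = h' r * (b - a)" if ab: "0 \<le> a" "a < b" for a b
  proof (rule mvt_simple[OF ab(2)])
    show "(h has_derivative (*) (h' r)) (at r within {a..b})" if "a \<le> r" "r \<le> b" for r
      using d[of r] ab that unfolding has_field_derivative_def
      by (auto intro: has_derivative_subset)
  qed
  from this[of s t] this[of t s] obtain r where "min s t < r" "r < max s t" "(h s - h t) / (s - t) = h' r"
    using st by (cases "s < t") (force simp: field_simps)+
  then show ?thesis using st by (intro that[of r]) auto
qed

text \<open>The class used for all duality arguments: test functions whose orbit is differentiable
  in norm with the expected derivative. Being described by a property, it inherits linearity from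
  the derivative, while membership is established for tensor products.\<close>

definition heat_regular :: "nat \<Rightarrow> ((nat \<Rightarrow> real) \<Rightarrow> real) set" where
  "heat_regular n = {\<phi> \<in> test_functions n. \<forall>t\<ge>0.
    ((\<lambda>s. norm_L2 n (\<lambda>x. (heat n s \<phi> x - heat n t \<phi> x) / (s - t) - heat n t (test_laplacian n \<phi>) x)) \<longlongrightarrow> 0)
      (at t within {0..})}"

text \<open>The derivative is known at each point of space. By the mean value theorem each
  difference quotient is the candidate derivative at an intermediate time, which the weight
  dominates; dominated convergence along sequences of times then gives convergence in norm.\<close>

lemma tensor_heat_regular:
  assumes F: "\<forall>i<n. test1 (F i)"
  shows "tensor n F \<in> heat_regular n"
proof -
  let ?\<phi> = "tensor n F" and ?L = "test_laplacian n (tensor n F)"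
  have \<phi>: "?\<phi> \<in> test_functions n" using F by (rule tensor_test1)
  note \<phi>L = test_functions_L2[OF \<phi>] test_laplacian_L2[OF \<phi>]
  have "((\<lambda>s. norm_L2 n (\<lambda>x. (heat n s ?\<phi> x - heat n t ?\<phi> x) / (s - t) - heat n t ?L x)) \<longlongrightarrow> 0) (at t within
      {0..})"
    if t: "t \<ge> 0" for t
    unfolding tendsto_at_iff_sequentially comp_def
  proof (intro allI impI)
    fix X :: "nat \<Rightarrow> real" assume X: "\<forall>k. X k \<in> {0..} - {t}" and lim: "X \<longlonglongrightarrow> t"
    obtain T where T: "\<And>k. \<bar>X k\<bar> \<le> T"
      using convergent_imp_Bseq[OF convergentI[OF lim]] unfolding Bseq_def by auto
    \<comment> \<open>The intermediate time satisfies
      \<open>r \<le> t + \<bar>X k - t\<bar> \<le> 2 * t + T\<close>, so the bound is needed up to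
      this time.\<close>
    obtain C where C: "C \<ge> 0" "\<And>s x. 0 \<le> s \<Longrightarrow> s \<le> 2 * t + T \<Longrightarrow> x \<in> space (Rn n) \<Longrightarrow> \<bar>heat n s ?L x\<bar>
        \<le> C * weight n x"
      using heat_test_laplacian_tensor_bound[OF F, of "2 * t + T"] by blast
    show "(\<lambda>k. norm_L2 n (\<lambda>x. (heat n (X k) ?\<phi> x - heat n t ?\<phi> x) / (X k - t) - heat n t ?L x)) \<longlonglongrightarrow> 0"
    proof (rule L2_dominated_convergence(3))
      show "(\<lambda>x. (heat n (X k) ?\<phi> x - heat n t ?\<phi> x) / (X k - t)) \<in> borel_measurable (Rn n)" for k
        using X t by (intro L2_measurable L2_intros heat_L2 \<phi>L) auto
      show "heat n t ?L \<in> borel_measurable (Rn n)"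
        by (intro L2_measurable heat_L2 \<phi>L t)
      show "(\<lambda>k. (heat n (X k) ?\<phi> x - heat n t ?\<phi> x) / (X k - t)) \<longlonglongrightarrow> heat n t ?L x" if x: "x \<in> space (Rn n)"
          for x
        using heat_tensor_has_derivative[OF F t x] X lim
        unfolding has_field_derivative_iff tendsto_at_iff_sequentially comp_def by blast
      show "(\<lambda>x. C * weight n x) \<in> L2 n" by (intro L2_cmult weight_L2)
      show "\<bar>(heat n (X k) ?\<phi> x - heat n t ?\<phi> x) / (X k - t)\<bar> \<le> C * weight n x" if x: "x \<in> space (Rn n)" for k x
      proof -
        have Xk: "X k \<ge> 0" "X k \<noteq> t" using X by auto
        from mean_value_nonneg[OF heat_tensor_has_derivative[OF F _ x] Xk(1) t Xk(2)]
        obtain r where r: "0 \<le> r" "\<bar>r - t\<bar> \<le> \<bar>X k - t\<bar>"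
          "(heat n (X k) ?\<phi> x - heat n t ?\<phi> x) / (X k - t) = heat n r ?L x" by blast
        have "r \<le> 2 * t + T" using r(2) T[of k] Xk t by (auto simp: abs_if split: if_splits)
        then show ?thesis using C(2)[OF r(1) _ x] r(3) by simp
      qed
    qed
  qed
  then show ?thesis using \<phi> by (simp add: heat_regular_def)
qed

section \<open>Linear combinations of regular functions\<close>

lemma heat_linear:
  assumes "t \<ge> 0" "f \<in> L2 n" "g \<in> L2 n" "x \<in> space (Rn n)"
  shows "heat n t (\<lambda>x. a * f x + b * g x) x = a * heat n t f x + b * heat n t g x"
  using assms by (simp add: heat_add heat_cmult L2_cmult)

lemma test_laplacian_linear:
  assumes "f \<in> test_functions n" "g \<in> test_functions n" "x \<in> space (Rn n)"
  shows "test_laplacian n (\<lambda>x. a * f x + b * g x) x = a * test_laplacian n f x + b * test_laplacian n g x"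
proof -
  have "partials [i, i] (\<lambda>x. a * f x + b * g x) x = a * partials [i, i] f x + b * partials [i, i] g x" if "i
      < n" for i
    using assms that by (intro partials_linear) (auto simp: test_functions_def)
  then show ?thesis
    by (simp add: test_laplacian_def sum.distrib sum_distrib_left del: partials.simps)
qed

lemma heat_regular_linear:
  assumes f: "f \<in> heat_regular n" and g: "g \<in> heat_regular n"
  shows "(\<lambda>x. a * f x + b * g x) \<in> heat_regular n"
proof -
  have tf: "f \<in> test_functions n" "g \<in> test_functions n" using f g by (auto simp: heat_regular_def)
  note L = test_functions_L2[OF tf(1)] test_functions_L2[OF tf(2)] test_laplacian_L2[OF tf(1)]
      test_laplacian_L2[OF tf(2)]
  let ?h = "\<lambda>x. a * f x + b * g x"
  let ?q = "\<lambda>t s f x. (heat n s f x - heat n t f x) / (s - t) - heat n t (test_laplacian n f) x"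
  have "((\<lambda>s. norm_L2 n (?q t s ?h)) \<longlongrightarrow> 0) (at t within {0..})" if t: "t \<ge> 0" for t
  proof (rule norm_L2_add_tendsto_0)
    have "((\<lambda>s. norm_L2 n (?q t s f)) \<longlongrightarrow> 0) (at t within {0..})"
        "((\<lambda>s. norm_L2 n (?q t s g)) \<longlongrightarrow> 0) (at t within {0..})"
      using f g t by (auto simp: heat_regular_def)
    then show "((\<lambda>s. norm_L2 n (\<lambda>x. a * ?q t s f x)) \<longlongrightarrow> 0) (at t within {0..})"
        "((\<lambda>s. norm_L2 n (\<lambda>x. b * ?q t s g x)) \<longlongrightarrow> 0) (at t within {0..})"
      unfolding norm_L2_cmult by (auto intro: tendsto_mult_right_zero)
    have "\<forall>\<^sub>F s in at t within {0..}. s \<ge> 0 \<and> s \<noteq> t" by (simp add: eventually_at_filter)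
    then show "\<forall>\<^sub>F s in at t within {0..}. (\<lambda>x. a * ?q t s f x) \<in> L2 n \<and> (\<lambda>x. b * ?q t s g x) \<in> L2 n \<and>
      (\<forall>x\<in>space (Rn n). ?q t s ?h x = a * ?q t s f x + b * ?q t s g x)"
    proof eventually_elim
      case (elim s)
      have "heat n t (test_laplacian n ?h) x = a * heat n t (test_laplacian n f) x + b * heat n t
          (test_laplacian n g) x"
        if x: "x \<in> space (Rn n)" for x
      proof -
        have "heat n t (test_laplacian n ?h) x = heat n t (\<lambda>x. a * test_laplacian n f x + b * test_laplacian
            n g x) x"
          by (intro heat_cong test_laplacian_linear tf t x)
        then show ?thesis using heat_linear[OF t L(3,4) x] by simp
      qed
      then show ?case
        using elim t L by (auto intro!: L2_intros heat_L2 simp: heat_linear diff_divide_distrib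
            add_divide_distrib right_diff_distrib distrib_left)
    qed
  qed
  then show ?thesis
    using test_functions_linear[OF tf] by (simp add: heat_regular_def)
qed

section \<open>Density of test functions\<close>

text \<open>Membership in the closure of \<open>heat_regular\<close>. Density is proved by showing
  that this closed linear class contains ever larger families of functions.\<close>

definition approximable :: "nat \<Rightarrow> ((nat \<Rightarrow> real) \<Rightarrow> real) \<Rightarrow> bool" where
  "approximable n f \<longleftrightarrow> f \<in> L2 n \<and> (\<forall>e>0. \<exists>\<phi>\<in>heat_regular n. norm_L2 n (\<lambda>x. f x - \<phi> x) < e)"

lemma heat_regular_L2: "\<phi> \<in> heat_regular n \<Longrightarrow> \<phi> \<in> L2 n"
  by (simp add: heat_regular_def test_functions_L2)

lemma heat_regular_approximable: "\<phi> \<in> heat_regular n \<Longrightarrow> approximable n \<phi>"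
  by (auto simp: approximable_def heat_regular_L2 intro!: bexI[of _ \<phi>])

lemma approximable_L2: "approximable n f \<Longrightarrow> f \<in> L2 n"
  by (simp add: approximable_def)

lemma approximable_limit:
  assumes f: "\<And>k::nat. approximable n (f k)" and f0: "f0 \<in> L2 n"
    and lim: "(\<lambda>k. norm_L2 n (\<lambda>x. f k x - f0 x)) \<longlonglongrightarrow> 0"
  shows "approximable n f0"
  unfolding approximable_def
proof (intro conjI allI impI f0)
  fix e :: real assume e: "e > 0"
  have "\<forall>\<^sub>F k in sequentially. norm_L2 n (\<lambda>x. f k x - f0 x) < e / 2"
    by (rule order_tendstoD(2)[OF lim]) (use e in simp)
  then obtain k where k: "norm_L2 n (\<lambda>x. f k x - f0 x) < e / 2"
    unfolding eventually_sequentially by blast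
  obtain \<phi> where \<phi>: "\<phi> \<in> heat_regular n" "norm_L2 n (\<lambda>x. f k x - \<phi> x) < e / 2"
    using f[of k] e unfolding approximable_def by (meson half_gt_zero)
  have "norm_L2 n (\<lambda>x. f0 x - \<phi> x) \<le> norm_L2 n (\<lambda>x. f0 x - f k x) + norm_L2 n (\<lambda>x. f k x - \<phi> x)"
    by (intro norm_L2_triangle_diff f0 approximable_L2[OF f] heat_regular_L2 \<phi>)
  also have "\<dots> < e" using k \<phi>(2) by (simp add: norm_L2_minus_commute[of n f0])
  finally show "\<exists>\<phi>\<in>heat_regular n. norm_L2 n (\<lambda>x. f0 x - \<phi> x) < e" using \<phi>(1) by blast
qed

lemma approximable_linear:
  assumes f: "approximable n f" and g: "approximable n g"
  shows "approximable n (\<lambda>x. a * f x + b * g x)"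
  unfolding approximable_def
proof (intro conjI allI impI)
  show "(\<lambda>x. a * f x + b * g x) \<in> L2 n"
    using f g by (intro L2_intros approximable_L2)
  fix e :: real assume e: "e > 0"
  \<comment> \<open>The summand 1 makes the denominator positive when \<open>a = b = 0\<close> and
    the final inequality strict.\<close>
  define d where "d = e / (\<bar>a\<bar> + \<bar>b\<bar> + 1)"
  have d: "d > 0" using e by (simp add: d_def add_nonneg_pos)
  obtain \<phi> where \<phi>: "\<phi> \<in> heat_regular n" "norm_L2 n (\<lambda>x. f x - \<phi> x) < d"
    using f d unfolding approximable_def by blast
  obtain \<psi> where \<psi>: "\<psi> \<in> heat_regular n" "norm_L2 n (\<lambda>x. g x - \<psi> x) < d"
    using g d unfolding approximable_def by blast
  have "norm_L2 n (\<lambda>x. (a * f x + b * g x) - (a * \<phi> x + b * \<psi> x))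
      = norm_L2 n (\<lambda>x. a * (f x - \<phi> x) + b * (g x - \<psi> x))"
    by (simp add: algebra_simps)
  also have "\<dots> \<le> norm_L2 n (\<lambda>x. a * (f x - \<phi> x)) + norm_L2 n (\<lambda>x. b * (g x - \<psi> x))"
    using f g \<phi> \<psi> by (intro norm_L2_triangle L2_intros approximable_L2 heat_regular_L2)
  also have "\<dots> \<le> \<bar>a\<bar> * d + \<bar>b\<bar> * d"
    unfolding norm_L2_cmult using \<phi> \<psi> by (intro add_mono mult_left_mono) auto
  also have "\<dots> < (\<bar>a\<bar> + \<bar>b\<bar> + 1) * d" using d by (simp add: distrib_right)
  also have "\<dots> = e" by (simp add: d_def add_nonneg_pos field_simps)
  finally show "\<exists>\<phi>\<in>heat_regular n. norm_L2 n (\<lambda>x. a * f x + b * g x - \<phi> x) < e"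
    by (intro bexI[of _ "\<lambda>x. a * \<phi> x + b * \<psi> x"] heat_regular_linear \<phi> \<psi>)
qed

lemma approximable_cong:
  assumes f: "approximable n f" and g: "g \<in> borel_measurable (Rn n)" and eq: "\<And>x. x \<in> space (Rn n) \<Longrightarrow> f x = g x"
  shows "approximable n g"
proof (rule approximable_limit[of n "\<lambda>_. f"])
  have "integrable (Rn n) (\<lambda>x. (g x)\<^sup>2) \<longleftrightarrow> integrable (Rn n) (\<lambda>x. (f x)\<^sup>2)"
    using eq by (intro Bochner_Integration.integrable_cong) auto
  then show "g \<in> L2 n"
    using approximable_L2[OF f] g by (simp add: L2_def)
  show "(\<lambda>k. norm_L2 n (\<lambda>x. f x - g x)) \<longlonglongrightarrow> 0"
    using eq norm_L2_cong[of n "\<lambda>x. f x - g x" "\<lambda>x. 0"] by simp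
qed (rule f)

lemma approximable_cmult: "approximable n f \<Longrightarrow> approximable n (\<lambda>x. c * f x)"
  using approximable_linear[of n f f c 0] by simp

lemma approximable_zero: "approximable n (\<lambda>x. 0)"
proof -
  have "tensor n (\<lambda>_. bump 0 0 1) \<in> heat_regular n"
    by (intro tensor_heat_regular allI impI test1_bump)
  from approximable_cmult[OF heat_regular_approximable[OF this], of 0] show ?thesis by simp
qed

lemma approximable_sum:
  assumes "finite I" "\<And>i. i \<in> I \<Longrightarrow> approximable n (f i)"
  shows "approximable n (\<lambda>x. \<Sum>i\<in>I. f i x)"
  using assms
proof (induction I rule: finite_induct)
  case (insert i I)
  then show ?case
    using approximable_linear[of n "f i" "\<lambda>x. \<Sum>i\<in>I. f i x" 1 1] by simp
qed (simp add: approximable_zero)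

section \<open>Indicators of boxes and of Borel sets\<close>

lemma indicator_finite_L2:
  assumes "A \<in> sets (Rn n)" "emeasure (Rn n) A < \<infinity>"
  shows "indicator A \<in> L2 n"
proof (rule L2I)
  have "(\<lambda>x. (indicator A x :: real)\<^sup>2) = indicator A"
    by (auto simp: indicator_def)
  then show "integrable (Rn n) (\<lambda>x. (indicator A x :: real)\<^sup>2)"
    using assms by simp
qed (use assms in simp)

lemma emeasure_open_box_finite: "emeasure (Rn n) (Pi\<^sub>E {..<n} (\<lambda>i. {a i<..<b i})) < \<infinity>"
proof -
  have "emeasure (Rn n) (Pi\<^sub>E {..<n} (\<lambda>i. {a i<..<b i})) = (\<Prod>i<n. emeasure lborel {a i<..<b i})"
    by (rule emeasure_Rn_PiE) simp
  also have "\<dots> = (\<Prod>i<n. ennreal (max 0 (b i - a i)))"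
    by (intro prod.cong) (auto simp: max_def emeasure_lborel_Ioo)
  also have "\<dots> < \<infinity>"
    by (subst prod_ennreal) auto
  finally show ?thesis .
qed

text \<open>Tensor products of bumps converge pointwise to the indicator and stay below it, so the
  indicator itself is the dominating function.\<close>

lemma approximable_open_box: "approximable n (indicator (Pi\<^sub>E {..<n} (\<lambda>i. {a i<..<b i})))"
proof -
  let ?B = "Pi\<^sub>E {..<n} (\<lambda>i. {a i<..<b i})"
  let ?T = "\<lambda>m. tensor n (\<lambda>i. bump m (a i) (b i))"
  have B: "?B \<in> sets (Rn n)" by (rule sets_Rn_PiE) simp
  have T: "?T m \<in> heat_regular n" for m
    by (intro tensor_heat_regular allI impI test1_bump)
  have ind: "(indicator ?B x :: real) = (\<Prod>i<n. indicator {a i<..<b i} (x i))" if "x \<in> space (Rn n)" for x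
  proof (cases "x \<in> ?B")
    case True
    then show ?thesis by (auto simp: PiE_iff)
  next
    case False
    then have "\<exists>i<n. x i \<notin> {a i<..<b i}" using that by (auto simp: space_Rn PiE_iff)
    then have "\<exists>i\<in>{..<n}. indicator {a i<..<b i} (x i) = (0 :: real)" by (auto simp: indicator_def)
    then have "(\<Prod>i<n. indicator {a i<..<b i} (x i)) = (0 :: real)" by (subst prod_zero_iff) auto
    then show ?thesis using False by simp
  qed
  have L: "indicator ?B \<in> L2 n" by (intro indicator_finite_L2 B emeasure_open_box_finite)
  show ?thesis
  proof (rule approximable_limit[where f = ?T])
    show "approximable n (?T m)" for m by (rule heat_regular_approximable[OF T])
    show "indicator ?B \<in> L2 n" by (rule L)
    show "(\<lambda>m. norm_L2 n (\<lambda>x. ?T m x - indicator ?B x)) \<longlonglongrightarrow> 0"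
    proof (rule L2_dominated_convergence(3))
      show "?T m \<in> borel_measurable (Rn n)" for m by (intro L2_measurable heat_regular_L2 T)
      show "indicator ?B \<in> borel_measurable (Rn n)" using B by simp
      show "indicator ?B \<in> L2 n" by (rule L)
      show "(\<lambda>m. ?T m x) \<longlonglongrightarrow> indicator ?B x" if x: "x \<in> space (Rn n)" for x
        unfolding ind[OF x] tensor_def by (intro tendsto_prod bump_tendsto)
      show "\<bar>?T m x\<bar> \<le> indicator ?B x" if x: "x \<in> space (Rn n)" for m x
        unfolding ind[OF x] tensor_def abs_prod
        using bump_bounds(1,2) by (intro prod_mono) auto
    qed
  qed
qed

definition open_boxes :: "nat \<Rightarrow> (nat \<Rightarrow> real) set set" where
  "open_boxes n = {Pi\<^sub>E {..<n} (\<lambda>i. {a i<..<b i}) | a b. True}"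

lemma open_boxesI: "Pi\<^sub>E {..<n} (\<lambda>i. {a i<..<b i}) \<in> open_boxes n"
  unfolding open_boxes_def mem_Collect_eq by (intro exI conjI) auto

lemma open_boxesE:
  assumes "X \<in> open_boxes n"
  obtains a b where "X = Pi\<^sub>E {..<n} (\<lambda>i. {a i<..<b i})"
  using assms unfolding open_boxes_def mem_Collect_eq by (elim exE conjE)

lemma sets_Rn_open_boxes: "sets (Rn n) = sigma_sets (space (Rn n)) (open_boxes n)"
proof -
  let ?E = "range (\<lambda>(a, b). {a<..<b :: real})"
  let ?P = "{{f \<in> (\<Pi>\<^sub>E i\<in>{..<n}. UNIV). \<forall>i\<in>j. f i \<in> A i} | A j. j \<in> {{..<n}} \<and> A \<in> Pi j (\<lambda>_. ?E)}"
  have borel: "borel = sigma UNIV ?E"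
    using borel_eq_box[where 'a = real] by (simp add: box_real)
  have P: "?P = open_boxes n"
  proof (intro set_eqI iffI)
    fix X assume "X \<in> ?P"
    then obtain A j where "X = {f \<in> (\<Pi>\<^sub>E i\<in>{..<n}. UNIV). \<forall>i\<in>j. f i \<in> A i}" "j \<in> {{..<n}}" "A \<in> Pi j (\<lambda>_. ?E)"
      unfolding mem_Collect_eq by (elim exE conjE)
    then have X: "X = {f \<in> (\<Pi>\<^sub>E i\<in>{..<n}. UNIV). \<forall>i\<in>{..<n}. f i \<in> A i}" and A: "A \<in> Pi {..<n} (\<lambda>_. ?E)"
      by simp_all
    have "\<exists>a b. A i = {a<..<b}" if "i < n" for i
      using Pi_mem[OF A, of i] that by auto
    then obtain a b where ab: "\<And>i. i < n \<Longrightarrow> A i = {a i<..<b i}" by metis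
    have "X = Pi\<^sub>E {..<n} (\<lambda>i. {a i<..<b i})"
      unfolding X using ab by (auto simp: PiE_iff extensional_def)
    then show "X \<in> open_boxes n" by (simp add: open_boxesI)
  next
    fix X assume "X \<in> open_boxes n"
    then obtain a b where X: "X = Pi\<^sub>E {..<n} (\<lambda>i. {a i<..<b i :: real})" by (rule open_boxesE)
    have "X = {f \<in> (\<Pi>\<^sub>E i\<in>{..<n}. UNIV). \<forall>i\<in>{..<n}. f i \<in> {a i<..<b i}}"
      unfolding X by (simp add: PiE_iff set_eq_iff conj_commute)
    moreover have "(\<lambda>i. {a i<..<b i}) \<in> Pi {..<n} (\<lambda>_. ?E)" by auto
    ultimately show "X \<in> ?P" unfolding mem_Collect_eq by (intro exI conjI) auto
  qed
  \<comment> \<open>Boxes of generators recover the cylinder sets because the whole line is a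
    countable union of generating intervals.\<close>
  have cover: "\<exists>S\<subseteq>?E. countable S \<and> UNIV = \<Union>S"
  proof (intro exI conjI)
    let ?S = "range (\<lambda>k::nat. {- real k<..<real k})"
    show "?S \<subseteq> ?E" by auto
    show "countable ?S" by simp
    show "UNIV = \<Union>?S"
    proof (intro set_eqI iffI)
      fix x :: real
      obtain k :: nat where "\<bar>x\<bar> < real k" using reals_Archimedean2 by blast
      then show "x \<in> \<Union>?S" by (auto simp: abs_less_iff intro!: exI[of _ k])
    qed simp
  qed
  have "sets (\<Pi>\<^sub>M i\<in>{..<n}. sigma UNIV ?E) = sets (sigma (\<Pi>\<^sub>E i\<in>{..<n}. UNIV) ?P)"
    by (rule sets_PiM_sigma) (use cover in auto)
  then have "sets (Rn n) = sets (sigma (\<Pi>\<^sub>E i\<in>{..<n}. UNIV) (open_boxes n))"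
    by (simp only: sets_Rn borel P)
  also have "\<dots> = sigma_sets (space (Rn n)) (open_boxes n)"
    by (subst sets_measure_of) (auto simp: open_boxes_def space_Rn)
  finally show ?thesis .
qed

lemma open_boxes_Int:
  "Pi\<^sub>E {..<n} (\<lambda>i. {a i<..<b i}) \<inter> Pi\<^sub>E {..<n} (\<lambda>i. {c i<..<d i})
    = Pi\<^sub>E {..<n} (\<lambda>i. {max (a i) (c i)<..<min (b i) (d i :: real)})"
  unfolding PiE_Int by (intro PiE_cong) auto

text \<open>Dynkin's argument, the open boxes being an intersection-stable generator. Cutting with a
  fixed box keeps the measure finite, so that complements and countable disjoint unions stay in
  L2.\<close>

lemma approximable_indicator_Int_box:
  assumes "A \<in> sets (Rn n)"
  shows "approximable n (indicator (A \<inter> Pi\<^sub>E {..<n} (\<lambda>i. {c i<..<d i})))"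
proof -
  let ?B = "Pi\<^sub>E {..<n} (\<lambda>i. {c i<..<d i})"
  have B: "?B \<in> sets (Rn n)" by (rule sets_Rn_PiE) simp
  have LB: "indicator ?B \<in> L2 n" by (intro indicator_finite_L2 B emeasure_open_box_finite)
  have meas: "X \<in> sets (Rn n)" if "X \<in> sigma_sets (space (Rn n)) (open_boxes n)" for X
    using that sets_Rn_open_boxes by simp
  have "Int_stable (open_boxes n)"
  proof (rule Int_stableI)
    fix X Y assume "X \<in> open_boxes n" "Y \<in> open_boxes n"
    then show "X \<inter> Y \<in> open_boxes n"
      by (elim open_boxesE) (simp only: open_boxes_Int open_boxesI)
  qed
  moreover have "open_boxes n \<subseteq> Pow (space (Rn n))" by (auto simp: open_boxes_def space_Rn)
  moreover have "A \<in> sigma_sets (space (Rn n)) (open_boxes n)" using assms sets_Rn_open_boxes by simp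
  ultimately show ?thesis
  proof (induction rule: sigma_sets_induct_disjoint)
    case (basic X)
    then obtain a b where X: "X = Pi\<^sub>E {..<n} (\<lambda>i. {a i<..<b i})" by (rule open_boxesE)
    show ?case unfolding X open_boxes_Int by (rule approximable_open_box)
  next
    case empty
    then show ?case using approximable_zero by (simp add: indicator_def)
  next
    case (compl X)
    have "approximable n (\<lambda>x. 1 * indicator ?B x + (- 1) * indicator (X \<inter> ?B) x)"
      by (intro approximable_linear approximable_open_box compl)
    then show ?case
      by (rule approximable_cong) (use meas[OF compl(1)] B in \<open>auto simp: indicator_def\<close>)
  next
    case (union X)
    let ?f = "\<lambda>k x. \<Sum>i<k. indicator (X i \<inter> ?B) x :: real"
    have X: "X i \<in> sets (Rn n)" for i using meas union by auto
    have f: "?f k x = indicator ((\<Union>i<k. X i) \<inter> ?B) x" for k x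
    proof (induction k)
      case (Suc k)
      have "X k \<inter> X i = {}" if "i < k" for i
        using disjoint_family_onD[OF union(1), of k i] that by simp
      then have "X k \<inter> (\<Union>i<k. X i) = {}" by blast
      moreover have "(\<Union>i<Suc k. X i) = X k \<union> (\<Union>i<k. X i)" by (auto simp: less_Suc_eq)
      ultimately show ?case
        using Suc by (simp add: indicator_def) blast
    qed simp
    show ?case
    proof (rule approximable_limit[where f = ?f])
      show "approximable n (?f k)" for k
        using union by (intro approximable_sum) auto
      have lim: "(\<lambda>k. ?f k x) \<longlonglongrightarrow> indicator ((\<Union>i. X i) \<inter> ?B) x" for x
      proof (cases "x \<in> (\<Union>i. X i)")
        case True
        then obtain i where i: "x \<in> X i" by blast
        have "\<forall>\<^sub>F k in sequentially. ?f k x = indicator ((\<Union>i. X i) \<inter> ?B) x"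
          using eventually_gt_at_top[of i]
        proof eventually_elim
          case (elim k)
          then have "x \<in> (\<Union>i<k. X i)" using i by blast
          then show ?case unfolding f using True by (auto simp: indicator_def)
        qed
        then show ?thesis by (rule tendsto_eventually)
      qed (simp add: indicator_def)
      have bd: "\<bar>?f k x\<bar> \<le> indicator ?B x" for k x
        unfolding f by (auto simp: indicator_def)
      have m: "?f k \<in> borel_measurable (Rn n)" "indicator ((\<Union>i. X i) \<inter> ?B) \<in> borel_measurable (Rn n)" for k
        using X B by (auto intro!: borel_measurable_sum borel_measurable_indicator)
      show "indicator ((\<Union>i. X i) \<inter> ?B) \<in> L2 n" "(\<lambda>k. norm_L2 n (\<lambda>x. ?f k x - indicator ((\<Union>i. X i) \<inter> ?B) x)) \<longlonglongrightarrow> 0"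
        using L2_dominated_convergence[OF m lim LB bd] by auto
    qed
  qed
qed

lemma L2_approximable:
  assumes f: "f \<in> L2 n" shows "approximable n f"
proof -
  have [measurable]: "f \<in> borel_measurable (Rn n)" using f by measurable
  obtain s where s: "\<And>k. simple_function (Rn n) (s k)"
    and lim: "\<And>x. x \<in> space (Rn n) \<Longrightarrow> (\<lambda>k. s k x) \<longlonglongrightarrow> f x"
    and bound: "\<And>k x. x \<in> space (Rn n) \<Longrightarrow> \<bar>s k x\<bar> \<le> 2 * \<bar>f x\<bar>"
    using borel_measurable_implies_sequence_metric[of f "Rn n" 0] by (auto simp: dist_norm) metis
  let ?B = "\<lambda>k::nat. Pi\<^sub>E {..<n} (\<lambda>i. {- real k<..<real k})"
  have B: "?B k \<in> sets (Rn n)" for k by (rule sets_Rn_PiE) simp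
  \<comment> \<open>Truncation to growing boxes reduces the level sets of a simple function to sets
    of finite measure.\<close>
  let ?g = "\<lambda>k x. s k x * indicator (?B k) x"
  have m: "s k \<in> borel_measurable (Rn n)" for k
    by (rule borel_measurable_simple_function[OF s])
  have gm: "?g k \<in> borel_measurable (Rn n)" for k
    using m[of k] B[of k] by measurable
  show ?thesis
  proof (rule approximable_limit[where f = ?g])
    show "approximable n (?g k)" for k
    proof -
      let ?I = "\<lambda>y. s k -` {y} \<inter> space (Rn n)"
      have "approximable n (\<lambda>x. \<Sum>y\<in>s k ` space (Rn n). y * indicator (?I y \<inter> ?B k) x)"
        by (rule approximable_sum[OF simple_functionD(1)[OF s]
              approximable_cmult[OF approximable_indicator_Int_box[OF simple_functionD(2)[OF s]]]])
      then show ?thesis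
      proof (rule approximable_cong[OF _ gm[of k]])
        fix x assume x: "x \<in> space (Rn n)"
        have "(\<Sum>y\<in>s k ` space (Rn n). y * indicator (?I y \<inter> ?B k) x)
            = (\<Sum>y\<in>s k ` space (Rn n). indicator (?I y) x *\<^sub>R y) * indicator (?B k) x"
          unfolding sum_distrib_right by (intro sum.cong refl) (simp add: indicator_inter_arith)
        also have "\<dots> = s k x * indicator (?B k) x"
          by (simp only: simple_function_indicator_representation_banach[OF s x, symmetric])
        finally show "(\<Sum>y\<in>s k ` space (Rn n). y * indicator (?I y \<inter> ?B k) x) = ?g k x" .
      qed
    qed
    show "f \<in> L2 n" by (rule f)
    show "(\<lambda>k. norm_L2 n (\<lambda>x. ?g k x - f x)) \<longlonglongrightarrow> 0"
    proof (rule L2_dominated_convergence(3))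
      show "?g k \<in> borel_measurable (Rn n)" for k by (rule gm)
      show "f \<in> borel_measurable (Rn n)" by measurable
      show "(\<lambda>x. 2 * \<bar>f x\<bar>) \<in> L2 n" using f by (intro L2_cmult) (simp add: L2_def)
      show "\<bar>?g k x\<bar> \<le> 2 * \<bar>f x\<bar>" if "x \<in> space (Rn n)" for k x
        using bound[OF that, of k] by (auto simp: indicator_def)
      show "(\<lambda>k. ?g k x) \<longlonglongrightarrow> f x" if x: "x \<in> space (Rn n)" for x
      proof (rule Lim_transform_eventually[OF lim[OF x]])
        \<comment> \<open>From this index on \<open>x\<close> lies in the box, so the truncation no
          longer acts at \<open>x\<close>.\<close>
        obtain K :: nat where K: "(\<Sum>i<n. \<bar>x i\<bar>) < real K" using reals_Archimedean2 by blast
        show "\<forall>\<^sub>F k in sequentially. s k x = ?g k x"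
          using eventually_ge_at_top[of K]
        proof eventually_elim
          case (elim k)
          have "x i \<in> {- real k<..<real k}" if "i < n" for i
          proof -
            have "\<bar>x i\<bar> \<le> (\<Sum>i<n. \<bar>x i\<bar>)" using that by (intro member_le_sum) auto
            then have "\<bar>x i\<bar> < real k" using K elim by linarith
            then show ?thesis by (simp add: abs_less_iff)
          qed
          then have "x \<in> ?B k" using x by (simp add: space_Rn PiE_iff)
          then show ?case by simp
        qed
      qed
    qed
  qed
qed

section \<open>Duality with regular functions\<close>

lemma heat_regular_dense:
  assumes "f \<in> L2 n" "e > 0"
  obtains \<phi> where "\<phi> \<in> heat_regular n" "norm_L2 n (\<lambda>x. f x - \<phi> x) < e"
  using L2_approximable[OF assms(1)] assms(2) unfolding approximable_def by blast

text \<open>The bound is applied to a regular function close to \<open>f\<close> itself, for which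
  the pairing is nearly the square of the norm.\<close>

lemma norm_L2_le_dual:
  assumes f: "f \<in> L2 n" and c: "c \<ge> 0" and b: "\<And>\<phi>. \<phi> \<in> heat_regular n \<Longrightarrow> \<bar>ip n f \<phi>\<bar> \<le> c * norm_L2 n \<phi>"
  shows "norm_L2 n f \<le> c"
proof (rule ccontr)
  assume "\<not> norm_L2 n f \<le> c"
  then have gt: "norm_L2 n f - c > 0" by simp
  define N where "N = norm_L2 n f"
  have N: "N > 0" using gt c by (simp add: N_def)
  have "N * N \<le> c * N + (c + N) * e" if e: "e > 0" for e
  proof -
    obtain \<phi> where \<phi>: "\<phi> \<in> heat_regular n" "norm_L2 n (\<lambda>x. f x - \<phi> x) < e"
      using heat_regular_dense[OF f e] .
    note \<phi>L = heat_regular_L2[OF \<phi>(1)]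
    have "norm_L2 n \<phi> \<le> norm_L2 n (\<lambda>x. \<phi> x - f x) + N"
      using norm_L2_triangle[of "\<lambda>x. \<phi> x - f x" n f] f \<phi>L by (simp add: L2_intros N_def)
    then have n\<phi>: "norm_L2 n \<phi> \<le> e + N" using \<phi>(2) by (simp add: norm_L2_minus_commute[of n \<phi>])
    have "N * N = ip n f f" by (simp add: N_def norm_L2_square flip: power2_eq_square)
    also have "\<dots> = ip n f (\<lambda>x. f x - \<phi> x) + ip n f \<phi>"
      using f \<phi>L by (simp add: ip_diff_right)
    also have "\<dots> \<le> N * norm_L2 n (\<lambda>x. f x - \<phi> x) + c * norm_L2 n \<phi>"
      using ip_Cauchy_Schwarz[OF f L2_diff[OF f \<phi>L]] b[OF \<phi>(1)] by (simp add: N_def)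
    also have "\<dots> \<le> N * e + c * (e + N)"
      using N c \<phi>(2) n\<phi> by (intro add_mono mult_left_mono) auto
    finally show ?thesis by (simp add: algebra_simps)
  qed
  \<comment> \<open>This choice of \<open>e\<close> makes the error \<open>(c + N) * e\<close> half
    of the gap \<open>N * (N - c)\<close>, which is then at most half of itself.\<close>
  moreover have "0 < N * (N - c) / (2 * (c + N))" using N c gt by (simp add: N_def[symmetric])
  ultimately have "N * N \<le> c * N + (c + N) * (N * (N - c) / (2 * (c + N)))" by blast
  also have "(c + N) * (N * (N - c) / (2 * (c + N))) = N * (N - c) / 2"
  proof -
    have *: "k * (x / (2 * k)) = x / 2" if "k > 0" for k x :: real using that by simp
    show ?thesis by (rule *) (use N c in simp)
  qed
  finally have "N * N \<le> c * N + N * (N - c) / 2" .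
  then have "N * (N - c) \<le> 0" by (simp add: field_simps)
  then show False using N gt by (auto simp: N_def[symmetric] mult_le_0_iff)
qed

lemma L2_eq_AE:
  assumes f: "f \<in> L2 n" and g: "g \<in> L2 n" and eq: "\<And>\<phi>. \<phi> \<in> heat_regular n \<Longrightarrow> ip n f \<phi> = ip n g \<phi>"
  shows "AE x in Rn n. f x = g x"
proof -
  have "norm_L2 n (\<lambda>x. f x - g x) \<le> 0"
    using f g eq heat_regular_L2 by (intro norm_L2_le_dual) (auto simp: L2_intros ip_diff_left)
  then have "norm_L2 n (\<lambda>x. f x - g x) = 0" by (simp add: order_antisym)
  from norm_L2_eq_0D[OF L2_diff[OF f g] this] show ?thesis by simp
qed

text \<open>The regular functions are test functions and already separate the elements of
  L2.\<close>

lemma has_weak_deriv_unique: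
  assumes "g \<in> L2 n" "h \<in> L2 n" "has_weak_deriv n is u g" "has_weak_deriv n is u h"
  shows "AE x in Rn n. g x = h x"
proof (rule L2_eq_AE)
  fix \<phi> assume "\<phi> \<in> heat_regular n"
  then have "\<phi> \<in> test_functions n" by (simp add: heat_regular_def)
  then have "(- 1) ^ length is * ip n g \<phi> = (- 1) ^ length is * ip n h \<phi>"
    using assms(3,4) unfolding has_weak_deriv_iff by metis
  then show "ip n g \<phi> = ip n h \<phi>" by simp
qed (use assms in auto)

section \<open>Time regularity of the heat semigroup\<close>

lemma heat_regular_time_deriv:
  assumes "\<phi> \<in> heat_regular n" "t \<ge> 0"
  shows "((\<lambda>s. norm_L2 n (\<lambda>x. (heat n s \<phi> x - heat n t \<phi> x) / (s - t) - heat n t (test_laplacian n \<phi>) x)) \<longlongrightarrow> 0)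
      (at t within {0..})"
  using assms by (simp add: heat_regular_def)

lemma heat_regular_test: "\<phi> \<in> heat_regular n \<Longrightarrow> \<phi> \<in> test_functions n"
  by (simp add: heat_regular_def)

text \<open>Continuity holds on the dense class, where orbits are differentiable, and passes to all
  of L2 because every \<open>heat n r\<close> is a contraction: two of the three errors are bounded
  by the distance from \<open>f\<close> to \<phi>.\<close>

lemma heat_continuous_into_L2:
  assumes f: "f \<in> L2 n"
  shows "continuous_into_L2 n (\<lambda>t. heat n t f)"
  unfolding continuous_into_L2_def
proof (intro allI impI conjI)
  fix t :: real assume t: "t \<ge> 0"
  show "heat n t f \<in> L2 n" by (rule heat_L2(1)[OF t f])
  show "((\<lambda>s. norm_L2 n (\<lambda>x. heat n s f x - heat n t f x)) \<longlongrightarrow> 0) (at t within {0..})"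
  proof (rule tendstoI)
    fix e :: real assume e: "e > 0"
    then have "e / 3 > 0" by simp
    then obtain \<phi> where \<phi>: "\<phi> \<in> heat_regular n" "norm_L2 n (\<lambda>x. f x - \<phi> x) < e / 3"
      using heat_regular_dense[OF f] by blast
    note \<phi>L = heat_regular_L2[OF \<phi>(1)]
    have "((\<lambda>s. norm_L2 n (\<lambda>x. heat n s \<phi> x - heat n t \<phi> x)) \<longlongrightarrow> 0) (at t within {0..})"
      by (rule norm_L2_continuous_of_derivative[OF heat_regular_time_deriv[OF \<phi>(1) t]])
        (use t in \<open>auto intro!: heat_L2 \<phi>L test_laplacian_L2 heat_regular_test \<phi>\<close>)
    then have "\<forall>\<^sub>F s in at t within {0..}. norm_L2 n (\<lambda>x. heat n s \<phi> x - heat n t \<phi> x) < e / 3"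
      by (rule order_tendstoD(2)) (use e in simp)
    moreover have "\<forall>\<^sub>F s in at t within {0..}. s \<ge> 0" by (simp add: eventually_at_filter)
    ultimately show "\<forall>\<^sub>F s in at t within {0..}. dist (norm_L2 n (\<lambda>x. heat n s f x - heat n t f x)) 0 < e"
    proof eventually_elim
      case (elim s)
      have le: "norm_L2 n (\<lambda>x. heat n r f x - heat n r \<phi> x) < e / 3" if "r \<ge> 0" for r
      proof -
        have "norm_L2 n (\<lambda>x. heat n r f x - heat n r \<phi> x) = norm_L2 n (heat n r (\<lambda>x. f x - \<phi> x))"
          by (intro norm_L2_cong) (simp add: heat_diff[OF that f \<phi>L])
        also have "\<dots> \<le> norm_L2 n (\<lambda>x. f x - \<phi> x)"
          by (intro heat_L2 that L2_diff f \<phi>L)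
        finally show ?thesis using \<phi>(2) by simp
      qed
      have L: "heat n s f \<in> L2 n" "heat n t f \<in> L2 n" "heat n s \<phi> \<in> L2 n" "heat n t \<phi> \<in> L2 n"
        using elim t by (auto intro!: heat_L2 f \<phi>L)
      have "norm_L2 n (\<lambda>x. heat n s f x - heat n t f x)
          \<le> norm_L2 n (\<lambda>x. heat n s f x - heat n s \<phi> x) + norm_L2 n (\<lambda>x. heat n s \<phi> x - heat n t f x)"
        by (intro norm_L2_triangle_diff L)
      also have "norm_L2 n (\<lambda>x. heat n s \<phi> x - heat n t f x)
          \<le> norm_L2 n (\<lambda>x. heat n s \<phi> x - heat n t \<phi> x) + norm_L2 n (\<lambda>x. heat n t \<phi> x - heat n t f x)"
        by (intro norm_L2_triangle_diff L)
      finally show ?case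
        using le[OF elim(2)] le[OF t] elim(1) by (simp add: norm_L2_minus_commute[of n "heat n t \<phi>"])
    qed
  qed
qed

lemma heat_time_deriv:
  assumes u: "u \<in> H2 n"
  shows "has_time_deriv_L2 n (\<lambda>t. heat n t u) (\<lambda>t. heat n t (laplacian n u))"
  unfolding has_time_deriv_L2_def
proof (intro allI impI tendstoI)
  fix t e :: real assume t: "t \<ge> 0" and e: "e > 0"
  let ?L = "laplacian n u"
  note uL = sobolev_L2[OF u] and LL = laplacian_L2[OF u]
  have "((\<lambda>s. norm_L2 n (\<lambda>x. heat n s ?L x - heat n t ?L x)) \<longlongrightarrow> 0) (at t within {0..})"
    using heat_continuous_into_L2[OF LL] t unfolding continuous_into_L2_def by blast
  then have "\<forall>\<^sub>F s in at t within {0..}. norm_L2 n (\<lambda>x. heat n s ?L x - heat n t ?L x) < e / 2"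
    by (rule order_tendstoD(2)) (use e in simp)
  then obtain d where d: "d > 0" "\<And>s. s \<ge> 0 \<Longrightarrow> s \<noteq> t \<Longrightarrow> \<bar>s - t\<bar> < d \<Longrightarrow>
      norm_L2 n (\<lambda>x. heat n s ?L x - heat n t ?L x) < e / 2"
    unfolding eventually_at by (auto simp: dist_real_def)
  have near: "norm_L2 n (\<lambda>x. heat n s ?L x - heat n t ?L x) \<le> e / 2" if "s \<ge> 0" "\<bar>s - t\<bar> < d" for s
    using d(2)[OF that(1) _ that(2)] e by (cases "s = t") auto
  have "dist (norm_L2 n (\<lambda>x. (heat n s u x - heat n t u x) / (s - t) - heat n t ?L x)) 0 < e"
    if s: "s \<ge> 0" "s \<noteq> t" "\<bar>s - t\<bar> < d" for s
  proof -
    let ?q = "\<lambda>x. (heat n s u x - heat n t u x) / (s - t) - heat n t ?L x"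
    have "norm_L2 n ?q \<le> e / 2"
    proof (rule norm_L2_le_dual)
      show "?q \<in> L2 n"
        by (intro L2_intros heat_L2 uL LL s t)
      show "0 \<le> e / 2" using e by simp
      fix \<phi> assume \<phi>: "\<phi> \<in> heat_regular n"
      note \<phi>L = heat_regular_L2[OF \<phi>] and \<phi>T = heat_regular_test[OF \<phi>]
      have "((\<lambda>r. ip n (heat n r u) \<phi>) has_real_derivative ip n (heat n r ?L) \<phi>) (at r within {0..})"
        if r: "r \<ge> 0" for r
      proof -
        have "((\<lambda>r. ip n u (heat n r \<phi>)) has_real_derivative
            ip n (\<lambda>x. 0) (heat n r \<phi>) + ip n u (heat n r (test_laplacian n \<phi>))) (at r within {0..})"
          by (rule ip_has_derivative) (use r heat_regular_time_deriv[OF \<phi> r] in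
            \<open>auto intro!: heat_L2 \<phi>L uL L2_zero test_laplacian_L2 \<phi>T\<close>)
        also have "ip n (\<lambda>x. 0) (heat n r \<phi>) + ip n u (heat n r (test_laplacian n \<phi>)) = ip n (heat n r ?L) \<phi>"
          using ip_heat_laplacian[OF u \<phi>T r] heat_selfadjoint[OF r LL \<phi>L] by (simp add: ip_def)
        finally show ?thesis
          by (rule has_field_derivative_transform_within[where d = 1])
            (use r in \<open>auto simp: heat_selfadjoint[OF _ uL \<phi>L]\<close>)
      qed
      \<comment> \<open>The time \<open>r\<close> depends on \<phi>, but the bound from
        \<open>near\<close> holds for all times this close to \<open>t\<close>; hence the estimate
        is uniform in \<phi> and duality applies.\<close>
      then obtain r where r: "0 \<le> r" "\<bar>r - t\<bar> \<le> \<bar>s - t\<bar>"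
        "(ip n (heat n s u) \<phi> - ip n (heat n t u) \<phi>) / (s - t) = ip n (heat n r ?L) \<phi>"
        using mean_value_nonneg[of "\<lambda>r. ip n (heat n r u) \<phi>" "\<lambda>r. ip n (heat n r ?L) \<phi>" s t] s t by blast
      have L: "heat n s u \<in> L2 n" "heat n t u \<in> L2 n" "heat n r ?L \<in> L2 n" "heat n t ?L \<in> L2 n"
        using s t r by (auto intro!: heat_L2 uL LL)
      have "ip n ?q \<phi>
          = (ip n (heat n s u) \<phi> - ip n (heat n t u) \<phi>) / (s - t) - ip n (heat n t ?L) \<phi>"
        using L \<phi>L by (simp add: ip_diff_left ip_divide_left L2_intros)
      also have "\<dots> = ip n (\<lambda>x. heat n r ?L x - heat n t ?L x) \<phi>"
        using L \<phi>L r(3) by (simp add: ip_diff_left)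
      finally have eq: "ip n ?q \<phi>
          = ip n (\<lambda>x. heat n r ?L x - heat n t ?L x) \<phi>" .
      have "\<bar>ip n (\<lambda>x. heat n r ?L x - heat n t ?L x) \<phi>\<bar>
          \<le> norm_L2 n (\<lambda>x. heat n r ?L x - heat n t ?L x) * norm_L2 n \<phi>"
        by (rule ip_Cauchy_Schwarz[OF L2_diff[OF L(3,4)] \<phi>L])
      also have "\<dots> \<le> e / 2 * norm_L2 n \<phi>"
        by (rule mult_right_mono[OF near[OF r(1) order.strict_trans1[OF r(2) s(3)]] norm_L2_nonneg])
      finally show "\<bar>ip n ?q \<phi>\<bar> \<le> e / 2 * norm_L2 n \<phi>"
        unfolding eq .
    qed
    then show ?thesis using e by simp
  qed
  then show "\<forall>\<^sub>F s in at t within {0..}.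
      dist (norm_L2 n (\<lambda>x. (heat n s u x - heat n t u x) / (s - t) - heat n t ?L x)) 0 < e"
    unfolding eventually_at using d(1) by (auto simp: dist_real_def)
qed

section \<open>Sums and scalar multiples of curves\<close>

lemma continuous_into_L2D:
  assumes "continuous_into_L2 n w" "t \<ge> 0"
  shows "w t \<in> L2 n" "((\<lambda>s. norm_L2 n (\<lambda>x. w s x - w t x)) \<longlongrightarrow> 0) (at t within {0..})"
  using assms by (auto simp: continuous_into_L2_def)

lemma eventually_within_nonneg: "\<forall>\<^sub>F s in at t within {0..}. s \<ge> (0::real) \<and> s \<noteq> t"
  by (simp add: eventually_at_filter)

lemma continuous_into_L2_add:
  assumes v: "continuous_into_L2 n v" and w: "continuous_into_L2 n w"
  shows "continuous_into_L2 n (\<lambda>t x. v t x + w t x)"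
  unfolding continuous_into_L2_def
proof (intro allI impI conjI)
  fix t :: real assume t: "t \<ge> 0"
  show "(\<lambda>x. v t x + w t x) \<in> L2 n" using v w t by (intro L2_add continuous_into_L2D)
  show "((\<lambda>s. norm_L2 n (\<lambda>x. v s x + w s x - (v t x + w t x))) \<longlongrightarrow> 0) (at t within {0..})"
  proof (rule norm_L2_add_tendsto_0[OF continuous_into_L2D(2)[OF v t] continuous_into_L2D(2)[OF w t]])
    show "\<forall>\<^sub>F s in at t within {0..}. (\<lambda>x. v s x - v t x) \<in> L2 n \<and> (\<lambda>x. w s x - w t x) \<in> L2 n \<and>
        (\<forall>x\<in>space (Rn n). v s x + w s x - (v t x + w t x) = v s x - v t x + (w s x - w t x))"
      using eventually_within_nonneg
      by eventually_elim (use t in \<open>auto intro!: L2_diff continuous_into_L2D(1)[OF v]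
          continuous_into_L2D(1)[OF w]\<close>)
  qed
qed

lemma continuous_into_L2_cmult:
  assumes a: "continuous_on {0..} a" and w: "continuous_into_L2 n w"
  shows "continuous_into_L2 n (\<lambda>t x. a t * w t x)"
  unfolding continuous_into_L2_def
proof (intro allI impI conjI)
  fix t :: real assume t: "t \<ge> 0"
  show "(\<lambda>x. a t * w t x) \<in> L2 n" using w t by (intro L2_cmult continuous_into_L2D)
  have at: "(a \<longlongrightarrow> a t) (at t within {0..})" using a t by (simp add: continuous_on_def)
  show "((\<lambda>s. norm_L2 n (\<lambda>x. a s * w s x - a t * w t x)) \<longlongrightarrow> 0) (at t within {0..})"
  proof (rule norm_L2_add_tendsto_0)
    show "((\<lambda>s. norm_L2 n (\<lambda>x. a s * (w s x - w t x))) \<longlongrightarrow> 0) (at t within {0..})"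
      unfolding norm_L2_cmult
      using tendsto_mult[OF tendsto_rabs[OF at] continuous_into_L2D(2)[OF w t]] by simp
    show "((\<lambda>s. norm_L2 n (\<lambda>x. (a s - a t) * w t x)) \<longlongrightarrow> 0) (at t within {0..})"
      unfolding norm_L2_cmult
      using at by (auto intro!: tendsto_eq_intros)
    show "\<forall>\<^sub>F s in at t within {0..}. (\<lambda>x. a s * (w s x - w t x)) \<in> L2 n \<and> (\<lambda>x. (a s - a t) * w t x) \<in> L2 n \<and>
        (\<forall>x\<in>space (Rn n). a s * w s x - a t * w t x = a s * (w s x - w t x) + (a s - a t) * w t x)"
      using eventually_within_nonneg
      by eventually_elim (use t in \<open>auto intro!: L2_cmult L2_diff continuous_into_L2D(1)[OF w] simp:
          left_diff_distrib right_diff_distrib\<close>)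
  qed
qed

lemma has_time_deriv_L2_add:
  assumes v: "has_time_deriv_L2 n v v'" and w: "has_time_deriv_L2 n w w'"
    and L: "\<And>t. t \<ge> 0 \<Longrightarrow> v t \<in> L2 n" "\<And>t. t \<ge> 0 \<Longrightarrow> v' t \<in> L2 n" "\<And>t. t \<ge> 0 \<Longrightarrow> w t \<in> L2 n" "\<And>t. t \<ge> 0 \<Longrightarrow> w' t \<in> L2 n"
  shows "has_time_deriv_L2 n (\<lambda>t x. v t x + w t x) (\<lambda>t x. v' t x + w' t x)"
  unfolding has_time_deriv_L2_def
proof (intro allI impI)
  fix t :: real assume t: "t \<ge> 0"
  show "((\<lambda>s. norm_L2 n (\<lambda>x. (v s x + w s x - (v t x + w t x)) / (s - t) - (v' t x + w' t x))) \<longlongrightarrow> 0) (at t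
      within {0..})"
  proof (rule norm_L2_add_tendsto_0[OF v[unfolded has_time_deriv_L2_def, rule_format, OF t] w[unfolded
      has_time_deriv_L2_def, rule_format, OF t]])
    show "\<forall>\<^sub>F s in at t within {0..}. (\<lambda>x. (v s x - v t x) / (s - t) - v' t x) \<in> L2 n \<and>
        (\<lambda>x. (w s x - w t x) / (s - t) - w' t x) \<in> L2 n \<and>
        (\<forall>x\<in>space (Rn n). (v s x + w s x - (v t x + w t x)) / (s - t) - (v' t x + w' t x)
          = (v s x - v t x) / (s - t) - v' t x + ((w s x - w t x) / (s - t) - w' t x))"
      using eventually_within_nonneg
      by eventually_elim (use L t in \<open>auto intro!: L2_intros simp: diff_divide_distrib add_divide_distrib\<close>)
  qed
qed

text \<open>The error of the product rule is \<open>a s\<close> times the error of \<open>w\<close>,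
  plus \<open>a s - a t\<close> times \<open>w' t\<close>, plus the error of \<open>a\<close> times
  \<open>w t\<close>.\<close>

lemma has_time_deriv_L2_cmult:
  assumes a: "\<And>t. t \<ge> 0 \<Longrightarrow> (a has_real_derivative a' t) (at t within {0..})"
    and w: "has_time_deriv_L2 n w w'"
    and L: "\<And>t. t \<ge> 0 \<Longrightarrow> w t \<in> L2 n" "\<And>t. t \<ge> 0 \<Longrightarrow> w' t \<in> L2 n"
  shows "has_time_deriv_L2 n (\<lambda>t x. a t * w t x) (\<lambda>t x. a' t * w t x + a t * w' t x)"
  unfolding has_time_deriv_L2_def
proof (intro allI impI)
  fix t :: real assume t: "t \<ge> 0"
  let ?F = "at t within {0..}"
  have at: "(a \<longlongrightarrow> a t) ?F"
    using DERIV_continuous[OF a[OF t]] by (simp add: continuous_within)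
  have at': "((\<lambda>s. (a s - a t) / (s - t) - a' t) \<longlongrightarrow> 0) ?F"
    using a[OF t] unfolding has_field_derivative_iff by (rule LIM_zero)
  have wt: "((\<lambda>s. norm_L2 n (\<lambda>x. (w s x - w t x) / (s - t) - w' t x)) \<longlongrightarrow> 0) ?F"
    using w t by (simp add: has_time_deriv_L2_def)
  have 1: "((\<lambda>s. norm_L2 n (\<lambda>x. a s * ((w s x - w t x) / (s - t) - w' t x))) \<longlongrightarrow> 0) ?F"
    unfolding norm_L2_cmult using tendsto_mult[OF tendsto_rabs[OF at] wt] by simp
  have 2: "((\<lambda>s. norm_L2 n (\<lambda>x. (a s - a t) * w' t x + ((a s - a t) / (s - t) - a' t) * w t x)) \<longlongrightarrow> 0) ?F"
  proof (rule norm_L2_add_tendsto_0)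
    show "((\<lambda>s. norm_L2 n (\<lambda>x. (a s - a t) * w' t x)) \<longlongrightarrow> 0) ?F"
      unfolding norm_L2_cmult using at by (auto intro!: tendsto_eq_intros)
    show "((\<lambda>s. norm_L2 n (\<lambda>x. ((a s - a t) / (s - t) - a' t) * w t x)) \<longlongrightarrow> 0) ?F"
      unfolding norm_L2_cmult using tendsto_mult_left_zero[OF tendsto_rabs_zero[OF at']] by simp
    show "\<forall>\<^sub>F s in ?F. (\<lambda>x. (a s - a t) * w' t x) \<in> L2 n \<and> (\<lambda>x. ((a s - a t) / (s - t) - a' t) * w t x) \<in> L2 n \<and>
        (\<forall>x\<in>space (Rn n). (a s - a t) * w' t x + ((a s - a t) / (s - t) - a' t) * w t x =
          (a s - a t) * w' t x + ((a s - a t) / (s - t) - a' t) * w t x)"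
      using L t by (intro always_eventually allI conjI ballI refl L2_cmult) auto
  qed
  show "((\<lambda>s. norm_L2 n (\<lambda>x. (a s * w s x - a t * w t x) / (s - t) - (a' t * w t x + a t * w' t x))) \<longlongrightarrow> 0) ?F"
  proof (rule norm_L2_add_tendsto_0[OF 1 2])
    show "\<forall>\<^sub>F s in ?F. (\<lambda>x. a s * ((w s x - w t x) / (s - t) - w' t x)) \<in> L2 n \<and>
        (\<lambda>x. (a s - a t) * w' t x + ((a s - a t) / (s - t) - a' t) * w t x) \<in> L2 n \<and>
        (\<forall>x\<in>space (Rn n). (a s * w s x - a t * w t x) / (s - t) - (a' t * w t x + a t * w' t x) =
          a s * ((w s x - w t x) / (s - t) - w' t x) + ((a s - a t) * w' t x + ((a s - a t) / (s - t) - a'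
              t) * w t x))"
      using eventually_within_nonneg
    proof eventually_elim
      case (elim s)
      have eq: "(p * q - p0 * q0) / (s - t) - (p1 * q0 + p0 * q1) =
          p * ((q - q0) / (s - t) - q1) + ((p - p0) * q1 + ((p - p0) / (s - t) - p1) * q0)" for p q p0 q0 p1
              q1 :: real
      proof -
        have "(p * q - p0 * q0) / (s - t) = p * ((q - q0) / (s - t)) + (p - p0) / (s - t) * q0"
          using elim by (simp add: divide_simps) (simp add: algebra_simps)
        then show ?thesis by (simp add: left_diff_distrib right_diff_distrib)
      qed
      show ?case using L t elim by (intro conjI ballI L2_intros eq) auto
    qed
  qed
qed

section \<open>Existence\<close>

lemma sobolev_diff:
  assumes u: "u \<in> sobolev n k" and v: "v \<in> sobolev n k"
  shows "(\<lambda>x. u x - v x) \<in> sobolev n k"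
  unfolding sobolev_def
proof (intro CollectI conjI ballI impI)
  note uL = sobolev_L2[OF u] and vL = sobolev_L2[OF v]
  show "(\<lambda>x. u x - v x) \<in> L2 n" by (rule L2_diff[OF uL vL])
  fix "is" assume i: "is \<in> lists {..<n}" "length is \<le> k"
  note uw = weak_deriv_spec[OF u i] and vw = weak_deriv_spec[OF v i]
  have "has_weak_deriv n is (\<lambda>x. u x - v x) (\<lambda>x. weak_deriv n is u x - weak_deriv n is v x)"
    using has_weak_deriv_linear[OF uL vL uw(1) vw(1) i(1) uw(2) vw(2), of 1 "- 1"] by simp
  then show "\<exists>g\<in>L2 n. has_weak_deriv n is (\<lambda>x. u x - v x) g"
    by (intro bexI[of _ "\<lambda>x. weak_deriv n is u x - weak_deriv n is v x"] L2_diff[OF uw(1) vw(1)])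
qed

lemma weak_deriv_AE:
  assumes "u \<in> sobolev n k" "is \<in> lists {..<n}" "length is \<le> k" "g \<in> L2 n" "has_weak_deriv n is u g"
  shows "AE x in Rn n. weak_deriv n is u x = g x"
  using weak_deriv_spec[OF assms(1-3)] assms(4,5) by (intro has_weak_deriv_unique)

text \<open>The Sobolev norm of \<open>u s - u t\<close> involves weak derivatives selected anew for
  each \<open>s\<close>. By uniqueness they agree almost everywhere with the differences of the
  given families \<open>w\<close>, whose continuity is known.\<close>

lemma continuous_into_H2I:
  assumes uL: "\<And>t. t \<ge> 0 \<Longrightarrow> u t \<in> L2 n"
    and w: "\<And>is. is \<in> lists {..<n} \<Longrightarrow> length is \<le> 2 \<Longrightarrow> continuous_into_L2 n (w is)"
    and d: "\<And>is t. is \<in> lists {..<n} \<Longrightarrow> length is \<le> 2 \<Longrightarrow> t \<ge> 0 \<Longrightarrow> has_weak_deriv n is (u t) (w is t)"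
  shows "continuous_into_H2 n u"
  unfolding continuous_into_H2_def
proof (intro allI impI conjI)
  have H2: "u t \<in> H2 n" if "t \<ge> 0" for t
    unfolding sobolev_def using uL w d that by (blast intro: continuous_into_L2D(1))
  fix t :: real assume t: "t \<ge> 0"
  show "u t \<in> H2 n" by (rule H2[OF t])
  let ?S = "\<lambda>s. \<Sum>is | is \<in> lists {..<n} \<and> length is \<le> 2. (norm_L2 n (\<lambda>x. w is s x - w is t x))\<^sup>2"
  have norm_eq: "norm_L2 n (weak_deriv n is (\<lambda>x. u s x - u t x)) = norm_L2 n (\<lambda>x. w is s x - w is t x)"
    if i: "is \<in> lists {..<n}" "length is \<le> 2" and s: "s \<ge> 0" for s "is"
  proof -
    have wL: "w is s \<in> L2 n" "w is t \<in> L2 n" using continuous_into_L2D(1)[OF w[OF i]] s t by auto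
    have wd: "has_weak_deriv n is (\<lambda>x. u s x - u t x) (\<lambda>x. w is s x - w is t x)"
      using has_weak_deriv_linear[OF uL[OF s] uL[OF t] wL i(1) d[OF i s] d[OF i t], of 1 "- 1"] by simp
    have sd: "(\<lambda>x. u s x - u t x) \<in> H2 n" by (intro sobolev_diff H2 s t)
    show ?thesis
      by (rule norm_L2_cong_AE[OF weak_deriv_AE[OF sd i L2_diff[OF wL] wd]
            L2_measurable[OF weak_deriv_spec(1)[OF sd i]] L2_measurable[OF L2_diff[OF wL]]])
  qed
  have "((\<lambda>s. sqrt (?S s))
      \<longlongrightarrow> sqrt (\<Sum>is | is \<in> lists {..<n} \<and> length is \<le> 2. 0\<^sup>2)) (at t within {0..})"
    by (intro tendsto_real_sqrt tendsto_sum tendsto_power continuous_into_L2D(2)[OF w t]) auto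
  then have "((\<lambda>s. sqrt (?S s))
      \<longlongrightarrow> 0) (at t within {0..})" by simp
  moreover have "\<forall>\<^sub>F s in at t within {0..}. sqrt (?S s)
      = norm_sobolev n 2 (\<lambda>x. u s x - u t x)"
    using eventually_within_nonneg
  proof eventually_elim
    case (elim s)
    then show ?case unfolding norm_sobolev_def
      by (intro arg_cong[of _ _ sqrt] sum.cong refl) (simp add: norm_eq)
  qed
  ultimately show "((\<lambda>s. norm_sobolev n 2 (\<lambda>x. u s x - u t x)) \<longlongrightarrow> 0) (at t within {0..})"
    by (rule Lim_transform_eventually)
qed

lemma laplacian_AE:
  assumes u: "u \<in> H2 n" and w: "\<And>i. i < n \<Longrightarrow> w i \<in> L2 n" "\<And>i. i < n \<Longrightarrow> has_weak_deriv n [i, i] u (w i)"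
  shows "AE x in Rn n. laplacian n u x = (\<Sum>i<n. w i x)"
proof -
  have "AE x in Rn n. \<forall>i\<in>{..<n}. weak_deriv n [i, i] u x = w i x"
    using w by (intro AE_finite_allI weak_deriv_AE[OF u]) auto
  then show ?thesis by eventually_elim (simp add: laplacian_def)
qed

text \<open>One component of the matrix exponential applied to \<open>(T_t f, T_t g)\<close>, with
  \<open>a\<close> and \<open>b\<close> as a row of the matrix. The same form covers its weak
  derivatives, its Laplacian and its time derivative, with changed data or coefficients.\<close>

definition heat_comb :: "nat \<Rightarrow> (real \<Rightarrow> real) \<Rightarrow> (real \<Rightarrow> real) \<Rightarrow> ((nat \<Rightarrow> real) \<Rightarrow> real) \<Rightarrow> ((nat \<Rightarrow> real) \<Rightarrow> real) \<Rightarrow>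
    real \<Rightarrow> (nat \<Rightarrow> real) \<Rightarrow> real" where
  "heat_comb n a b f g t x = a t * heat n t f x + b t * heat n t g x"

lemma heat_comb_eta: "heat_comb n a b f g t = (\<lambda>x. a t * heat n t f x + b t * heat n t g x)"
  by (simp add: heat_comb_def fun_eq_iff)

lemma heat_comb_continuous_into_L2:
  assumes "f \<in> L2 n" "g \<in> L2 n" "continuous_on {0..} a" "continuous_on {0..} b"
  shows "continuous_into_L2 n (heat_comb n a b f g)"
  unfolding heat_comb_def[abs_def]
  by (rule continuous_into_L2_add[OF continuous_into_L2_cmult[OF assms(3) heat_continuous_into_L2[OF assms(1)]]
      continuous_into_L2_cmult[OF assms(4) heat_continuous_into_L2[OF assms(2)]]])

lemma heat_comb_weak_deriv:
  assumes f: "f \<in> sobolev n k" and g: "g \<in> sobolev n k" and i: "is \<in> lists {..<n}" "length is \<le> k" and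
      t: "t \<ge> 0"
  shows "has_weak_deriv n is (heat_comb n a b f g t) (heat_comb n a b (weak_deriv n is f) (weak_deriv n is
      g) t)"
  unfolding heat_comb_eta
  by (intro has_weak_deriv_linear has_weak_deriv_heat heat_L2 weak_deriv_spec[OF f i] weak_deriv_spec[OF g i]
      sobolev_L2[OF f] sobolev_L2[OF g] i t)

lemma heat_comb_continuous_into_H2:
  assumes f: "f \<in> H2 n" and g: "g \<in> H2 n" and a: "continuous_on {0..} a" and b: "continuous_on {0..} b"
  shows "continuous_into_H2 n (heat_comb n a b f g)"
proof (rule continuous_into_H2I)
  show "heat_comb n a b f g t \<in> L2 n" if "t \<ge> 0" for t
    by (rule continuous_into_L2D(1)[OF heat_comb_continuous_into_L2[OF sobolev_L2[OF f] sobolev_L2[OF g] a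
        b] that])
  fix "is" assume i: "is \<in> lists {..<n}" "length is \<le> 2"
  show "continuous_into_L2 n (heat_comb n a b (weak_deriv n is f) (weak_deriv n is g))"
    by (intro heat_comb_continuous_into_L2 weak_deriv_spec(1)[OF f i] weak_deriv_spec(1)[OF g i] a b)
  show "has_weak_deriv n is (heat_comb n a b f g t) (heat_comb n a b (weak_deriv n is f) (weak_deriv n is g)
      t)" if "t \<ge> 0" for t
    by (rule heat_comb_weak_deriv[OF f g i that])
qed

lemma heat_comb_laplacian:
  assumes f: "f \<in> H2 n" and g: "g \<in> H2 n" and t: "t \<ge> 0" and a: "continuous_on {0..} a" and
      b: "continuous_on {0..} b"
  shows "AE x in Rn n. laplacian n (heat_comb n a b f g t) x
      = heat_comb n a b (laplacian n f) (laplacian n g) t x"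
proof -
  let ?w = "\<lambda>i. heat_comb n a b (weak_deriv n [i, i] f) (weak_deriv n [i, i] g) t"
  have wd: "weak_deriv n [i, i] f \<in> L2 n" "weak_deriv n [i, i] g \<in> L2 n" if "i < n" for i
    using that by (auto intro!: weak_deriv_spec(1)[OF f] weak_deriv_spec(1)[OF g])
  have 1: "AE x in Rn n. laplacian n (heat_comb n a b f g t) x = (\<Sum>i<n. ?w i x)"
  proof (rule laplacian_AE)
    show "heat_comb n a b f g t \<in> H2 n"
      using heat_comb_continuous_into_H2[OF f g a b] t unfolding continuous_into_H2_def by blast
    show "?w i \<in> L2 n" if "i < n" for i
      unfolding heat_comb_eta by (intro L2_intros heat_L2 wd that t)
    show "has_weak_deriv n [i, i] (heat_comb n a b f g t) (?w i)" if "i < n" for i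
      by (rule heat_comb_weak_deriv[OF f g _ _ t]) (use that in auto)
  qed
  have 2: "(\<Sum>i<n. ?w i x) = heat_comb n a b (laplacian n f) (laplacian n g) t x" if x: "x \<in> space (Rn n)" for x
  proof -
    have "heat n t (laplacian n f) x = (\<Sum>i<n. heat n t (weak_deriv n [i, i] f) x)"
      unfolding laplacian_def[abs_def] by (rule heat_sum[OF t _ x]) (use wd in auto)
    moreover have "heat n t (laplacian n g) x = (\<Sum>i<n. heat n t (weak_deriv n [i, i] g) x)"
      unfolding laplacian_def[abs_def] by (rule heat_sum[OF t _ x]) (use wd in auto)
    ultimately show ?thesis by (simp add: heat_comb_def sum.distrib sum_distrib_left)
  qed
  show ?thesis using 1 AE_space by eventually_elim (simp add: 2)
qed

lemma heat_comb_time_deriv: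
  assumes f: "f \<in> H2 n" and g: "g \<in> H2 n"
    and a: "\<And>t. (a has_real_derivative a' t) (at t)" and b: "\<And>t. (b has_real_derivative b' t) (at t)"
  shows "has_time_deriv_L2 n (heat_comb n a b f g)
    (\<lambda>t x. heat_comb n a' b' f g t x + heat_comb n a b (laplacian n f) (laplacian n g) t x)"
proof -
  note L = sobolev_L2[OF f] sobolev_L2[OF g] laplacian_L2[OF f] laplacian_L2[OF g]
  have A: "has_time_deriv_L2 n (\<lambda>t x. a t * heat n t f x) (\<lambda>t x. a' t * heat n t f x + a t * heat n t
      (laplacian n f) x)"
    by (rule has_time_deriv_L2_cmult[OF has_field_derivative_at_within[OF a] heat_time_deriv[OF f]])
      (auto intro!: heat_L2 L)
  have B: "has_time_deriv_L2 n (\<lambda>t x. b t * heat n t g x) (\<lambda>t x. b' t * heat n t g x + b t * heat n t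
      (laplacian n g) x)"
    by (rule has_time_deriv_L2_cmult[OF has_field_derivative_at_within[OF b] heat_time_deriv[OF g]])
      (auto intro!: heat_L2 L)
  have "has_time_deriv_L2 n (\<lambda>t x. a t * heat n t f x + b t * heat n t g x)
      (\<lambda>t x. (a' t * heat n t f x + a t * heat n t (laplacian n f) x) + (b' t * heat n t g x + b t * heat n
          t (laplacian n g) x))"
    by (rule has_time_deriv_L2_add[OF A B]; intro L2_add L2_cmult heat_L2 L; assumption)
  then show ?thesis
    unfolding heat_comb_def[abs_def] by (simp add: add.assoc add.left_commute)
qed

text \<open>The hypotheses on the coefficients say \<open>C' = M C\<close> and
  \<open>C 0 = I\<close> for the matrix \<open>C\<close> of the four functions. Differentiating
  \<open>C\<close> yields the zeroth order terms, differentiating the flow yields the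
  Laplacian.\<close>

lemma solution_exists:
  fixes c11 c12 c21 c22 :: "real \<Rightarrow> real"
  assumes u0: "u\<^sub>0 \<in> H2 n" and v0: "v\<^sub>0 \<in> H2 n" and eps: "\<epsilon> > 0"
    and d11: "\<And>t. (c11 has_real_derivative (\<alpha> / \<epsilon> - \<mu>) * c11 t + \<beta> / \<epsilon> * c21 t) (at t)"
    and d12: "\<And>t. (c12 has_real_derivative (\<alpha> / \<epsilon> - \<mu>) * c12 t + \<beta> / \<epsilon> * c22 t) (at t)"
    and d21: "\<And>t. (c21 has_real_derivative \<gamma> * c11 t + (\<delta> - \<nu>) * c21 t) (at t)"
    and d22: "\<And>t. (c22 has_real_derivative \<gamma> * c12 t + (\<delta> - \<nu>) * c22 t) (at t)"
    and init: "c11 0 = 1" "c12 0 = 0" "c21 0 = 0" "c22 0 = 1"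
  shows "is_solution n \<epsilon> \<mu> \<nu> \<alpha> \<beta> \<gamma> \<delta> u\<^sub>0 v\<^sub>0 (heat_comb n c11 c12 u\<^sub>0 v\<^sub>0) (heat_comb n c21 c22 u\<^sub>0 v\<^sub>0)"
proof -
  let ?D = "\<lambda>a b a' b' t x. heat_comb n a' b' u\<^sub>0 v\<^sub>0 t x + heat_comb n a b (laplacian n u\<^sub>0) (laplacian n
      v\<^sub>0) t x"
  let ?a11 = "\<lambda>t. (\<alpha> / \<epsilon> - \<mu>) * c11 t + \<beta> / \<epsilon> * c21 t" and ?a12 = "\<lambda>t. (\<alpha> / \<epsilon> - \<mu>) * c12 t + \<beta> / \<epsilon> * c22 t"
  let ?a21 = "\<lambda>t. \<gamma> * c11 t + (\<delta> - \<nu>) * c21 t" and ?a22 = "\<lambda>t. \<gamma> * c12 t + (\<delta> - \<nu>) * c22 t"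
  note L = sobolev_L2[OF u0] sobolev_L2[OF v0] laplacian_L2[OF u0] laplacian_L2[OF v0]
  have c: "continuous_on {0..} c11" "continuous_on {0..} c12" "continuous_on {0..} c21"
      "continuous_on {0..} c22"
    by (rule DERIV_continuous_on[OF has_field_derivative_at_within], rule d11 d12 d21 d22)+
  have ca: "continuous_on {0..} ?a11" "continuous_on {0..} ?a12" "continuous_on {0..} ?a21"
      "continuous_on {0..} ?a22"
    using c eps by (auto intro!: continuous_intros)
  show ?thesis
    unfolding is_solution_def
  proof (intro conjI exI allI impI)
    show "continuous_into_H2 n (heat_comb n c11 c12 u\<^sub>0 v\<^sub>0)"
        "continuous_into_H2 n (heat_comb n c21 c22 u\<^sub>0 v\<^sub>0)"
      by (intro heat_comb_continuous_into_H2 u0 v0 c)+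
    show "has_time_deriv_L2 n (heat_comb n c11 c12 u\<^sub>0 v\<^sub>0) (?D c11 c12 ?a11 ?a12)"
      by (rule heat_comb_time_deriv[OF u0 v0 d11 d12])
    show "has_time_deriv_L2 n (heat_comb n c21 c22 u\<^sub>0 v\<^sub>0) (?D c21 c22 ?a21 ?a22)"
      by (rule heat_comb_time_deriv[OF u0 v0 d21 d22])
    show "continuous_into_L2 n (?D c11 c12 ?a11 ?a12)" "continuous_into_L2 n (?D c21 c22 ?a21 ?a22)"
      by (intro continuous_into_L2_add heat_comb_continuous_into_L2 L c ca)+
    show "AE x in Rn n. heat_comb n c11 c12 u\<^sub>0 v\<^sub>0 0 x = u\<^sub>0 x \<and> heat_comb n c21 c22 u\<^sub>0 v\<^sub>0 0 x = v\<^sub>0 x"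
      by (simp add: heat_comb_def init)
    fix t :: real assume t: "t \<ge> 0"
    show "AE x in Rn n.
        \<epsilon> * ?D c11 c12 ?a11 ?a12 t x = \<epsilon> * (laplacian n (heat_comb n c11 c12 u\<^sub>0 v\<^sub>0 t) x - \<mu> * heat_comb n
            c11 c12 u\<^sub>0 v\<^sub>0 t x)
          + \<alpha> * heat_comb n c11 c12 u\<^sub>0 v\<^sub>0 t x + \<beta> * heat_comb n c21 c22 u\<^sub>0 v\<^sub>0 t x \<and>
        ?D c21 c22 ?a21 ?a22 t x = laplacian n (heat_comb n c21 c22 u\<^sub>0 v\<^sub>0 t) x - \<nu> * heat_comb n c21 c22
            u\<^sub>0 v\<^sub>0 t x
          + \<gamma> * heat_comb n c11 c12 u\<^sub>0 v\<^sub>0 t x + \<delta> * heat_comb n c21 c22 u\<^sub>0 v\<^sub>0 t x"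
      using heat_comb_laplacian[OF u0 v0 t c(1,2)] heat_comb_laplacian[OF u0 v0 t c(3,4)]
    proof eventually_elim
      case (elim x)
      have "\<epsilon> * heat_comb n ?a11 ?a12 u\<^sub>0 v\<^sub>0 t x
          = - \<epsilon> * \<mu> * heat_comb n c11 c12 u\<^sub>0 v\<^sub>0 t x + \<alpha> * heat_comb n c11 c12 u\<^sub>0 v\<^sub>0 t x + \<beta> * heat_comb
              n c21 c22 u\<^sub>0 v\<^sub>0 t x"
        using eps by (simp add: heat_comb_def field_simps)
      moreover have "heat_comb n ?a21 ?a22 u\<^sub>0 v\<^sub>0 t x
          = - \<nu> * heat_comb n c21 c22 u\<^sub>0 v\<^sub>0 t x + \<gamma> * heat_comb n c11 c12 u\<^sub>0 v\<^sub>0 t x + \<delta> * heat_comb n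
              c21 c22 u\<^sub>0 v\<^sub>0 t x"
        by (simp add: heat_comb_def algebra_simps)
      ultimately show ?case using elim by (simp add: algebra_simps)
    qed
  qed
qed

section \<open>Uniqueness and the solution formula\<close>

lemma solution_L2:
  assumes "continuous_into_H2 n u" "t \<ge> 0" shows "u t \<in> H2 n" "u t \<in> L2 n"
  using assms sobolev_L2[of "u t" n 2] by (auto simp: continuous_into_H2_def)

text \<open>The hypotheses on \<open>a\<close> and \<open>b\<close> say that the row
  \<open>(a, b)\<close> has derivative \<open>- (a, b) M\<close>, which is chosen to cancel the
  zeroth order terms; the backward flow of \<phi> cancels the Laplacian.\<close>

lemma solution_backward_dual:
  fixes a b :: "real \<Rightarrow> real"
  assumes sol: "is_solution n \<epsilon> \<mu> \<nu> \<alpha> \<beta> \<gamma> \<delta> u\<^sub>0 v\<^sub>0 u v" and u0: "u\<^sub>0 \<in> L2 n" and v0: "v\<^sub>0 \<in> L2 n"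
    and eps: "\<epsilon> > 0" and T: "T > 0" and \<phi>: "\<phi> \<in> heat_regular n"
    and a: "\<And>t. (a has_real_derivative - ((\<alpha> / \<epsilon> - \<mu>) * a t + \<gamma> * b t)) (at t)"
    and b: "\<And>t. (b has_real_derivative - (\<beta> / \<epsilon> * a t + (\<delta> - \<nu>) * b t)) (at t)"
  shows "ip n (\<lambda>x. a T * u T x + b T * v T x) \<phi> = ip n (heat n T (\<lambda>x. a 0 * u\<^sub>0 x + b 0 * v\<^sub>0 x)) \<phi>"
proof -
  obtain u' v' where u': "has_time_deriv_L2 n u u'" "continuous_into_L2 n u'"
    and v': "has_time_deriv_L2 n v v'" "continuous_into_L2 n v'"
    and eq: "\<And>t. t \<ge> 0 \<Longrightarrow> AE x in Rn n.
         \<epsilon> * u' t x = \<epsilon> * (laplacian n (u t) x - \<mu> * u t x) + \<alpha> * u t x + \<beta> * v t x \<and>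
         v' t x = (laplacian n (v t) x - \<nu> * v t x) + \<gamma> * u t x + \<delta> * v t x"
    using sol unfolding is_solution_def by blast
  have uH: "continuous_into_H2 n u" and vH: "continuous_into_H2 n v"
    and init: "AE x in Rn n. u 0 x = u\<^sub>0 x \<and> v 0 x = v\<^sub>0 x"
    using sol unfolding is_solution_def by blast+
  note uL = solution_L2(2)[OF uH] and vL = solution_L2(2)[OF vH]
    and u'L = continuous_into_L2D(1)[OF u'(2)] and v'L = continuous_into_L2D(1)[OF v'(2)]
  note \<phi>L = heat_regular_L2[OF \<phi>] and \<phi>T = heat_regular_test[OF \<phi>]
  let ?a' = "\<lambda>t. - ((\<alpha> / \<epsilon> - \<mu>) * a t + \<gamma> * b t)" and ?b' = "\<lambda>t. - (\<beta> / \<epsilon> * a t + (\<delta> - \<nu>) * b t)"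
  define Z where "Z = (\<lambda>t x. a t * u t x + b t * v t x)"
  define Z' where "Z' = (\<lambda>t x. (?a' t * u t x + a t * u' t x) + (?b' t * v t x + b t * v' t x))"
  have ZL: "Z t \<in> L2 n" and Z'L: "Z' t \<in> L2 n" if "t \<ge> 0" for t
    unfolding Z_def Z'_def by (intro L2_add L2_cmult uL vL u'L v'L that)+
  have Zd: "has_time_deriv_L2 n Z Z'"
    unfolding Z_def Z'_def
    by (intro has_time_deriv_L2_add has_time_deriv_L2_cmult[OF has_field_derivative_at_within[OF a] u'(1)]
        has_time_deriv_L2_cmult[OF has_field_derivative_at_within[OF b] v'(1)] L2_add L2_cmult uL vL u'L v'L)
  \<comment> \<open>The flow has a meaning only for nonnegative times, so \<open>W\<close> is used
    up to time \<open>T\<close>, and all derivatives below are taken within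
    \<open>{0..T}\<close>.\<close>
  define W where "W = (\<lambda>t. heat n (T - t) \<phi>)"
  define W' where "W' = (\<lambda>t x. - heat n (T - t) (test_laplacian n \<phi>) x)"
  have WL: "W t \<in> L2 n" and W'L: "W' t \<in> L2 n" if "t \<le> T" for t
    unfolding W_def W'_def using that by (auto intro!: heat_L2 L2_uminus \<phi>L test_laplacian_L2 \<phi>T)
  have Wd: "((\<lambda>s. norm_L2 n (\<lambda>x. (W s x - W t x) / (s - t) - W' t x)) \<longlongrightarrow> 0) (at t within {0..T})"
    if t: "0 \<le> t" "t \<le> T" for t
  proof -
    let ?q = "\<lambda>r x. (heat n r \<phi> x - heat n (T - t) \<phi> x) / (r - (T - t)) - heat n (T - t) (test_laplacian n \<phi>) x"
    have 1: "((\<lambda>r. norm_L2 n (?q r)) \<longlongrightarrow> 0) (at (T - t) within {0..})"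
      using heat_regular_time_deriv[OF \<phi>] t by simp
    have "filterlim (\<lambda>s. T - s) (at (T - t) within {0..}) (at t within {0..T})"
      unfolding filterlim_at by (auto simp: eventually_at_filter intro!: tendsto_intros)
    from filterlim_compose[OF 1 this]
    have 2: "((\<lambda>s. norm_L2 n (?q (T - s))) \<longlongrightarrow> 0) (at t within {0..T})" .
    have "norm_L2 n (?q (T - s)) = norm_L2 n (\<lambda>x. (W s x - W t x) / (s - t) - W' t x)" for s
    proof -
      \<comment> \<open>Time reversal changes the sign of the denominator and leaves the numerator
        alone; this sign is the one in \<open>W'\<close>.\<close>
      have "?q (T - s) x = - 1 * ((W s x - W t x) / (s - t) - W' t x)" for x
      proof -
        have "T - s - (T - t) = - (s - t)" by simp
        then show ?thesis by (simp only: W_def W'_def divide_minus_right) simp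
      qed
      then show ?thesis by (simp only: norm_L2_cmult)
    qed
    with 2 show ?thesis by simp
  qed
  have deriv: "((\<lambda>s. ip n (Z s) (W s)) has_real_derivative 0) (at t within {0..T})" if t: "t \<in> {0..T}" for t
  proof -
    have t0: "t \<ge> 0" and tT: "t \<le> T" and Tt: "T - t \<ge> 0" using t by auto
    have "((\<lambda>s. norm_L2 n (\<lambda>x. (Z s x - Z t x) / (s - t) - Z' t x)) \<longlongrightarrow> 0) (at t within {0..T})"
      by (intro tendsto_within_subset[OF Zd[unfolded has_time_deriv_L2_def, rule_format, OF t0]]) auto
    then have D: "((\<lambda>s. ip n (Z s) (W s)) has_real_derivative ip n (Z' t) (W t) + ip n (Z t) (W' t)) (at t
        within {0..T})"
      by (rule ip_has_derivative[OF _ Wd[OF t0 tT]]) (use t ZL Z'L WL W'L in auto)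
    let ?A = "ip n (u t) (W t)" and ?B = "ip n (v t) (W t)"
    note uH2 = solution_L2(1)[OF uH t0] and vH2 = solution_L2(1)[OF vH t0]
    note lapL = laplacian_L2[OF uH2] laplacian_L2[OF vH2]
    have "AE x in Rn n. u' t x = laplacian n (u t) x + ((\<alpha> / \<epsilon> - \<mu>) * u t x + \<beta> / \<epsilon> * v t x)"
      using eq[OF t0]
    proof eventually_elim
      case (elim x)
      then have "u' t x = (\<epsilon> * (laplacian n (u t) x - \<mu> * u t x) + \<alpha> * u t x + \<beta> * v t x) / \<epsilon>"
        using eps by (simp add: eq_divide_eq mult.commute)
      also have "\<dots> = laplacian n (u t) x + ((\<alpha> / \<epsilon> - \<mu>) * u t x + \<beta> / \<epsilon> * v t x)"
        using eps by (simp add: field_simps)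
      finally show ?case .
    qed
    then have "ip n (u' t) (W t) = ip n (\<lambda>x. laplacian n (u t) x + ((\<alpha> / \<epsilon> - \<mu>) * u t x + \<beta> / \<epsilon> * v t x)) (W t)"
      by (rule ip_cong_AE) (intro L2_add L2_cmult lapL u'L uL vL WL t0 tT)+
    also have "\<dots> = ip n (laplacian n (u t)) (W t) + ((\<alpha> / \<epsilon> - \<mu>) * ?A + \<beta> / \<epsilon> * ?B)"
      using lapL uL[OF t0] vL[OF t0] WL[OF tT] by (simp add: ip_add_left ip_cmult_left ip_divide_left L2_add
          L2_cmult L2_divide)
    finally have Iu: "ip n (u' t) (W t) = ip n (laplacian n (u t)) (W t) + ((\<alpha> / \<epsilon> - \<mu>) * ?A + \<beta> / \<epsilon> * ?B)" .
    have "AE x in Rn n. v' t x = laplacian n (v t) x + (\<gamma> * u t x + (\<delta> - \<nu>) * v t x)"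
      using eq[OF t0] by eventually_elim (simp add: algebra_simps)
    then have "ip n (v' t) (W t) = ip n (\<lambda>x. laplacian n (v t) x + (\<gamma> * u t x + (\<delta> - \<nu>) * v t x)) (W t)"
      by (rule ip_cong_AE) (intro L2_add L2_cmult lapL v'L uL vL WL t0 tT)+
    also have "\<dots> = ip n (laplacian n (v t)) (W t) + (\<gamma> * ?A + (\<delta> - \<nu>) * ?B)"
      using lapL uL[OF t0] vL[OF t0] WL[OF tT] by (simp add: ip_add_left ip_cmult_left L2_add L2_cmult)
    finally have Iv: "ip n (v' t) (W t) = ip n (laplacian n (v t)) (W t) + (\<gamma> * ?A + (\<delta> - \<nu>) * ?B)" .
    have "ip n (Z' t) (W t) = (?a' t * ?A + a t * ip n (u' t) (W t)) + (?b' t * ?B + b t * ip n (v' t) (W t))"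
      unfolding Z'_def using u'L[OF t0] v'L[OF t0] uL[OF t0] vL[OF t0] WL[OF tT]
      by (simp add: ip_add_left ip_cmult_left L2_add L2_cmult)
    \<comment> \<open>The zeroth order terms of the system cancel against the derivatives of
      \<open>a\<close> and \<open>b\<close>.\<close>
    also have "\<dots> = a t * ip n (laplacian n (u t)) (W t) + b t * ip n (laplacian n (v t)) (W t)"
      unfolding Iu Iv by (simp add: algebra_simps)
    also have "\<dots> = - ip n (Z t) (W' t)"
    proof -
      have "W' t = (\<lambda>x. - 1 * heat n (T - t) (test_laplacian n \<phi>) x)" by (simp add: W'_def)
      moreover have "heat n (T - t) (test_laplacian n \<phi>) \<in> L2 n" by (intro heat_L2 Tt test_laplacian_L2 \<phi>T)
      ultimately have "- ip n (Z t) (W' t) = a t * ip n (u t) (heat n (T - t) (test_laplacian n \<phi>))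
          + b t * ip n (v t) (heat n (T - t) (test_laplacian n \<phi>))"
        unfolding Z_def using uL[OF t0] vL[OF t0]
        by (simp only: ip_cmult_right) (simp add: ip_add_left ip_cmult_left L2_cmult)
      \<comment> \<open>The Laplacian is moved onto the test function, where it matches the
        derivative of \<open>W\<close>.\<close>
      then show ?thesis
        using ip_heat_laplacian[OF uH2 \<phi>T Tt] ip_heat_laplacian[OF vH2 \<phi>T Tt] by (simp add: W_def)
    qed
    finally show ?thesis using D by simp
  qed
  have "\<exists>c. \<forall>t\<in>{0..T}. ip n (Z t) (W t) = c"
    by (rule has_field_derivative_zero_constant[OF _ deriv]) auto
  then have "ip n (Z T) (W T) = ip n (Z 0) (W 0)" using T by auto
  then have "ip n (Z T) \<phi> = ip n (Z 0) (heat n T \<phi>)" by (simp add: W_def)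
  \<comment> \<open>The initial condition holds only almost everywhere, which the inner product does
    not see.\<close>
  also have "\<dots> = ip n (\<lambda>x. a 0 * u\<^sub>0 x + b 0 * v\<^sub>0 x) (heat n T \<phi>)"
  proof (rule ip_cong_AE)
    show "AE x in Rn n. Z 0 x = a 0 * u\<^sub>0 x + b 0 * v\<^sub>0 x"
      using init by eventually_elim (simp add: Z_def)
  qed (use T in \<open>auto intro!: ZL heat_L2 L2_add L2_cmult u0 v0 \<phi>L\<close>)
  also have "\<dots> = ip n (heat n T (\<lambda>x. a 0 * u\<^sub>0 x + b 0 * v\<^sub>0 x)) \<phi>"
    using T by (intro heat_selfadjoint[symmetric] L2_add L2_cmult u0 v0 \<phi>L) auto
  finally show ?thesis by (simp add: Z_def)
qed

text \<open>Here \<open>(a, b)\<close> has derivative \<open>(a, b) M\<close>; reversed in time it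
  satisfies the backward system. A row of the matrix exponential starts at a unit vector, so the
  left-hand side becomes a single component of the solution.\<close>

lemma solution_eq_heat:
  fixes a b :: "real \<Rightarrow> real"
  assumes sol: "is_solution n \<epsilon> \<mu> \<nu> \<alpha> \<beta> \<gamma> \<delta> u\<^sub>0 v\<^sub>0 u v" and u0: "u\<^sub>0 \<in> L2 n" and v0: "v\<^sub>0 \<in> L2 n"
    and eps: "\<epsilon> > 0" and T: "T > 0"
    and a: "\<And>t. (a has_real_derivative (\<alpha> / \<epsilon> - \<mu>) * a t + \<gamma> * b t) (at t)"
    and b: "\<And>t. (b has_real_derivative \<beta> / \<epsilon> * a t + (\<delta> - \<nu>) * b t) (at t)"
  shows "AE x in Rn n. a 0 * u T x + b 0 * v T x
    = a T * conv n (heat_kernel n T) u\<^sub>0 x + b T * conv n (heat_kernel n T) v\<^sub>0 x"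
proof -
  have uH: "continuous_into_H2 n u" and vH: "continuous_into_H2 n v"
    using sol unfolding is_solution_def by blast+
  have rev: "((\<lambda>t. f (T - t)) has_real_derivative - d) (at t)" if "(f has_real_derivative d) (at (T - t))"
      for f d t
  proof -
    have "((\<lambda>t. T - t) has_real_derivative - 1) (at t)" by (auto intro!: derivative_eq_intros)
    from DERIV_chain2[of f d "\<lambda>t. T - t", OF that this] show ?thesis by simp
  qed
  \<comment> \<open>The differences are left unsimplified so that the statement is an instance for
    the reversed functions at the times \<open>T\<close> and 0.\<close>
  have "AE x in Rn n. a (T - T) * u T x + b (T - T) * v T x
      = heat n T (\<lambda>x. a (T - 0) * u\<^sub>0 x + b (T - 0) * v\<^sub>0 x) x"
  proof (rule L2_eq_AE)
    fix \<phi> assume "\<phi> \<in> heat_regular n"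
    from solution_backward_dual[OF sol u0 v0 eps T this rev[OF a] rev[OF b]]
    show "ip n (\<lambda>x. a (T - T) * u T x + b (T - T) * v T x) \<phi>
        = ip n (heat n T (\<lambda>x. a (T - 0) * u\<^sub>0 x + b (T - 0) * v\<^sub>0 x)) \<phi>" .
  qed (use T in \<open>auto intro!: L2_add L2_cmult heat_L2 u0 v0 solution_L2(2)[OF uH] solution_L2(2)[OF vH]\<close>)
  then show ?thesis using AE_space
  proof eventually_elim
    case (elim x)
    then show ?case using T heat_linear[of T u\<^sub>0 n v\<^sub>0 x "a T" "b T"] u0 v0 by (simp add: heat_def)
  qed
qed

section \<open>The kernels of the formula and the matrix exponential\<close>

lemma conv_scale_kernel: "conv n (\<lambda>y. c * k y) f x = c * conv n k f x"
  by (simp add: conv_def mult.assoc)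

text \<open>The exponentials are constant in space, so the combination of kernels is one scalar
  times the heat kernel and only that scalar has to leave the integral.\<close>

lemma conv_L_kernels:
  "conv n (\<lambda>y. r * L_kernel 1 n \<mu> \<nu> \<alpha> \<beta> \<gamma> \<delta> \<epsilon> t y + s * L_kernel (- 1) n \<mu> \<nu> \<alpha> \<beta> \<gamma> \<delta> \<epsilon> t y) f x
    = (r * exp ((\<alpha> / \<epsilon> - \<mu> + \<delta> - \<nu> + Re (Omega \<mu> \<nu> \<alpha> \<beta> \<gamma> \<delta> \<epsilon>)) / 2 * t)
      + s * exp ((\<alpha> / \<epsilon> - \<mu> + \<delta> - \<nu> - Re (Omega \<mu> \<nu> \<alpha> \<beta> \<gamma> \<delta> \<epsilon>)) / 2 * t)) * conv n (heat_kernel n t) f x"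
proof -
  have "L_kernel 1 n \<mu> \<nu> \<alpha> \<beta> \<gamma> \<delta> \<epsilon> t y
      = exp ((\<alpha> / \<epsilon> - \<mu> + \<delta> - \<nu> + Re (Omega \<mu> \<nu> \<alpha> \<beta> \<gamma> \<delta> \<epsilon>)) / 2 * t) * heat_kernel n t y"
    and "L_kernel (- 1) n \<mu> \<nu> \<alpha> \<beta> \<gamma> \<delta> \<epsilon> t y
      = exp ((\<alpha> / \<epsilon> - \<mu> + \<delta> - \<nu> - Re (Omega \<mu> \<nu> \<alpha> \<beta> \<gamma> \<delta> \<epsilon>)) / 2 * t) * heat_kernel n t y" for y
    by (simp_all add: L_kernel_def)
  then show ?thesis
    by (subst conv_scale_kernel[symmetric]) (simp only: distrib_right mult.assoc)
qed

text \<open>Multiplied by \<epsilon>^2 the expression becomes a polynomial in \<epsilon> whose value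
  at 0 is \<alpha>^2.\<close>

lemma discriminant_eventually_pos:
  fixes \<mu> \<nu> \<alpha> \<beta> \<gamma> \<delta> :: real
  assumes "\<alpha> \<noteq> 0"
  shows "\<forall>\<^sub>F \<epsilon> in at_right 0. 0 < (\<delta> - \<nu> - \<alpha> / \<epsilon> + \<mu>)\<^sup>2 + 4 * (\<beta> * \<gamma>) / \<epsilon>"
proof -
  have "((\<lambda>\<epsilon>. ((\<delta> - \<nu> + \<mu>) * \<epsilon> - \<alpha>)\<^sup>2 + 4 * (\<beta> * \<gamma>) * \<epsilon>) \<longlongrightarrow> ((\<delta> - \<nu> + \<mu>) * 0 - \<alpha>)\<^sup>2 + 4 * (\<beta> * \<gamma>) * 0)
      (at_right 0)"
    by (intro tendsto_intros)
  then have "\<forall>\<^sub>F \<epsilon> in at_right 0. 0 < ((\<delta> - \<nu> + \<mu>) * \<epsilon> - \<alpha>)\<^sup>2 + 4 * (\<beta> * \<gamma>) * \<epsilon>"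
    by (rule order_tendstoD(1)) (use assms in simp)
  moreover have "\<forall>\<^sub>F \<epsilon> in at_right (0::real). \<epsilon> > 0" by (simp add: eventually_at_filter)
  ultimately show ?thesis
  proof eventually_elim
    case (elim \<epsilon>)
    have "(\<delta> - \<nu> - \<alpha> / \<epsilon> + \<mu>)\<^sup>2 + 4 * (\<beta> * \<gamma>) / \<epsilon> = (((\<delta> - \<nu> + \<mu>) * \<epsilon> - \<alpha>)\<^sup>2 + 4 * (\<beta> * \<gamma>) * \<epsilon>) / \<epsilon>\<^sup>2"
      using elim by (simp add: field_simps power2_eq_square)
    then show ?case using elim by simp
  qed
qed

text \<open>For the matrix \<open>M\<close> with rows \<open>(m, p)\<close> and
  \<open>(q, d)\<close> the eigenvalues are \<open>kp\<close> and \<open>km\<close>, at distance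
  \<open>w\<close>. The four functions are the entries of
  \<open>(M - km I) / w * exp (kp t) + (kp I - M) / w * exp (km t)\<close>, a combination of the
  spectral projections. Both \<open>C' = M C\<close> and \<open>C' = C M\<close> are listed:
  existence differentiates columns, uniqueness rows.\<close>

lemma matrix_exponential:
  fixes m p q d :: real
  assumes D: "(d - m)\<^sup>2 + 4 * (p * q) > 0"
  defines "w \<equiv> sqrt ((d - m)\<^sup>2 + 4 * (p * q))"
  defines "kp \<equiv> (m + d + w) / 2" and "km \<equiv> (m + d - w) / 2"
  defines "c11 \<equiv> \<lambda>t. (m - km) / w * exp (kp * t) + (kp - m) / w * exp (km * t)"
    and "c12 \<equiv> \<lambda>t. p / w * exp (kp * t) + - p / w * exp (km * t)"
    and "c21 \<equiv> \<lambda>t. q / w * exp (kp * t) + - q / w * exp (km * t)"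
    and "c22 \<equiv> \<lambda>t. (d - km) / w * exp (kp * t) + (kp - d) / w * exp (km * t)"
  shows "c11 0 = 1" "c12 0 = 0" "c21 0 = 0" "c22 0 = 1"
    and "(c11 has_real_derivative m * c11 t + p * c21 t) (at t)"
        "(c12 has_real_derivative m * c12 t + p * c22 t) (at t)"
    and "(c21 has_real_derivative q * c11 t + d * c21 t) (at t)"
        "(c22 has_real_derivative q * c12 t + d * c22 t) (at t)"
    and "(c11 has_real_derivative m * c11 t + q * c12 t) (at t)"
        "(c12 has_real_derivative p * c11 t + d * c12 t) (at t)"
    and "(c21 has_real_derivative m * c21 t + q * c22 t) (at t)"
        "(c22 has_real_derivative p * c21 t + d * c22 t) (at t)"
proof -
  have w: "w > 0" using D by (simp add: w_def)
  have ww: "w * w = (d - m)\<^sup>2 + 4 * (p * q)" using D by (simp add: w_def)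
  have diff: "kp - km = w" by (simp add: kp_def km_def field_simps)
  show "c11 0 = 1" "c12 0 = 0" "c21 0 = 0" "c22 0 = 1"
    using w diff by (simp_all add: c11_def c12_def c21_def c22_def flip: add_divide_distrib)
  \<comment> \<open>The characteristic polynomial takes the value \<open>- p * q\<close> at
    \<open>m\<close> and at \<open>d\<close>; together with the trace identity \<open>S\<close> this
    is all that the coefficient comparisons use.\<close>
  have P: "(m - km) * (kp - m) = p * q" and Q: "(d - km) * (kp - d) = p * q"
    using ww by (simp_all add: kp_def km_def field_simps power2_eq_square)
  have S: "kp + km = m + d" by (simp add: kp_def km_def field_simps)
  \<comment> \<open>An equation between such combinations follows from comparing the coefficients of
    the two exponentials.\<close>
  have e: "((\<lambda>t. r / w * exp (kp * t) + s / w * exp (km * t)) has_real_derivative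
      x * (r1 / w * exp (kp * t) + s1 / w * exp (km * t)) + y * (r2 / w * exp (kp * t) + s2 / w * exp (km *
          t))) (at t)"
    if "r * kp = x * r1 + y * r2" "s * km = x * s1 + y * s2" for r s r1 s1 r2 s2 x y t
  proof -
    have "((\<lambda>t. r / w * exp (kp * t) + s / w * exp (km * t)) has_real_derivative
      (r * kp) / w * exp (kp * t) + (s * km) / w * exp (km * t)) (at t)"
      using w by (auto intro!: derivative_eq_intros simp: mult_ac)
    then show ?thesis
      unfolding that by (simp add: add_divide_distrib algebra_simps)
  qed
  have k1: "(m - km) * kp = m * (m - km) + p * q" "(kp - m) * km = m * (kp - m) - p * q"
    "(d - km) * kp = d * (d - km) + p * q" "(kp - d) * km = d * (kp - d) - p * q"
    using P Q by (simp_all add: algebra_simps)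
  show "(c11 has_real_derivative m * c11 t + p * c21 t) (at t)"
    unfolding c11_def c21_def by (rule e) (use k1 in simp_all)
  show "(c12 has_real_derivative m * c12 t + p * c22 t) (at t)"
    unfolding c12_def c22_def by (rule e) (use S in \<open>simp_all add: algebra_simps\<close>, algebra+)
  show "(c21 has_real_derivative q * c11 t + d * c21 t) (at t)"
    unfolding c11_def c21_def by (rule e) (use S in \<open>simp_all add: algebra_simps\<close>, algebra+)
  show "(c22 has_real_derivative q * c12 t + d * c22 t) (at t)"
    unfolding c12_def c22_def by (rule e) (use k1 in \<open>simp_all add: mult.commute\<close>)
  show "(c11 has_real_derivative m * c11 t + q * c12 t) (at t)"
    unfolding c11_def c12_def by (rule e) (use k1 in \<open>simp_all add: mult.commute\<close>)
  show "(c12 has_real_derivative p * c11 t + d * c12 t) (at t)"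
    unfolding c11_def c12_def by (rule e) (use S in \<open>simp_all add: algebra_simps\<close>, algebra+)
  show "(c21 has_real_derivative m * c21 t + q * c22 t) (at t)"
    unfolding c21_def c22_def by (rule e) (use S in \<open>simp_all add: algebra_simps\<close>, algebra+)
  show "(c22 has_real_derivative p * c21 t + d * c22 t) (at t)"
    unfolding c21_def c22_def by (rule e) (use k1 in simp_all)
qed

text \<open>Existence is asserted next to the formula, since a statement about all solutions would
  be vacuous without one; applied to every solution, the formula also gives uniqueness for positive
  times almost everywhere in space.\<close>

theorem lemma2p2:
  fixes \<mu> \<nu> \<alpha> \<beta> \<gamma> \<delta> :: real
  assumes "\<alpha> < 0" and "\<beta> \<noteq> 0" and "\<gamma> \<noteq> 0" and "\<delta> \<noteq> 0"
  shows "\<forall>\<^sub>F \<epsilon> in at_right 0.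
    Omega \<mu> \<nu> \<alpha> \<beta> \<gamma> \<delta> \<epsilon> \<in> \<real> - {0} \<and>
    (\<exists>\<rho> :: nat \<Rightarrow> real.
      \<forall>n\<ge>1. \<forall>u\<^sub>0\<in>H2 n. \<forall>v\<^sub>0\<in>H2 n.
        (\<exists>u v. is_solution n \<epsilon> \<mu> \<nu> \<alpha> \<beta> \<gamma> \<delta> u\<^sub>0 v\<^sub>0 u v) \<and>
        (\<forall>u v. is_solution n \<epsilon> \<mu> \<nu> \<alpha> \<beta> \<gamma> \<delta> u\<^sub>0 v\<^sub>0 u v \<longrightarrow>
          (\<forall>t>0.
            let Lp = L_kernel 1 n \<mu> \<nu> \<alpha> \<beta> \<gamma> \<delta> \<epsilon> t;
                Lm = L_kernel (- 1) n \<mu> \<nu> \<alpha> \<beta> \<gamma> \<delta> \<epsilon> t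
            in AE x in Rn n.
              u t x = conv n (\<lambda>y. \<rho> 1 * Lp y + \<rho> 2 * Lm y) u\<^sub>0 x
                    + conv n (\<lambda>y. \<rho> 3 * Lp y + \<rho> 4 * Lm y) v\<^sub>0 x \<and>
              v t x = conv n (\<lambda>y. \<rho> 5 * Lp y + \<rho> 6 * Lm y) u\<^sub>0 x
                    + conv n (\<lambda>y. \<rho> 7 * Lp y + \<rho> 8 * Lm y) v\<^sub>0 x)))"
proof -
  have "\<forall>\<^sub>F \<epsilon> in at_right (0::real). \<epsilon> > 0" by (simp add: eventually_at_filter)
  moreover have "\<forall>\<^sub>F \<epsilon> in at_right 0. 0 < (\<delta> - \<nu> - \<alpha> / \<epsilon> + \<mu>)\<^sup>2 + 4 * (\<beta> * \<gamma>) / \<epsilon>"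
    using assms by (intro discriminant_eventually_pos) simp
  ultimately show ?thesis
  proof eventually_elim
    case (elim \<epsilon>)
    define m where "m = \<alpha> / \<epsilon> - \<mu>"
    define p where "p = \<beta> / \<epsilon>"
    define d where "d = \<delta> - \<nu>"
    define w where "w = sqrt ((d - m)\<^sup>2 + 4 * (p * \<gamma>))"
    define kp where "kp = (m + d + w) / 2"
    define km where "km = (m + d - w) / 2"
    define c11 where "c11 = (\<lambda>t. (m - km) / w * exp (kp * t) + (kp - m) / w * exp (km * t))"
    define c12 where "c12 = (\<lambda>t. p / w * exp (kp * t) + - p / w * exp (km * t))"
    define c21 where "c21 = (\<lambda>t. \<gamma> / w * exp (kp * t) + - \<gamma> / w * exp (km * t))"
    define c22 where "c22 = (\<lambda>t. (d - km) / w * exp (kp * t) + (kp - d) / w * exp (km * t))"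
    have disc: "(\<delta> - \<nu> - \<alpha> / \<epsilon> + \<mu>)\<^sup>2 + 4 * (\<beta> * \<gamma>) / \<epsilon> = (d - m)\<^sup>2 + 4 * (p * \<gamma>)"
      by (simp add: m_def p_def d_def algebra_simps)
    then have D: "(d - m)\<^sup>2 + 4 * (p * \<gamma>) > 0" using elim by simp
    \<comment> \<open>The abbreviation \<open>w\<close> is folded first, because \<open>kp\<close>
      and \<open>km\<close> contain it.\<close>
    note M = matrix_exponential[OF D, folded w_def, folded kp_def km_def]
    have init: "c11 0 = 1" "c12 0 = 0" "c21 0 = 0" "c22 0 = 1"
      unfolding c11_def c12_def c21_def c22_def by (rule M(1-4))+
    note fold = c11_def c12_def c21_def c22_def m_def[symmetric] p_def[symmetric] d_def[symmetric]
    have columns: "(c11 has_real_derivative (\<alpha> / \<epsilon> - \<mu>) * c11 t + \<beta> / \<epsilon> * c21 t) (at t)"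
      "(c12 has_real_derivative (\<alpha> / \<epsilon> - \<mu>) * c12 t + \<beta> / \<epsilon> * c22 t) (at t)"
      "(c21 has_real_derivative \<gamma> * c11 t + (\<delta> - \<nu>) * c21 t) (at t)"
      "(c22 has_real_derivative \<gamma> * c12 t + (\<delta> - \<nu>) * c22 t) (at t)" for t
      unfolding fold by (rule M(5-8))+
    have rows: "(c11 has_real_derivative (\<alpha> / \<epsilon> - \<mu>) * c11 t + \<gamma> * c12 t) (at t)"
      "(c12 has_real_derivative \<beta> / \<epsilon> * c11 t + (\<delta> - \<nu>) * c12 t) (at t)"
      "(c21 has_real_derivative (\<alpha> / \<epsilon> - \<mu>) * c21 t + \<gamma> * c22 t) (at t)"
      "(c22 has_real_derivative \<beta> / \<epsilon> * c21 t + (\<delta> - \<nu>) * c22 t) (at t)" for t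
      unfolding fold by (rule M(9-12))+
    have w: "w > 0" using D by (simp add: w_def)
    \<comment> \<open>The principal complex root of a positive real number is its real root.\<close>
    have Om: "Omega \<mu> \<nu> \<alpha> \<beta> \<gamma> \<delta> \<epsilon> = complex_of_real w"
      unfolding Omega_def disc w_def using D by (intro of_real_sqrt[symmetric]) simp
    have kp: "(\<alpha> / \<epsilon> - \<mu> + \<delta> - \<nu> + Re (Omega \<mu> \<nu> \<alpha> \<beta> \<gamma> \<delta> \<epsilon>)) / 2 = kp"
      and km: "(\<alpha> / \<epsilon> - \<mu> + \<delta> - \<nu> - Re (Omega \<mu> \<nu> \<alpha> \<beta> \<gamma> \<delta> \<epsilon>)) / 2 = km"
      by (simp_all add: Om kp_def km_def m_def d_def algebra_simps)
    \<comment> \<open>The entries of the two spectral projections. The coefficients are numbered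
      from 1 and list positions from 0, hence \<open>k - 1\<close>.\<close>
    define \<rho> where "\<rho> = (\<lambda>k::nat. [(m - km) / w, (kp - m) / w, p / w, - p / w,
        \<gamma> / w, - \<gamma> / w, (d - km) / w, (kp - d) / w] ! (k - 1))"
    have \<rho>: "\<rho> 1 = (m - km) / w" "\<rho> 2 = (kp - m) / w" "\<rho> 3 = p / w" "\<rho> 4 = - p / w"
      "\<rho> 5 = \<gamma> / w" "\<rho> 6 = - \<gamma> / w" "\<rho> 7 = (d - km) / w" "\<rho> 8 = (kp - d) / w"
      by (simp_all add: \<rho>_def)
    show ?case
    \<comment> \<open>The witness is fixed before \<open>n\<close> and the initial data are
      introduced, so it depends on the parameters alone.\<close>
    proof (intro conjI exI[of _ \<rho>] allI impI ballI)
      show "Omega \<mu> \<nu> \<alpha> \<beta> \<gamma> \<delta> \<epsilon> \<in> \<real> - {0}" using w by (simp add: Om)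
      fix n :: nat and u\<^sub>0 v\<^sub>0 assume u0: "u\<^sub>0 \<in> H2 n" and v0: "v\<^sub>0 \<in> H2 n"
      show "\<exists>u v. is_solution n \<epsilon> \<mu> \<nu> \<alpha> \<beta> \<gamma> \<delta> u\<^sub>0 v\<^sub>0 u v"
        using solution_exists[OF u0 v0 elim(1) columns init] by blast
      fix u v and t :: real
      assume sol: "is_solution n \<epsilon> \<mu> \<nu> \<alpha> \<beta> \<gamma> \<delta> u\<^sub>0 v\<^sub>0 u v" and t: "t > 0"
      note formula = solution_eq_heat[OF sol sobolev_L2[OF u0] sobolev_L2[OF v0] elim(1) t]
      \<comment> \<open>The first row of the matrix exponential starts at \<open>(1, 0)\<close> and
        so isolates \<open>u\<close>; the second starts at \<open>(0, 1)\<close> and isolates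
        \<open>v\<close>.\<close>
      have "AE x in Rn n. u t x = c11 t * conv n (heat_kernel n t) u\<^sub>0 x + c12 t * conv n (heat_kernel n t) v\<^sub>0 x"
        using formula[OF rows(1,2)] by (simp add: init)
      moreover have "AE x in Rn n. v t x = c21 t * conv n (heat_kernel n t) u\<^sub>0 x + c22 t * conv n (heat_kernel n t) v\<^sub>0 x"
        using formula[OF rows(3,4)] by (simp add: init)
      ultimately show "let Lp = L_kernel 1 n \<mu> \<nu> \<alpha> \<beta> \<gamma> \<delta> \<epsilon> t;
                Lm = L_kernel (- 1) n \<mu> \<nu> \<alpha> \<beta> \<gamma> \<delta> \<epsilon> t
            in AE x in Rn n.
              u t x = conv n (\<lambda>y. \<rho> 1 * Lp y + \<rho> 2 * Lm y) u\<^sub>0 x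
                    + conv n (\<lambda>y. \<rho> 3 * Lp y + \<rho> 4 * Lm y) v\<^sub>0 x \<and>
              v t x = conv n (\<lambda>y. \<rho> 5 * Lp y + \<rho> 6 * Lm y) u\<^sub>0 x
                    + conv n (\<lambda>y. \<rho> 7 * Lp y + \<rho> 8 * Lm y) v\<^sub>0 x"
        unfolding Let_def conv_L_kernels kp km \<rho> c11_def c12_def c21_def c22_def
        by eventually_elim (rule conjI)
    qed
  qed
qed


end
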